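(* Let $(\mathcal{S},\mathcal{A},r,p_\theta)$, $\theta\in\Theta$, be a family of Markov decision processes with true parameter $\theta_0$, let $\Pi$ be a class of stationary policies with optimal policies $\pi_\theta^*\in\Pi$, and let the data be generated by $\epsilon$-greedy Thompson sampling (defined in the context) with exploration rates $\{\delta_t\}_{t\ge0}$ and priors $\{P_t\}_{t\ge0}$; let $\pi$ denote the resulting policy. Assume: (A) There exist two positive integers $k,l$, a non-increasing sequence of positive numbers $\{\alpha_i\}_{i\ge0}$ and two non-negative functions $\mu,\nu$ on $\mathcal{S}\times\mathcal{A}$ such that for all $\theta\in\Theta$, $i\ge0$ and all possible $\widetilde H_i$, $\alpha_i\mu(\cdot,\cdot)\le\frac1k\sum_{j=1}^kp^{\widetilde H_i,j}_{\theta,\pi}(\cdot,\cdot)$ and $p^{\widetilde H_i,l}_{\theta,\pi}(\cdot,\cdot)\le\nu(\cdot,\cdot)$. (B) With $K>0,\xi\in(0,1)$ testing constants for $(k,l,\{\alpha_i\},\mu,\nu)$ (see context) and $n$ a fixed positive integer: $\epsilon_t>0$, $\epsilon_t\to0$, $\bar\epsilon_t=\big(\sum_{i=0}^{\lfloor t/(k+l)\rfloor-1}\alpha_{i(k+l)}\epsilon_t^2/t\big)^{1/2}$, $1/(t\bar\epsilon_t^2)=\mathcal{O}(1)$, and for every sufficiently large $j\in\mathbb{N}$ and every $t\ge k+l$, $$\sup_{\epsilon>\epsilon_t}\log N\Big(\tfrac12\alpha^{1/2}_{(\lfloor t/(k+l)\rfloor-1)(k+l)}\xi\epsilon,\{\theta\in\Theta:d_\mu(\theta,\theta_0)<\epsilon\},d_\nu\Big)\le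 t\bar\epsilon_t^2,$$ $$\frac{P_t(\theta\in\Theta:j\epsilon_t<d_\mu(\theta,\theta_0)\le(j+1)\epsilon_t)}{P_t(B_t(\theta_0,\bar\epsilon_t;n))}\le\exp\{Kt\bar\epsilon_t^2j^2/2\}.$$ (C) $\lambda(\mathcal{S},\mathcal{A})<\infty$ and there exist positive $C_1,C_2,C_3,C_4$ with $\gamma C_1C_2\lambda(\mathcal{S},\mathcal{A})<1$ such that $p_{\tilde\pi_t}(a|H_t)\le C_1$ for all $a\in\mathcal{A}$, $\tilde\pi\in\Pi$, $H_t$, $t\ge0$; $p_\theta(s'|s,a)\le C_2$ for all $s,s'\in\mathcal{S},a\in\mathcal{A},\theta\in\Theta$; $|p_\theta(s'|s,a)-p_{\theta_0}(s'|s,a)|\le C_3d_\mu(\theta,\theta_0)^\rho$ for all $s,s'\in\mathcal{S},a\in\mathcal{A},\theta\in\Theta$ and some $\rho\in(0,1]$; and $|r(s,a)|\le C_4$ for all $s\in\mathcal{S},a\in\mathcal{A}$. Moreover suppose: (i) $\bar\epsilon_t\ge t^{-\beta}$ for some $\beta\in(0,\frac12)$ with $n(1-2\beta)>2$; (ii) there exists $b>0$ such that $Q_{\theta_0}(s,\pi^*_{\theta_0,t}(s),\pi^*_{\theta_0})\ge Q_{\theta_0}(s,a,\pi^*_{\theta_0})+b$ for all $s\in\mathcal{S}$ and all $a\ne\pi^*_{\theta_0,t}(s)$; (iii) there exists a non-decreasing function $f$ such that $\sum_{i=0}^t\delta_i\le f(t)$ and $f(t)\to\infty$ as $t\to\infty$.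 Then for every $\delta\in(0,1)$ there exists $T_0\in\mathbb{N}$ such that for all $T\ge T_0$ and all $d>0$, $$P_{\theta_0}\Big(\sum_{t=0}^T1(A_t\ne\pi^*_{\theta_0,t}(S_t))\le f(T)^{1+d}+B(\delta)\Big)\ge1-\delta,$$ where $B(\delta)$ does not depend on $T$; and for sufficiently large $M$, $$P_T(\theta\in\Theta:\ d_\mu(\theta,\theta_0)>M\epsilon_T\mid H_T)\to0\quad\text{almost surely as }T\to\infty.$$
   Context: A Markov decision process (MDP) $(\mathcal{S},\mathcal{A},r,p_\theta)$ has state space $\mathcal{S}$, action space $\mathcal{A}$, reward function $r:\mathcal{S}\times\mathcal{A}\to\mathbb{R}$ and transition density $p_\theta(S_{t+1}|S_t,A_t)$, the conditional density of $S_{t+1}$ given $S_t,A_t$, for $t\in\{0,1,2,\dots\}$, indexed by $\theta\in\Theta$, where $\Theta$ may be infinite dimensional. The reward is $R_t=r(S_t,A_t)$. The history is $H_t=(S_0,A_0,R_0,\dots,S_{t-1},A_{t-1},R_{t-1},S_t)$, and $\widetilde H_t=(H_t,A_t,R_t)$. A policy $\pi$ is an infinite sequence of functions $\pi_t$ mapping histories $H_t$ to probability distributions on $\mathcal{A}$; $A_t$ is drawn from $\pi_t(H_t)$, with density $p_{\pi_t}(\cdot|H_t)$. A policy is stationary if $\pi_t(H_t)$ depends only on the current state $S_t$. $P_{\theta,\pi},\mathbb{E}_{\theta,\pi}$ are the probability and expectation induced by dynamics $\theta$ and policy $\pi$; $p^{(t)}_{\theta,\pi}$ is the density of $H_t$.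 Transition densities are with respect to a measure $m$ on $\mathcal{S}$, policy densities with respect to a measure $\kappa$ on $\mathcal{A}$, and $\lambda=m\otimes\kappa$ is the reference finite measure on $\mathcal{S}\times\mathcal{A}$, of total mass $\lambda(\mathcal{S},\mathcal{A})$. $p^{\widetilde H_i,j}_{\theta,\pi}$ is the density with respect to $\lambda$ of the conditional distribution of $(S_{i+j},A_{i+j})$ given $\widetilde H_i$ under $P_{\theta,\pi}$. With discount factor $\gamma\in(0,1]$, $V_\theta(\pi)=\mathbb{E}_{\theta,\pi}(\sum_{t=0}^\infty\gamma^tR_t)$ and $Q_\theta(s,a,\pi)=\mathbb{E}_{\theta,\pi}[\sum_{t=0}^\infty\gamma^tR_t\mid S_0=s,A_0=a]$. For each $\theta$, $\pi^*_\theta\in\Pi$ satisfies $V_\theta(\pi_\theta^* )\ge V_\theta(\tilde\pi)$ for all $\tilde\pi\in\Pi$; $\pi^*_{\theta,t}$ does not depend on $t$ and selects $\pi^*_{\theta,t}(H_t)=\pi^*_{\theta,t}(S_t)=\mathrm{argmax}_{a\in\mathcal{A}}Q_\theta(S_t,a,\pi_\theta^* )$. $\epsilon$-greedy Thompson sampling: given non-negative numbers $\{\delta_t\}$ and priors $\{P_t\}$ on $\Theta$, at each $t=0,1,2,\dots$: sample $u\sim U(0,1)$. If $u>\delta_t$, sample $\theta\sim P_t(\cdot|H_t)$ (the posterior of $\theta$ given $H_t$ under the prior $P_t$), compute $\pi_\theta^*$ and select $A_t\sim\pi^*_{\theta,t}(H_t)$; otherwise select $A_t$ from all actions in $\mathcal{A}$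 with equal probability. Then observe $R_t,S_{t+1}$. $P_{\theta_0}$ is the probability for this process under true dynamics $\theta_0$. $d_\mu^2(\theta,\theta')=\int h^2(p_\theta(\cdot|s,a),p_{\theta'}(\cdot|s,a))\mu(s,a)\,d\lambda(s,a)$ with $h^2(p_1,p_2)=\int(\sqrt{p_1(x)}-\sqrt{p_2(x)})^2dm(x)$; $d_\nu$ likewise. $N(\epsilon,\Theta',d)$ is the $\epsilon$-covering number of $\Theta'$ with respect to $d$. $K(p_1;p_2)=\mathbb{E}_{p_1}\log\frac{p_1(X)}{p_2(X)}$, $V_n(p_1;p_2)=\mathbb{E}_{p_1}|\log\frac{p_1(X)}{p_2(X)}-K(p_1;p_2)|^n$, and $B_t(\theta_0,\epsilon;n)=\{\theta\in\Theta:K(p^{(t)}_{\theta_0,\pi};p^{(t)}_{\theta,\pi})\le t\epsilon^2,\ V_n(p^{(t)}_{\theta_0,\pi};p^{(t)}_{\theta,\pi})\le t^{n/2}\epsilon^n\}$. Testing constants: $K>0$, $\xi\in(0,1)$ are constants such that for every $t\ge k+l$ and $\theta_1\in\Theta$ there is a test $\phi_t$ (measurable $[0,1]$-valued function of $H_t$) for which, whatever the distribution of $S_0$, both $\mathbb{E}_{\theta_0,\pi}\phi_t$ and $\sup_{\theta\in B}\mathbb{E}_{\theta,\pi}(1-\phi_t)$ are at most $\exp\{-K\sum_{i=0}^{\lfloor t/(k+l)\rfloor-1}\alpha_{i(k+l)}d^2_\mu(\theta_0,\theta_1)\}$, where $B=\{\theta\in\Theta:d_\nu(\theta,\theta_1)\le\xi\alpha^{1/2}_{(\lfloor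 t/(k+l)\rfloor-1)(k+l)}d_\mu(\theta_0,\theta_1)\}$; such constants exist under (A). *)

theory Defs
  imports "HOL-Probability.Probability"
begin

section \<open>Families of Markov decision processes\<close>

text \<open>The state space, the action space and the parameter set are the carriers of the measures
  \<open>states\<close> (the reference measure \<open>m\<close>), \<open>actions\<close> (the reference measure
  \<open>\<kappa>\<close>) and \<open>params\<close>. Of \<open>params\<close> only the carrier and the sigma-algebra
  matter. \<open>tdens D \<theta> s a s'\<close> is the transition density \<open>p\<^sub>\<theta>(s' | s, a)\<close>.\<close>

record ('s, 'a, 'p) mdp_family =
  states :: "'s measure"
  actions :: "'a measure"
  params :: "'p measure"
  tdens :: "'p \<Rightarrow> 's \<Rightarrow> 'a \<Rightarrow> 's \<Rightarrow> real"
  reward :: "'s \<Rightarrow> 'a \<Rightarrow> real"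

definition state_actions :: "('s, 'a, 'p) mdp_family \<Rightarrow> ('s \<times> 'a) measure" where
  "state_actions D = states D \<Otimes>\<^sub>M actions D"

definition wf_mdp_family :: "('s, 'a, 'p) mdp_family \<Rightarrow> bool" where
  "wf_mdp_family D \<longleftrightarrow>
     sigma_finite_measure (states D) \<and> sigma_finite_measure (actions D) \<and>
     (\<lambda>(\<theta>, (s, a), s'). tdens D \<theta> s a s')
       \<in> borel_measurable (params D \<Otimes>\<^sub>M (state_actions D \<Otimes>\<^sub>M states D)) \<and>
     (\<forall>\<theta>\<in>space (params D). \<forall>s\<in>space (states D). \<forall>a\<in>space (actions D).
        (\<forall>s'\<in>space (states D). 0 \<le> tdens D \<theta> s a s') \<and>
        (\<integral>\<^sup>+s'. ennreal (tdens D \<theta> s a s') \<partial>states D) = 1) \<and>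
     (\<lambda>(s, a). reward D s a) \<in> borel_measurable (state_actions D)"


section \<open>Histories and policies\<close>

text \<open>A history \<open>H\<^sub>t\<close> is encoded as the pair of \<open>(S\<^sub>i, A\<^sub>i)\<close>, \<open>i < t\<close>, and \<open>S\<^sub>t\<close>. The rewards
  are left out: they are determined by \<open>R\<^sub>i = r(S\<^sub>i, A\<^sub>i)\<close>.\<close>

type_synonym ('s, 'a) hist = "(nat \<Rightarrow> 's \<times> 'a) \<times> 's"

type_synonym ('s, 'a) policy = "nat \<Rightarrow> ('s, 'a) hist \<Rightarrow> 'a measure"

definition hist_space :: "('s, 'a, 'p) mdp_family \<Rightarrow> nat \<Rightarrow> ('s, 'a) hist measure" where
  "hist_space D t = PiM {0..<t} (\<lambda>_. state_actions D) \<Otimes>\<^sub>M states D"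

definition hist_at :: "nat \<Rightarrow> (nat \<Rightarrow> 's \<times> 'a) \<Rightarrow> ('s, 'a) hist" where
  "hist_at t \<omega> = (restrict \<omega> {0..<t}, fst (\<omega> t))"

definition is_policy :: "('s, 'a, 'p) mdp_family \<Rightarrow> ('s, 'a) policy \<Rightarrow> bool" where
  "is_policy D \<pi> \<longleftrightarrow> (\<forall>t. \<pi> t \<in> hist_space D t \<rightarrow>\<^sub>M prob_algebra (actions D))"

definition stationary_policy :: "('s, 'a, 'p) mdp_family \<Rightarrow> ('s, 'a) policy \<Rightarrow> bool" where
  "stationary_policy D \<pi> \<longleftrightarrow>
     (\<forall>t. \<exists>g. \<forall>H\<in>space (hist_space D t). \<pi> t H = g (snd H))"

definition select_policy :: "('s, 'a, 'p) mdp_family \<Rightarrow> ('s \<Rightarrow> 'a) \<Rightarrow> ('s, 'a) policy" where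
  "select_policy D g t H = return (actions D) (g (snd H))"


section \<open>The law of the process\<close>

text \<open>The conditional law of \<open>(S\<^sub>i, A\<^sub>i)\<close> given \<open>(S\<^sub>j, A\<^sub>j)\<close>, \<open>j < i\<close>, which are the values
  \<open>\<omega> j\<close>. \<open>ini\<close> is the law of \<open>S\<^sub>0\<close>.\<close>

definition step_kernel ::
  "('s, 'a, 'p) mdp_family \<Rightarrow> 's measure \<Rightarrow> 'p \<Rightarrow> ('s, 'a) policy \<Rightarrow>
   nat \<Rightarrow> (nat \<Rightarrow> 's \<times> 'a) \<Rightarrow> ('s \<times> 'a) measure" where
  "step_kernel D ini \<theta> \<pi> i \<omega> =
     (case i of
        0 \<Rightarrow> ini
      | Suc j \<Rightarrow> density (states D) (\<lambda>s. ennreal (tdens D \<theta> (fst (\<omega> j)) (snd (\<omega> j)) s)))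
     \<bind> (\<lambda>s. \<pi> i (\<omega>, s) \<bind> (\<lambda>a. return (state_actions D) (s, a)))"

text \<open>The Ionescu-Tulcea measure on trajectories \<open>\<omega>\<close>, \<open>\<omega> t = (S\<^sub>t, A\<^sub>t)\<close>, in which the first
  \<open>n\<close> steps are frozen at the values \<open>h\<close> and all later steps follow \<open>step_kernel\<close>. For
  \<open>n = 0\<close> this is \<open>P\<^bsub>\<theta>,\<pi>\<^esub>\<close> with \<open>S\<^sub>0\<close> distributed as \<open>ini\<close>. For
  \<open>n = i + 1\<close> it is the conditional law of the process under \<open>P\<^bsub>\<theta>,\<pi>\<^esub>\<close> given
  that the history up to and including \<open>(S\<^sub>i, A\<^sub>i, R\<^sub>i)\<close> is \<open>h\<close>; then \<open>ini\<close> plays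
  no role.\<close>

definition frozen_law ::
  "('s, 'a, 'p) mdp_family \<Rightarrow> 's measure \<Rightarrow> 'p \<Rightarrow> ('s, 'a) policy \<Rightarrow>
   nat \<Rightarrow> (nat \<Rightarrow> 's \<times> 'a) \<Rightarrow> (nat \<Rightarrow> 's \<times> 'a) measure" where
  "frozen_law D ini \<theta> \<pi> n h =
     projective_family.lim UNIV
       (Ionescu_Tulcea.CI
          (\<lambda>i \<omega>. if i < n then return (state_actions D) (h i) else step_kernel D ini \<theta> \<pi> i \<omega>)
          (\<lambda>_. state_actions D))
       (\<lambda>_. state_actions D)"

definition process_law ::
  "('s, 'a, 'p) mdp_family \<Rightarrow> 's measure \<Rightarrow> 'p \<Rightarrow> ('s, 'a) policy \<Rightarrow>
   (nat \<Rightarrow> 's \<times> 'a) measure" where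
  "process_law D ini \<theta> \<pi> = frozen_law D ini \<theta> \<pi> 0 (\<lambda>_. undefined)"

definition hist_law ::
  "('s, 'a, 'p) mdp_family \<Rightarrow> 's measure \<Rightarrow> 'p \<Rightarrow> ('s, 'a) policy \<Rightarrow> nat \<Rightarrow>
   ('s, 'a) hist measure" where
  "hist_law D ini \<theta> \<pi> t = distr (process_law D ini \<theta> \<pi>) (hist_space D t) (hist_at t)"

text \<open>The conditional law of \<open>(S\<^bsub>i+j\<^esub>, A\<^bsub>i+j\<^esub>)\<close> given the history \<open>h\<close> up to and
  including \<open>(S\<^sub>i, A\<^sub>i, R\<^sub>i)\<close>.\<close>

definition cond_law ::
  "('s, 'a, 'p) mdp_family \<Rightarrow> 's measure \<Rightarrow> 'p \<Rightarrow> ('s, 'a) policy \<Rightarrow>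
   nat \<Rightarrow> (nat \<Rightarrow> 's \<times> 'a) \<Rightarrow> nat \<Rightarrow> ('s \<times> 'a) measure" where
  "cond_law D ini \<theta> \<pi> i h j =
     distr (frozen_law D ini \<theta> \<pi> (Suc i) h) (state_actions D) (\<lambda>\<omega>. \<omega> (i + j))"

definition total_reward ::
  "('s, 'a, 'p) mdp_family \<Rightarrow> real \<Rightarrow> (nat \<Rightarrow> 's \<times> 'a) \<Rightarrow> real" where
  "total_reward D \<gamma> \<omega> = (\<Sum>t. \<gamma> ^ t * reward D (fst (\<omega> t)) (snd (\<omega> t)))"

definition V_value ::
  "('s, 'a, 'p) mdp_family \<Rightarrow> real \<Rightarrow> 's measure \<Rightarrow> 'p \<Rightarrow> ('s, 'a) policy \<Rightarrow> real" where
  "V_value D \<gamma> ini \<theta> \<pi> = (\<integral>\<omega>. total_reward D \<gamma> \<omega> \<partial>process_law D ini \<theta> \<pi>)"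

definition Q_value ::
  "('s, 'a, 'p) mdp_family \<Rightarrow> real \<Rightarrow> 's measure \<Rightarrow> 'p \<Rightarrow> ('s, 'a) policy \<Rightarrow> 's \<Rightarrow> 'a \<Rightarrow> real"
  where
  "Q_value D \<gamma> ini \<theta> \<pi> s a =
     (\<integral>\<omega>. total_reward D \<gamma> \<omega> \<partial>frozen_law D ini \<theta> \<pi> 1 (\<lambda>_. (s, a)))"


section \<open>Epsilon-greedy Thompson sampling\<close>

definition hist_state :: "nat \<Rightarrow> ('s, 'a) hist \<Rightarrow> nat \<Rightarrow> 's" where
  "hist_state t H i = (if i < t then fst (fst H i) else snd H)"

text \<open>The factors of the density of \<open>H\<^sub>t\<close> that depend on the parameter. The law of \<open>S\<^sub>0\<close> and the
  policy contribute factors free of the parameter, which cancel in Bayes' formula.\<close>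

definition likelihood ::
  "('s, 'a, 'p) mdp_family \<Rightarrow> nat \<Rightarrow> ('s, 'a) hist \<Rightarrow> 'p \<Rightarrow> real" where
  "likelihood D t H \<theta> =
     (\<Prod>i<t. tdens D \<theta> (hist_state t H i) (snd (fst H i)) (hist_state t H (Suc i)))"

text \<open>For histories at which Bayes' formula is undefined, the posterior is set to the prior.\<close>

definition posterior ::
  "('s, 'a, 'p) mdp_family \<Rightarrow> 'p measure \<Rightarrow> nat \<Rightarrow> ('s, 'a) hist \<Rightarrow> 'p measure" where
  "posterior D prior t H =
     (let e = (\<integral>\<^sup>+\<theta>. ennreal (likelihood D t H \<theta>) \<partial>prior) in
      if 0 < e \<and> e < \<top> then density prior (\<lambda>\<theta>. ennreal (likelihood D t H \<theta>) / e) else prior)"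

text \<open>On an infinite action space, equal probability is understood relative to the reference
  measure.\<close>

definition equal_prob :: "'a measure \<Rightarrow> 'a measure" where
  "equal_prob \<kappa> =
     (if finite (space \<kappa>) then distr (uniform_count_measure (space \<kappa>)) \<kappa> (\<lambda>a. a)
      else uniform_measure \<kappa> (space \<kappa>))"

text \<open>\<open>astar \<theta>\<close> is the action selected by the optimal policy of \<open>\<theta>\<close> as a function of the
  current state.\<close>

definition ts_policy ::
  "('s, 'a, 'p) mdp_family \<Rightarrow> ('p \<Rightarrow> 's \<Rightarrow> 'a) \<Rightarrow> (nat \<Rightarrow> real) \<Rightarrow> (nat \<Rightarrow> 'p measure) \<Rightarrow>
   ('s, 'a) policy" where
  "ts_policy D astar \<delta> prior t H =
     uniform_measure lborel {0<..<1::real} \<bind>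
       (\<lambda>u. if u > \<delta> t
            then posterior D (prior t) t H \<bind> (\<lambda>\<theta>. select_policy D (astar \<theta>) t H)
            else equal_prob (actions D))"


section \<open>Distances, covering numbers and Kullback-Leibler neighbourhoods\<close>

definition hellinger_sq :: "'s measure \<Rightarrow> ('s \<Rightarrow> real) \<Rightarrow> ('s \<Rightarrow> real) \<Rightarrow> ennreal" where
  "hellinger_sq m p q = (\<integral>\<^sup>+x. ennreal ((sqrt (p x) - sqrt (q x))\<^sup>2) \<partial>m)"

text \<open>The distance \<open>d\<^sub>w\<close>. It is extended real valued because the weight need not be integrable.\<close>

definition hdist ::
  "('s, 'a, 'p) mdp_family \<Rightarrow> ('s \<times> 'a \<Rightarrow> real) \<Rightarrow> 'p \<Rightarrow> 'p \<Rightarrow> ennreal" where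
  "hdist D w \<theta> \<theta>' =
     (let I = (\<integral>\<^sup>+(s, a). hellinger_sq (states D) (tdens D \<theta> s a) (tdens D \<theta>' s a)
                 * ennreal (w (s, a)) \<partial>state_actions D)
      in if I = \<top> then \<top> else ennreal (sqrt (enn2real I)))"

text \<open>The least number of closed balls of radius \<open>\<epsilon>\<close> with centres in \<open>X\<close> that cover \<open>T\<close>.\<close>

definition covering_number :: "'p set \<Rightarrow> ennreal \<Rightarrow> 'p set \<Rightarrow> ('p \<Rightarrow> 'p \<Rightarrow> ennreal) \<Rightarrow> enat" where
  "covering_number X \<epsilon> T d =
     (INF C\<in>{C. C \<subseteq> X \<and> finite C \<and> (\<forall>\<theta>\<in>T. \<exists>c\<in>C. d \<theta> c \<le> \<epsilon>)}. enat (card C))"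

definition log_enat :: "enat \<Rightarrow> ereal" where
  "log_enat N = (case N of enat n \<Rightarrow> (if n = 0 then - \<infinity> else ereal (ln (real n))) | \<infinity> \<Rightarrow> \<infinity>)"

text \<open>If \<open>P\<close> and \<open>Q\<close> have densities \<open>p\<^sub>1\<close> and \<open>p\<^sub>2\<close> with respect to a common measure, then
  \<open>entropy_density (exp 1) Q P\<close> is \<open>log (p\<^sub>1 / p\<^sub>2)\<close>, \<open>P\<close>-almost everywhere. The library's
  Bochner integrals vanish for non-integrable functions, hence the case distinctions; the negative
  part of \<open>log (p\<^sub>1 / p\<^sub>2)\<close> is always \<open>P\<close>-integrable.\<close>

definition KL :: "'b measure \<Rightarrow> 'b measure \<Rightarrow> ereal" where
  "KL P Q =
     (if absolutely_continuous Q P \<and> integrable P (entropy_density (exp 1) Q P)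
      then ereal (KL_divergence (exp 1) Q P) else \<infinity>)"

definition KL_moment :: "nat \<Rightarrow> 'b measure \<Rightarrow> 'b measure \<Rightarrow> ennreal" where
  "KL_moment n P Q =
     (if KL P Q = \<infinity> then \<top>
      else (\<integral>\<^sup>+x. ennreal (\<bar>entropy_density (exp 1) Q P x - KL_divergence (exp 1) Q P\<bar> ^ n) \<partial>P))"

definition KL_nbhd ::
  "('s, 'a, 'p) mdp_family \<Rightarrow> 's measure \<Rightarrow> ('s, 'a) policy \<Rightarrow> nat \<Rightarrow> 'p \<Rightarrow> real \<Rightarrow> nat \<Rightarrow> 'p set"
  where
  "KL_nbhd D ini \<pi> t \<theta>\<^sub>0 \<epsilon> n =
     {\<theta> \<in> space (params D).
        KL (hist_law D ini \<theta>\<^sub>0 \<pi> t) (hist_law D ini \<theta> \<pi> t) \<le> ereal (real t * \<epsilon>\<^sup>2) \<and>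
        KL_moment n (hist_law D ini \<theta>\<^sub>0 \<pi> t) (hist_law D ini \<theta> \<pi> t)
          \<le> ennreal (real t powr (real n / 2) * \<epsilon> ^ n)}"


section \<open>Blocks of length \<open>k + l\<close>\<close>

definition alpha_sum :: "nat \<Rightarrow> nat \<Rightarrow> (nat \<Rightarrow> real) \<Rightarrow> nat \<Rightarrow> real" where
  "alpha_sum k l \<alpha> t = (\<Sum>i<t div (k + l). \<alpha> (i * (k + l)))"

definition alpha_last :: "nat \<Rightarrow> nat \<Rightarrow> (nat \<Rightarrow> real) \<Rightarrow> nat \<Rightarrow> real" where
  "alpha_last k l \<alpha> t = \<alpha> ((t div (k + l) - 1) * (k + l))"

definition eps_bar :: "nat \<Rightarrow> nat \<Rightarrow> (nat \<Rightarrow> real) \<Rightarrow> (nat \<Rightarrow> real) \<Rightarrow> nat \<Rightarrow> real" where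
  "eps_bar k l \<alpha> \<epsilon> t = sqrt (\<Sum>i<t div (k + l). \<alpha> (i * (k + l)) * (\<epsilon> t)\<^sup>2 / real t)"

definition testing_constants ::
  "('s, 'a, 'p) mdp_family \<Rightarrow> 'p \<Rightarrow> ('s, 'a) policy \<Rightarrow> nat \<Rightarrow> nat \<Rightarrow> (nat \<Rightarrow> real) \<Rightarrow>
   ('s \<times> 'a \<Rightarrow> real) \<Rightarrow> ('s \<times> 'a \<Rightarrow> real) \<Rightarrow> real \<Rightarrow> real \<Rightarrow> bool" where
  "testing_constants D \<theta>\<^sub>0 \<pi> k l \<alpha> \<mu> \<nu> K \<xi> \<longleftrightarrow>
     0 < K \<and> 0 < \<xi> \<and> \<xi> < 1 \<and>
     (\<forall>t\<ge>k + l. \<forall>\<theta>\<^sub>1\<in>space (params D).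
        \<exists>\<phi>\<in>borel_measurable (hist_space D t).
          (\<forall>H\<in>space (hist_space D t). 0 \<le> \<phi> H \<and> \<phi> H \<le> (1::real)) \<and>
          (\<forall>ini. prob_space ini \<and> sets ini = sets (states D) \<longrightarrow>
             (\<integral>H. \<phi> H \<partial>hist_law D ini \<theta>\<^sub>0 \<pi> t)
               \<le> exp (- K * (alpha_sum k l \<alpha> t * (enn2real (hdist D \<mu> \<theta>\<^sub>0 \<theta>\<^sub>1))\<^sup>2)) \<and>
             (\<forall>\<theta>\<in>space (params D).
                hdist D \<nu> \<theta> \<theta>\<^sub>1 \<le> ennreal (\<xi> * sqrt (alpha_last k l \<alpha> t)) * hdist D \<mu> \<theta>\<^sub>0 \<theta>\<^sub>1 \<longrightarrow>
                (\<integral>H. 1 - \<phi> H \<partial>hist_law D ini \<theta> \<pi> t)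
                  \<le> exp (- K * (alpha_sum k l \<alpha> t * (enn2real (hdist D \<mu> \<theta>\<^sub>0 \<theta>\<^sub>1))\<^sup>2)))))"

end

(* Write L_t(theta) for the likelihood of H_t and c_t = t * eps_bar_t^2, which is at least t^(1 - 2 beta).
   Both claims follow from the summability over t of the expected posterior mass of
   A_t = {d_mu(theta, theta_0) > J eps_t} for one large J. Markov's inequality for the moments of order n gives
   L_t(theta) >= exp(-2 c_t) L_t(theta_0) on half of the prior mass of the Kullback-Leibler neighbourhood, off an
   event of probability O(c_t^(-n/2)); against this lower bound on the evidence, the tests for the shells
   j eps_t < d_mu <= (j + 1) eps_t leave an expected posterior mass O(exp(-c_t)). The resulting bound
   O(t^(-n (1 - 2 beta) / 2)) is summable.

   The optimal action value functions are fixed points of the Bellman optimality operators, which contract with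
   factor gamma < 1 and depend continuously on theta. By the gap condition the optimal policies of theta and theta_0
   agree outside A_t once t is large, so given H_t a wrong action has probability at most
   (1 - e) delta_t plus the posterior mass of A_t; here e > 0 because the optimal action is an atom of the uniform
   exploration law. Since (exp e - 1) (1 - e) <= e, an exponential supermartingale bounds the number of wrong actions
   by f(T) plus a constant, uniformly in T, with any prescribed probability below 1. *)

theory Submission
  imports Defs
begin

text \<open>The order of quantifiers shapes the count of wrong actions: T_0 is fixed before d, so
  letting d tend to 0 shows that the bound f(T) + B must already hold, with coefficient one and with
  a deviation that stays bounded in T. Fluctuations of order sqrt (f(T)) around f(T) would be too
  large. The slack comes from exploration: it picks the optimal action with probability at least e,
  so the expected count carries the factor 1 - e, and the room this leaves absorbs the fluctuations.

  The posterior enters both claims through one random variable, the sum over t of the posterior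
  masses of the sets A_t. Its integrability makes the terms tend to zero almost surely and bounds
  their share of the count for all T at once.

  Condition (C) does hidden work. A point mass with bounded density sits at an atom of the reference
  measure, which produces e. Normalised densities bounded by C_1 and C_2 force C_1 C_2 times the
  total reference mass to be at least one, whence \<gamma> < 1.\<close>

section \<open>One step of an Ionescu-Tulcea process\<close>

context Ionescu_Tulcea
begin

text \<open>\<open>CI J\<close> projects the law of the first \<open>up_to J\<close> coordinates to
  \<open>J\<close>; for an initial segment nothing is projected away.\<close>

lemma CI_initial: "CI {0..<n} = C 0 n (\<lambda>_. undefined)"
proof -
  have up: "up_to {0..<n} = n"
  proof (rule antisym)
    show "up_to {0..<n} \<le> n" by (subst up_to_iff) auto
    show "n \<le> up_to {0..<n}" using up_to[of "{0..<n}"] by auto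
  qed
  have "C 0 n (\<lambda>_. undefined) = distr (C 0 n (\<lambda>_. undefined)) (PiM {0..<0 + n} M) (\<lambda>x. restrict x {0..<0 + n})"
    by (rule distr_C) auto
  then show ?thesis by (simp add: CI_def up)
qed

text \<open>The image of the limit on the empty product is a probability measure, and taking images
  preserves total mass.\<close>

lemma prob_space_lim: "prob_space PF.lim"
proof -
  have "(\<lambda>x. restrict x {}) \<in> PF.lim \<rightarrow>\<^sub>M PiM {} M"
    by (simp add: measurable_cong_sets[OF PF.sets_lim] measurable_restrict_subset)
  moreover have "prob_space (distr PF.lim (PiM {} M) (\<lambda>x. restrict x {}))"
    by (simp add: distr_lim PF.prob_space_P)
  ultimately show ?thesis by (rule prob_space_distrD)
qed

lemma measurable_lim_restrict [measurable]: "(\<lambda>\<omega>. restrict \<omega> {0..<n}) \<in> PF.lim \<rightarrow>\<^sub>M PiM {0..<n} M"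
  by (simp add: measurable_cong_sets[OF PF.sets_lim] measurable_restrict_subset)

lemma nn_integral_lim_restrict:
  assumes f: "f \<in> borel_measurable (PiM {0..<n} M)"
  shows "(\<integral>\<^sup>+\<omega>. f (restrict \<omega> {0..<n}) \<partial>PF.lim) = (\<integral>\<^sup>+x. f x \<partial>C 0 n (\<lambda>_. undefined))"
proof -
  have "(\<integral>\<^sup>+x. f x \<partial>C 0 n (\<lambda>_. undefined)) = (\<integral>\<^sup>+x. f x \<partial>distr PF.lim (PiM {0..<n} M) (\<lambda>x. restrict x {0..<n}))"
    by (simp add: distr_lim CI_initial)
  also have "\<dots> = (\<integral>\<^sup>+\<omega>. f (restrict \<omega> {0..<n}) \<partial>PF.lim)"
    by (rule nn_integral_distr) (use f in auto)
  finally show ?thesis by simp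
qed

text \<open>Conditioning of coordinate i on its past. The integrand sees only the first i + 1
  coordinates, whose law is that of the first i followed by the kernel. Integrals over trajectories
  are later computed through this identity.\<close>

lemma nn_integral_lim_step:
  assumes F: "(\<lambda>(x, y). F x y) \<in> borel_measurable (PiM {0..<i} M \<Otimes>\<^sub>M M i)"
  shows "(\<integral>\<^sup>+\<omega>. F (restrict \<omega> {0..<i}) (\<omega> i) \<partial>PF.lim) =
    (\<integral>\<^sup>+\<omega>. (\<integral>\<^sup>+y. F (restrict \<omega> {0..<i}) y \<partial>P i (restrict \<omega> {0..<i})) \<partial>PF.lim)"
proof -
  let ?G = "\<lambda>x. F (restrict x {0..<i}) (x i)"
  let ?x0 = "\<lambda>_::nat. undefined :: 'a"
  have x0: "?x0 \<in> space (PiM {0..<0} M)" by simp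
  have "(\<lambda>x. (restrict x {0..<i}, x i)) \<in> PiM {0..<Suc i} M \<rightarrow>\<^sub>M PiM {0..<i} M \<Otimes>\<^sub>M M i"
    by (intro measurable_Pair measurable_restrict_subset measurable_component_singleton) auto
  from measurable_compose[OF this F] have G: "?G \<in> borel_measurable (PiM {0..<Suc i} M)"
    by simp
  have meas: "eP i \<in> C 0 i ?x0 \<rightarrow>\<^sub>M subprob_algebra (PiM {0..<Suc i} M)"
    using measurable_eP[of i] by (simp add: measurable_cong_sets[OF sets_C[OF x0]])
  have "(\<integral>\<^sup>+\<omega>. F (restrict \<omega> {0..<i}) (\<omega> i) \<partial>PF.lim) = (\<integral>\<^sup>+\<omega>. ?G (restrict \<omega> {0..<Suc i}) \<partial>PF.lim)"
    by (intro nn_integral_cong) (auto simp: Int_absorb1)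
  also have "\<dots> = (\<integral>\<^sup>+x. ?G x \<partial>C 0 (Suc i) ?x0)"
    by (rule nn_integral_lim_restrict[OF G])
  also have "\<dots> = (\<integral>\<^sup>+x. \<integral>\<^sup>+y. ?G y \<partial>eP i x \<partial>C 0 i ?x0)"
    using meas by (simp add: nn_integral_bind[OF G])
  also have "\<dots> = (\<integral>\<^sup>+x. \<integral>\<^sup>+y. F x y \<partial>P i x \<partial>C 0 i ?x0)"
  proof (intro nn_integral_cong)
    fix x assume "x \<in> space (C 0 i ?x0)"
    then have x: "x \<in> space (PiM {0..<i} M)" by (simp add: space_C[OF x0])
    then have [simp]: "restrict x {0..<i} = x"
      by (auto simp: space_PiM PiE_iff extensional_def)
    have "restrict (x(i := y)) {0..<i} = x" for y
    proof -
      have "restrict (x(i := y)) {0..<i} = restrict x {0..<i}"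
        by (auto simp: restrict_def)
      then show ?thesis by simp
    qed
    then show "(\<integral>\<^sup>+y. ?G y \<partial>eP i x) = (\<integral>\<^sup>+y. F x y \<partial>P i x)"
      by (simp add: nn_integral_eP[OF x G])
  qed
  also have "\<dots> = (\<integral>\<^sup>+\<omega>. (\<integral>\<^sup>+y. F (restrict \<omega> {0..<i}) y \<partial>P i (restrict \<omega> {0..<i})) \<partial>PF.lim)"
    by (rule nn_integral_lim_restrict[symmetric])
       (rule nn_integral_measurable_subprob_algebra2[OF F P])
  finally show ?thesis .
qed

end

lemma measurable_density_prob_algebra:
  fixes g :: "'b \<Rightarrow> 'c \<Rightarrow> ennreal"
  assumes M: "sigma_finite_measure M"
    and g[measurable]: "(\<lambda>(x, y). g x y) \<in> borel_measurable (N \<Otimes>\<^sub>M M)"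
    and one: "\<And>x. x \<in> space N \<Longrightarrow> (\<integral>\<^sup>+y. g x y \<partial>M) = 1"
  shows "(\<lambda>x. density M (g x)) \<in> N \<rightarrow>\<^sub>M prob_algebra M"
proof (rule measurable_prob_algebraI)
  interpret M: sigma_finite_measure M by fact
  show P: "prob_space (density M (g x))" if x: "x \<in> space N" for x
  proof
    have [measurable]: "g x \<in> borel_measurable M"
      using measurable_compose[OF measurable_Pair1'[OF x] g] by simp
    show "emeasure (density M (g x)) (space (density M (g x))) = 1"
      using one[OF x] by (simp add: emeasure_density)
  qed
  show "(\<lambda>x. density M (g x)) \<in> N \<rightarrow>\<^sub>M subprob_algebra M"
  proof (rule measurable_subprob_algebra)
    show "x \<in> space N \<Longrightarrow> subprob_space (density M (g x))" for x
      by (rule prob_space_imp_subprob_space) (rule P)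
    fix X assume X[measurable]: "X \<in> sets M"
    have "(\<lambda>x. \<integral>\<^sup>+y. g x y * indicator X y \<partial>M) \<in> borel_measurable N"
      by (rule M.borel_measurable_nn_integral) measurable
    moreover have "emeasure (density M (g x)) X = (\<integral>\<^sup>+y. g x y * indicator X y \<partial>M)" if x: "x \<in> space N" for x
      using measurable_compose[OF measurable_Pair1'[OF x] g] by (simp add: emeasure_density)
    ultimately show "(\<lambda>x. emeasure (density M (g x)) X) \<in> borel_measurable N"
      by (simp cong: measurable_cong)
  qed simp
qed


section \<open>Laws of controlled processes\<close>

locale mdp =
  fixes D :: "('s, 'a, 'p) mdp_family"
  assumes wf: "wf_mdp_family D"
begin

sublocale states: sigma_finite_measure "states D"
  using wf by (simp add: wf_mdp_family_def)

sublocale actions: sigma_finite_measure "actions D"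
  using wf by (simp add: wf_mdp_family_def)

sublocale state_actions: sigma_finite_measure "state_actions D"
  unfolding state_actions_def
  by (rule sigma_finite_pair_measure) unfold_locales

lemma measurable_tdens [measurable (raw)]:
  assumes "f \<in> N \<rightarrow>\<^sub>M params D" "g \<in> N \<rightarrow>\<^sub>M states D" "h \<in> N \<rightarrow>\<^sub>M actions D" "k \<in> N \<rightarrow>\<^sub>M states D"
  shows "(\<lambda>x. tdens D (f x) (g x) (h x) (k x)) \<in> borel_measurable N"
proof -
  have "(\<lambda>(\<theta>, (s, a), s'). tdens D \<theta> s a s')
       \<in> borel_measurable (params D \<Otimes>\<^sub>M (state_actions D \<Otimes>\<^sub>M states D))"
    using wf by (simp add: wf_mdp_family_def)
  moreover have "(\<lambda>x. (f x, (g x, h x), k x)) \<in> N \<rightarrow>\<^sub>M params D \<Otimes>\<^sub>M (state_actions D \<Otimes>\<^sub>M states D)"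
    unfolding state_actions_def using assms by measurable
  ultimately have "(\<lambda>x. (\<lambda>(\<theta>, (s, a), s'). tdens D \<theta> s a s') (f x, (g x, h x), k x)) \<in> borel_measurable N"
    by (rule measurable_compose[rotated])
  then show ?thesis by simp
qed

lemma measurable_reward [measurable (raw)]:
  assumes "g \<in> N \<rightarrow>\<^sub>M states D" "h \<in> N \<rightarrow>\<^sub>M actions D"
  shows "(\<lambda>x. reward D (g x) (h x)) \<in> borel_measurable N"
proof -
  have "(\<lambda>(s, a). reward D s a) \<in> borel_measurable (state_actions D)"
    using wf by (simp add: wf_mdp_family_def)
  moreover have "(\<lambda>x. (g x, h x)) \<in> N \<rightarrow>\<^sub>M state_actions D"
    unfolding state_actions_def using assms by measurable
  ultimately have "(\<lambda>x. (\<lambda>(s, a). reward D s a) (g x, h x)) \<in> borel_measurable N"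
    by (rule measurable_compose[rotated])
  then show ?thesis by simp
qed

lemma measurable_state_of [measurable (raw)]:
  "f \<in> N \<rightarrow>\<^sub>M state_actions D \<Longrightarrow> (\<lambda>x. fst (f x)) \<in> N \<rightarrow>\<^sub>M states D"
  unfolding state_actions_def by measurable

lemma measurable_action_of [measurable (raw)]:
  "f \<in> N \<rightarrow>\<^sub>M state_actions D \<Longrightarrow> (\<lambda>x. snd (f x)) \<in> N \<rightarrow>\<^sub>M actions D"
  unfolding state_actions_def by measurable

lemma measurable_state_action [measurable (raw)]:
  "f \<in> N \<rightarrow>\<^sub>M states D \<Longrightarrow> g \<in> N \<rightarrow>\<^sub>M actions D \<Longrightarrow> (\<lambda>x. (f x, g x)) \<in> N \<rightarrow>\<^sub>M state_actions D"
  unfolding state_actions_def by measurable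

lemma space_state_actions: "space (state_actions D) = space (states D) \<times> space (actions D)"
  by (simp add: state_actions_def space_pair_measure)

lemma tdens_nonneg:
  "\<theta> \<in> space (params D) \<Longrightarrow> s \<in> space (states D) \<Longrightarrow> a \<in> space (actions D) \<Longrightarrow> s' \<in> space (states D) \<Longrightarrow>
    0 \<le> tdens D \<theta> s a s'"
  using wf by (simp add: wf_mdp_family_def)

lemma nn_integral_tdens:
  "\<theta> \<in> space (params D) \<Longrightarrow> s \<in> space (states D) \<Longrightarrow> a \<in> space (actions D) \<Longrightarrow>
    (\<integral>\<^sup>+s'. ennreal (tdens D \<theta> s a s') \<partial>states D) = 1"
  using wf by (simp add: wf_mdp_family_def)

lemma measurable_transition:
  assumes [measurable]: "f \<in> N \<rightarrow>\<^sub>M params D" "g \<in> N \<rightarrow>\<^sub>M states D" "h \<in> N \<rightarrow>\<^sub>M actions D"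
  shows "(\<lambda>x. density (states D) (\<lambda>s. ennreal (tdens D (f x) (g x) (h x) s))) \<in> N \<rightarrow>\<^sub>M prob_algebra (states D)"
  by (rule measurable_density_prob_algebra[OF states.sigma_finite_measure_axioms])
     (measurable, auto intro!: nn_integral_tdens dest: measurable_space[OF assms(1)] measurable_space[OF assms(2)] measurable_space[OF assms(3)])

lemma space_hist_space: "H \<in> space (hist_space D t) \<longleftrightarrow>
    fst H \<in> space (PiM {0..<t} (\<lambda>_. state_actions D)) \<and> snd H \<in> space (states D)"
  by (cases H) (auto simp: hist_space_def space_pair_measure)

end

locale mdp_control = mdp D for D :: "('s, 'a, 'p) mdp_family" +
  fixes ini :: "'s measure" and \<pi> :: "('s, 'a) policy" and \<theta> :: 'p
  assumes prob_ini: "prob_space ini" and sets_ini: "sets ini = sets (states D)"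
    and policy: "is_policy D \<pi>" and \<theta>: "\<theta> \<in> space (params D)"
begin

lemma space_ini: "space ini = space (states D)"
  using sets_ini by (rule sets_eq_imp_space_eq)

lemma measurable_policy: "\<pi> t \<in> hist_space D t \<rightarrow>\<^sub>M prob_algebra (actions D)"
  using policy by (simp add: is_policy_def)

lemma policy_prob_space:
  "H \<in> space (hist_space D t) \<Longrightarrow> prob_space (\<pi> t H)"
  "H \<in> space (hist_space D t) \<Longrightarrow> sets (\<pi> t H) = sets (actions D)"
  "H \<in> space (hist_space D t) \<Longrightarrow> space (\<pi> t H) = space (actions D)"
proof -
  have *: "\<pi> t H \<in> space (prob_algebra (actions D))" if "H \<in> space (hist_space D t)"
    using measurable_space[OF measurable_policy that] .
  show "H \<in> space (hist_space D t) \<Longrightarrow> prob_space (\<pi> t H)"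
    "H \<in> space (hist_space D t) \<Longrightarrow> sets (\<pi> t H) = sets (actions D)"
    using * by (auto simp: space_prob_algebra)
  then show "H \<in> space (hist_space D t) \<Longrightarrow> space (\<pi> t H) = space (actions D)"
    by (metis sets_eq_imp_space_eq)
qed

text \<open>The state half of \<open>step_kernel\<close>. Once it is separated from the action half,
  the action can be integrated out on its own.\<close>

definition state_kernel :: "nat \<Rightarrow> (nat \<Rightarrow> 's \<times> 'a) \<Rightarrow> 's measure" where
  "state_kernel i \<omega> = (case i of 0 \<Rightarrow> ini
      | Suc j \<Rightarrow> density (states D) (\<lambda>s. ennreal (tdens D \<theta> (fst (\<omega> j)) (snd (\<omega> j)) s)))"

lemma measurable_state_kernel:
  "state_kernel i \<in> PiM {0..<i} (\<lambda>_. state_actions D) \<rightarrow>\<^sub>M prob_algebra (states D)"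
proof (cases i)
  case 0
  then show ?thesis
    by (auto simp: state_kernel_def[abs_def] space_prob_algebra prob_ini sets_ini intro!: measurable_const)
next
  case (Suc j)
  then show ?thesis
    unfolding state_kernel_def[abs_def] nat.case
    using \<theta> by (auto intro!: measurable_transition measurable_component_singleton measurable_const
        measurable_state_of measurable_action_of)
qed

lemma step_kernel_eq: "step_kernel D ini \<theta> \<pi> i \<omega> =
    state_kernel i \<omega> \<bind> (\<lambda>s. \<pi> i (\<omega>, s) \<bind> (\<lambda>a. return (state_actions D) (s, a)))"
  by (simp add: step_kernel_def state_kernel_def)

lemma measurable_action_kernel:
  "(\<lambda>(\<omega>, s). \<pi> i (\<omega>, s) \<bind> (\<lambda>a. return (state_actions D) (s, a)))
     \<in> PiM {0..<i} (\<lambda>_. state_actions D) \<Otimes>\<^sub>M states D \<rightarrow>\<^sub>M prob_algebra (state_actions D)"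
  unfolding case_prod_beta
proof (rule measurable_bind_prob_space2)
  show "(\<lambda>x. \<pi> i (fst x, snd x)) \<in> PiM {0..<i} (\<lambda>_. state_actions D) \<Otimes>\<^sub>M states D \<rightarrow>\<^sub>M prob_algebra (actions D)"
    using measurable_policy[of i] by (simp add: hist_space_def)
  show "(\<lambda>(x, y). return (state_actions D) (snd x, y))
    \<in> (PiM {0..<i} (\<lambda>_. state_actions D) \<Otimes>\<^sub>M states D) \<Otimes>\<^sub>M actions D \<rightarrow>\<^sub>M prob_algebra (state_actions D)"
    unfolding case_prod_beta
    by (rule measurable_compose[OF _ measurable_return_prob_space]) measurable
qed

lemma measurable_step_kernel:
  "step_kernel D ini \<theta> \<pi> i \<in> PiM {0..<i} (\<lambda>_. state_actions D) \<rightarrow>\<^sub>M prob_algebra (state_actions D)"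
  unfolding step_kernel_eq[abs_def]
  by (rule measurable_bind_prob_space2[OF measurable_state_kernel])
     (use measurable_action_kernel in simp)

lemma nn_integral_step_kernel:
  assumes \<omega>: "\<omega> \<in> space (PiM {0..<i} (\<lambda>_. state_actions D))"
    and F[measurable]: "F \<in> borel_measurable (state_actions D)"
  shows "(\<integral>\<^sup>+x. F x \<partial>step_kernel D ini \<theta> \<pi> i \<omega>) =
    (\<integral>\<^sup>+s. \<integral>\<^sup>+a. F (s, a) \<partial>\<pi> i (\<omega>, s) \<partial>state_kernel i \<omega>)"
proof -
  have sk: "state_kernel i \<omega> \<in> space (prob_algebra (states D))"
    using measurable_space[OF measurable_state_kernel \<omega>] .
  then have sets_sk: "sets (state_kernel i \<omega>) = sets (states D)" by (simp add: space_prob_algebra)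
  have "(\<lambda>s. (\<omega>, s)) \<in> states D \<rightarrow>\<^sub>M PiM {0..<i} (\<lambda>_. state_actions D) \<Otimes>\<^sub>M states D"
    using \<omega> by simp
  from measurable_compose[OF this measurable_action_kernel]
  have k: "(\<lambda>s. \<pi> i (\<omega>, s) \<bind> (\<lambda>a. return (state_actions D) (s, a))) \<in> state_kernel i \<omega> \<rightarrow>\<^sub>M subprob_algebra (state_actions D)"
    by (simp add: measurable_cong_sets[OF sets_sk refl] measurable_prob_algebraD)
  have "(\<integral>\<^sup>+x. F x \<partial>step_kernel D ini \<theta> \<pi> i \<omega>) =
     (\<integral>\<^sup>+s. (\<integral>\<^sup>+x. F x \<partial>(\<pi> i (\<omega>, s) \<bind> (\<lambda>a. return (state_actions D) (s, a)))) \<partial>state_kernel i \<omega>)"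
    unfolding step_kernel_eq by (rule nn_integral_bind[OF F k])
  also have "\<dots> = (\<integral>\<^sup>+s. \<integral>\<^sup>+a. F (s, a) \<partial>\<pi> i (\<omega>, s) \<partial>state_kernel i \<omega>)"
  proof (intro nn_integral_cong)
    fix s assume "s \<in> space (state_kernel i \<omega>)"
    then have s[measurable]: "s \<in> space (states D)" using sets_eq_imp_space_eq[OF sets_sk] by simp
    then have h: "(\<omega>, s) \<in> space (hist_space D i)" using \<omega> by (simp add: space_hist_space)
    note sp = policy_prob_space[OF h]
    have r: "(\<lambda>a. return (state_actions D) (s, a)) \<in> \<pi> i (\<omega>, s) \<rightarrow>\<^sub>M subprob_algebra (state_actions D)"
      unfolding measurable_cong_sets[OF sp(2) refl]
      by (rule measurable_compose[OF _ return_measurable]) measurable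
    have "(\<integral>\<^sup>+x. F x \<partial>(\<pi> i (\<omega>, s) \<bind> (\<lambda>a. return (state_actions D) (s, a)))) =
      (\<integral>\<^sup>+a. \<integral>\<^sup>+x. F x \<partial>return (state_actions D) (s, a) \<partial>\<pi> i (\<omega>, s))"
      by (rule nn_integral_bind[OF F r])
    also have "\<dots> = (\<integral>\<^sup>+a. F (s, a) \<partial>\<pi> i (\<omega>, s))"
      by (intro nn_integral_cong nn_integral_return) (auto simp: sp space_state_actions s)
    finally show "(\<integral>\<^sup>+x. F x \<partial>(\<pi> i (\<omega>, s) \<bind> (\<lambda>a. return (state_actions D) (s, a)))) = (\<integral>\<^sup>+a. F (s, a) \<partial>\<pi> i (\<omega>, s))" .
  qed
  finally show ?thesis .
qed

text \<open>Freezing uses point masses at points of the space, which are again Markov kernels, so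
  frozen processes obey the same disintegration as free ones.\<close>

lemma frozen_Ionescu_Tulcea:
  assumes h: "\<And>i. i < n \<Longrightarrow> h i \<in> space (state_actions D)"
  shows "Ionescu_Tulcea
    (\<lambda>i \<omega>. if i < n then return (state_actions D) (h i) else step_kernel D ini \<theta> \<pi> i \<omega>) (\<lambda>_. state_actions D)"
proof -
  have *: "(\<lambda>\<omega>. if i < n then return (state_actions D) (h i) else step_kernel D ini \<theta> \<pi> i \<omega>)
    \<in> PiM {0..<i} (\<lambda>_. state_actions D) \<rightarrow>\<^sub>M prob_algebra (state_actions D)" for i
    using h[of i] measurable_step_kernel[of i]
    by (cases "i < n") (auto simp: space_prob_algebra prob_space_return intro!: measurable_const)
  show ?thesis
    unfolding Ionescu_Tulcea_def using * measurable_space[OF *]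
    by (auto simp: space_prob_algebra intro: measurable_prob_algebraD)
qed

lemma
  assumes h: "\<And>i. i < n \<Longrightarrow> h i \<in> space (state_actions D)"
  shows prob_space_frozen_law: "prob_space (frozen_law D ini \<theta> \<pi> n h)"
    and sets_frozen_law: "sets (frozen_law D ini \<theta> \<pi> n h) = sets (PiM UNIV (\<lambda>_. state_actions D))"
    and space_frozen_law: "space (frozen_law D ini \<theta> \<pi> n h) = space (PiM UNIV (\<lambda>_. state_actions D))"
proof -
  interpret IT: Ionescu_Tulcea
    "\<lambda>i \<omega>. if i < n then return (state_actions D) (h i) else step_kernel D ini \<theta> \<pi> i \<omega>" "\<lambda>_. state_actions D"
    using h by (rule frozen_Ionescu_Tulcea)
  show "prob_space (frozen_law D ini \<theta> \<pi> n h)"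
    "sets (frozen_law D ini \<theta> \<pi> n h) = sets (PiM UNIV (\<lambda>_. state_actions D))"
    "space (frozen_law D ini \<theta> \<pi> n h) = space (PiM UNIV (\<lambda>_. state_actions D))"
    unfolding frozen_law_def using IT.prob_space_lim by auto
qed

lemma nn_integral_frozen_fixed:
  assumes h: "\<And>i. i < n \<Longrightarrow> h i \<in> space (state_actions D)" and i: "i < n"
    and F[measurable]: "F \<in> borel_measurable (state_actions D)"
  shows "(\<integral>\<^sup>+\<omega>. F (\<omega> i) \<partial>frozen_law D ini \<theta> \<pi> n h) = F (h i)"
proof -
  interpret IT: Ionescu_Tulcea
    "\<lambda>i \<omega>. if i < n then return (state_actions D) (h i) else step_kernel D ini \<theta> \<pi> i \<omega>" "\<lambda>_. state_actions D"
    using h by (rule frozen_Ionescu_Tulcea)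
  interpret fl: prob_space "frozen_law D ini \<theta> \<pi> n h" by (rule prob_space_frozen_law[OF h])
  show ?thesis
    using IT.nn_integral_lim_step[of "\<lambda>_. F" i] i h[OF i] fl.emeasure_space_1
    by (simp add: frozen_law_def[symmetric] nn_integral_return)
qed

lemma nn_integral_frozen_step:
  assumes h: "\<And>i. i < n \<Longrightarrow> h i \<in> space (state_actions D)" and i: "n \<le> i"
    and F[measurable]: "(\<lambda>(x, y). F x y) \<in> borel_measurable (PiM {0..<i} (\<lambda>_. state_actions D) \<Otimes>\<^sub>M state_actions D)"
  shows "(\<integral>\<^sup>+\<omega>. F (restrict \<omega> {0..<i}) (\<omega> i) \<partial>frozen_law D ini \<theta> \<pi> n h) =
    (\<integral>\<^sup>+\<omega>. \<integral>\<^sup>+s. \<integral>\<^sup>+a. F (restrict \<omega> {0..<i}) (s, a) \<partial>\<pi> i (restrict \<omega> {0..<i}, s)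
        \<partial>state_kernel i (restrict \<omega> {0..<i}) \<partial>frozen_law D ini \<theta> \<pi> n h)"
proof -
  interpret IT: Ionescu_Tulcea
    "\<lambda>i \<omega>. if i < n then return (state_actions D) (h i) else step_kernel D ini \<theta> \<pi> i \<omega>" "\<lambda>_. state_actions D"
    using h by (rule frozen_Ionescu_Tulcea)
  have "(\<integral>\<^sup>+\<omega>. F (restrict \<omega> {0..<i}) (\<omega> i) \<partial>frozen_law D ini \<theta> \<pi> n h) =
    (\<integral>\<^sup>+\<omega>. \<integral>\<^sup>+y. F (restrict \<omega> {0..<i}) y \<partial>step_kernel D ini \<theta> \<pi> i (restrict \<omega> {0..<i}) \<partial>frozen_law D ini \<theta> \<pi> n h)"
    unfolding frozen_law_def using IT.nn_integral_lim_step[OF F] i by simp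
  also have "\<dots> = (\<integral>\<^sup>+\<omega>. \<integral>\<^sup>+s. \<integral>\<^sup>+a. F (restrict \<omega> {0..<i}) (s, a) \<partial>\<pi> i (restrict \<omega> {0..<i}, s)
        \<partial>state_kernel i (restrict \<omega> {0..<i}) \<partial>frozen_law D ini \<theta> \<pi> n h)"
  proof (intro nn_integral_cong nn_integral_step_kernel)
    fix \<omega> assume "\<omega> \<in> space (frozen_law D ini \<theta> \<pi> n h)"
    then show r: "restrict \<omega> {0..<i} \<in> space (PiM {0..<i} (\<lambda>_. state_actions D))"
      by (auto simp: space_frozen_law[OF h] space_PiM PiE_iff)
    show "F (restrict \<omega> {0..<i}) \<in> borel_measurable (state_actions D)"
      using measurable_compose[OF measurable_Pair1'[OF r] F] by simp
  qed
  finally show ?thesis .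
qed

end

section \<open>Laws of histories and likelihoods\<close>

definition hist_ext :: "nat \<Rightarrow> ('s, 'a) hist \<Rightarrow> 'a \<Rightarrow> 's \<Rightarrow> ('s, 'a) hist" where
  "hist_ext t H a s = ((fst H)(t := (snd H, a)), s)"

lemma likelihood_hist_ext:
  "likelihood D (Suc t) (hist_ext t H a s) \<theta> = likelihood D t H \<theta> * tdens D \<theta> (snd H) a s"
proof -
  have "(\<Prod>i<t. tdens D \<theta> (hist_state (Suc t) (hist_ext t H a s) i) (snd (fst (hist_ext t H a s) i))
          (hist_state (Suc t) (hist_ext t H a s) (Suc i))) = likelihood D t H \<theta>"
    unfolding likelihood_def
    by (intro prod.cong refl) (auto simp: hist_state_def hist_ext_def)
  then show ?thesis
    by (simp add: likelihood_def hist_state_def hist_ext_def)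
qed

context mdp
begin

lemma measurable_hist_at [measurable]:
  "hist_at t \<in> PiM UNIV (\<lambda>_. state_actions D) \<rightarrow>\<^sub>M hist_space D t"
  unfolding hist_at_def[abs_def] hist_space_def
  by (intro measurable_Pair measurable_restrict_subset measurable_state_of measurable_component_singleton) auto

lemma measurable_hist_ext [measurable (raw)]:
  assumes f: "f \<in> N \<rightarrow>\<^sub>M hist_space D t" and g[measurable]: "g \<in> N \<rightarrow>\<^sub>M actions D"
    and h[measurable]: "h \<in> N \<rightarrow>\<^sub>M states D"
  shows "(\<lambda>x. hist_ext t (f x) (g x) (h x)) \<in> N \<rightarrow>\<^sub>M hist_space D (Suc t)"
proof -
  have [measurable]: "(\<lambda>x. fst (f x)) \<in> N \<rightarrow>\<^sub>M PiM {0..<t} (\<lambda>_. state_actions D)"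
    "(\<lambda>x. snd (f x)) \<in> N \<rightarrow>\<^sub>M states D"
    using f unfolding hist_space_def by (auto intro: measurable_compose[OF _ measurable_fst] measurable_compose[OF _ measurable_snd])
  have "(\<lambda>x. (fst (f x))(t := (snd (f x), g x))) \<in> N \<rightarrow>\<^sub>M PiM {0..<Suc t} (\<lambda>_. state_actions D)"
    by (rule measurable_fun_upd[where J="{0..<t}"]) (auto, measurable)
  then show ?thesis
    unfolding hist_ext_def hist_space_def by measurable
qed

lemma measurable_current_state [measurable (raw)]:
  "f \<in> N \<rightarrow>\<^sub>M hist_space D t \<Longrightarrow> (\<lambda>x. snd (f x)) \<in> N \<rightarrow>\<^sub>M states D"
  unfolding hist_space_def by (rule measurable_compose[OF _ measurable_snd])

lemma measurable_likelihood [measurable (raw)]: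
  assumes f: "f \<in> N \<rightarrow>\<^sub>M hist_space D t" and g[measurable]: "g \<in> N \<rightarrow>\<^sub>M params D"
  shows "(\<lambda>x. likelihood D t (f x) (g x)) \<in> borel_measurable N"
proof -
  have 1: "(\<lambda>x. fst (f x) i) \<in> N \<rightarrow>\<^sub>M state_actions D" if "i < t" for i
  proof -
    have "(\<lambda>x. fst (f x)) \<in> N \<rightarrow>\<^sub>M PiM {0..<t} (\<lambda>_. state_actions D)"
      using f unfolding hist_space_def by (rule measurable_compose[OF _ measurable_fst])
    from measurable_compose[OF this measurable_component_singleton[of i]] that show ?thesis by simp
  qed
  have 2: "(\<lambda>x. hist_state t (f x) i) \<in> N \<rightarrow>\<^sub>M states D" for i
    using 1[of i] f by (cases "i < t") (auto simp: hist_state_def intro: measurable_state_of measurable_current_state)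
  show ?thesis
    unfolding likelihood_def
    by (intro borel_measurable_prod measurable_tdens g 2 measurable_action_of 1) auto
qed

lemma hist_state_in_space:
  "H \<in> space (hist_space D t) \<Longrightarrow> hist_state t H i \<in> space (states D)"
  by (auto simp: space_hist_space hist_state_def space_PiM PiE_iff space_state_actions mem_Times_iff)

lemma likelihood_nonneg:
  "H \<in> space (hist_space D t) \<Longrightarrow> \<theta> \<in> space (params D) \<Longrightarrow> 0 \<le> likelihood D t H \<theta>"
  unfolding likelihood_def
  by (intro prod_nonneg ballI tdens_nonneg hist_state_in_space)
     (auto simp: space_hist_space space_PiM PiE_iff space_state_actions mem_Times_iff)

end

context mdp_control
begin

lemma prob_space_process_law: "prob_space (process_law D ini \<theta> \<pi>)"
  and sets_process_law: "sets (process_law D ini \<theta> \<pi>) = sets (PiM UNIV (\<lambda>_. state_actions D))"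
  and space_process_law: "space (process_law D ini \<theta> \<pi>) = space (PiM UNIV (\<lambda>_. state_actions D))"
  unfolding process_law_def
  by (auto intro: prob_space_frozen_law simp: sets_frozen_law space_frozen_law)

lemma measurable_process_law: "f \<in> process_law D ini \<theta> \<pi> \<rightarrow>\<^sub>M N \<longleftrightarrow> f \<in> PiM UNIV (\<lambda>_. state_actions D) \<rightarrow>\<^sub>M N"
  by (simp add: measurable_cong_sets[OF sets_process_law])

lemmas nn_integral_process_step =
  nn_integral_frozen_step[of 0 "\<lambda>_. undefined", folded process_law_def, simplified]

lemma hist_at_in_space: "\<omega> \<in> space (process_law D ini \<theta> \<pi>) \<Longrightarrow> hist_at t \<omega> \<in> space (hist_space D t)"
  using measurable_space[OF measurable_hist_at] by (simp add: space_process_law)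

lemma measurable_policy_integral:
  assumes F: "(\<lambda>(H, a). F H a) \<in> borel_measurable (hist_space D t \<Otimes>\<^sub>M actions D)"
  shows "(\<lambda>H. \<integral>\<^sup>+a. F H a \<partial>\<pi> t H) \<in> borel_measurable (hist_space D t)"
  by (rule nn_integral_measurable_subprob_algebra2[OF F measurable_prob_algebraD[OF measurable_policy]])

text \<open>Given the history up to \<open>S\<^sub>t\<close>, the action has law
  \<open>\<pi> t\<close>. The step formula is applied twice: the integrand on the right is constant
  in the action, so integrating it against \<open>\<pi> t\<close> once more changes nothing.\<close>

lemma nn_integral_process_action:
  assumes F[measurable]: "(\<lambda>(H, a). F H a) \<in> borel_measurable (hist_space D t \<Otimes>\<^sub>M actions D)"
  shows "(\<integral>\<^sup>+\<omega>. F (hist_at t \<omega>) (snd (\<omega> t)) \<partial>process_law D ini \<theta> \<pi>) =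
    (\<integral>\<^sup>+\<omega>. \<integral>\<^sup>+a. F (hist_at t \<omega>) a \<partial>\<pi> t (hist_at t \<omega>) \<partial>process_law D ini \<theta> \<pi>)"
proof -
  let ?X = "PiM {0..<t} (\<lambda>_. state_actions D)"
  have [measurable]: "(\<lambda>H. \<integral>\<^sup>+a. F H a \<partial>\<pi> t H) \<in> borel_measurable (hist_space D t)"
    by (rule measurable_policy_integral[OF F])
  have [measurable]: "(\<lambda>z. (fst z, fst (snd z))) \<in> ?X \<Otimes>\<^sub>M state_actions D \<rightarrow>\<^sub>M hist_space D t"
    unfolding hist_space_def by measurable
  have "(\<lambda>z. ((fst z, fst (snd z)), snd (snd z))) \<in> ?X \<Otimes>\<^sub>M state_actions D \<rightarrow>\<^sub>M hist_space D t \<Otimes>\<^sub>M actions D"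
    by measurable
  from measurable_compose[OF this F]
  have F1: "(\<lambda>(x, y). F (x, fst y) (snd y)) \<in> borel_measurable (?X \<Otimes>\<^sub>M state_actions D)"
    by (simp add: case_prod_beta)
  have F2: "(\<lambda>(x, y). \<integral>\<^sup>+a. F (x, fst y) a \<partial>\<pi> t (x, fst y)) \<in> borel_measurable (?X \<Otimes>\<^sub>M state_actions D)"
    unfolding case_prod_beta by measurable
  have "(\<integral>\<^sup>+\<omega>. F (hist_at t \<omega>) (snd (\<omega> t)) \<partial>process_law D ini \<theta> \<pi>) =
    (\<integral>\<^sup>+\<omega>. \<integral>\<^sup>+s. \<integral>\<^sup>+a. F (restrict \<omega> {0..<t}, s) a \<partial>\<pi> t (restrict \<omega> {0..<t}, s)
        \<partial>state_kernel t (restrict \<omega> {0..<t}) \<partial>process_law D ini \<theta> \<pi>)"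
    using nn_integral_process_step[OF F1] by (simp add: hist_at_def)
  also have "\<dots> = (\<integral>\<^sup>+\<omega>. \<integral>\<^sup>+s. \<integral>\<^sup>+a. (\<integral>\<^sup>+a'. F (restrict \<omega> {0..<t}, s) a' \<partial>\<pi> t (restrict \<omega> {0..<t}, s))
     \<partial>\<pi> t (restrict \<omega> {0..<t}, s) \<partial>state_kernel t (restrict \<omega> {0..<t}) \<partial>process_law D ini \<theta> \<pi>)"
  proof (rule nn_integral_cong, rule nn_integral_cong)
    fix \<omega> s assume \<omega>: "\<omega> \<in> space (process_law D ini \<theta> \<pi>)" and s: "s \<in> space (state_kernel t (restrict \<omega> {0..<t}))"
    have r: "restrict \<omega> {0..<t} \<in> space ?X"
      using \<omega> by (auto simp: space_process_law space_PiM PiE_iff)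
    have "state_kernel t (restrict \<omega> {0..<t}) \<in> space (prob_algebra (states D))"
      using measurable_space[OF measurable_state_kernel r] .
    then have "space (state_kernel t (restrict \<omega> {0..<t})) = space (states D)"
      by (auto simp: space_prob_algebra dest: sets_eq_imp_space_eq)
    then have "(restrict \<omega> {0..<t}, s) \<in> space (hist_space D t)"
      using r s by (simp add: space_hist_space)
    from prob_space.emeasure_space_1[OF policy_prob_space(1)[OF this]]
    show "(\<integral>\<^sup>+a. F (restrict \<omega> {0..<t}, s) a \<partial>\<pi> t (restrict \<omega> {0..<t}, s)) =
      (\<integral>\<^sup>+a. (\<integral>\<^sup>+a'. F (restrict \<omega> {0..<t}, s) a' \<partial>\<pi> t (restrict \<omega> {0..<t}, s))
     \<partial>\<pi> t (restrict \<omega> {0..<t}, s))" by simp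
  qed
  also have "\<dots> = (\<integral>\<^sup>+\<omega>. \<integral>\<^sup>+a. F (hist_at t \<omega>) a \<partial>\<pi> t (hist_at t \<omega>) \<partial>process_law D ini \<theta> \<pi>)"
    using nn_integral_process_step[OF F2] by (simp add: hist_at_def)
  finally show ?thesis .
qed

lemma nn_integral_state_kernel_Suc:
  assumes x: "x \<in> space (PiM {0..<Suc t} (\<lambda>_. state_actions D))"
    and F[measurable]: "F \<in> borel_measurable (states D)"
  shows "(\<integral>\<^sup>+s. F s \<partial>state_kernel (Suc t) x) =
    (\<integral>\<^sup>+s. ennreal (tdens D \<theta> (fst (x t)) (snd (x t)) s) * F s \<partial>states D)"
proof -
  have *[measurable]: "fst (x t) \<in> space (states D)" "snd (x t) \<in> space (actions D)"
    using x by (auto simp: space_PiM PiE_iff space_state_actions mem_Times_iff)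
  have "(\<lambda>s. tdens D \<theta> (fst (x t)) (snd (x t)) s) \<in> borel_measurable (states D)"
    using \<theta> * by measurable
  then show ?thesis
    by (simp add: state_kernel_def nn_integral_density)
qed

text \<open>The counterpart for states: given all pairs up to time t, the next state has the
  transition density. The action drawn together with that state integrates out, having total mass
  one.\<close>

lemma nn_integral_process_state:
  assumes F[measurable]: "(\<lambda>(x, s). F x s) \<in> borel_measurable (PiM {0..<Suc t} (\<lambda>_. state_actions D) \<Otimes>\<^sub>M states D)"
  shows "(\<integral>\<^sup>+\<omega>. F (restrict \<omega> {0..<Suc t}) (fst (\<omega> (Suc t))) \<partial>process_law D ini \<theta> \<pi>) =
    (\<integral>\<^sup>+\<omega>. \<integral>\<^sup>+s. ennreal (tdens D \<theta> (fst (\<omega> t)) (snd (\<omega> t)) s) * F (restrict \<omega> {0..<Suc t}) s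
      \<partial>states D \<partial>process_law D ini \<theta> \<pi>)"
proof -
  let ?X = "PiM {0..<Suc t} (\<lambda>_. state_actions D)"
  have "(\<lambda>z. (fst z, fst (snd z))) \<in> ?X \<Otimes>\<^sub>M state_actions D \<rightarrow>\<^sub>M ?X \<Otimes>\<^sub>M states D"
    by measurable
  from measurable_compose[OF this F]
  have F1: "(\<lambda>(x, y). F x (fst y)) \<in> borel_measurable (?X \<Otimes>\<^sub>M state_actions D)"
    by (simp add: case_prod_beta)
  have "(\<integral>\<^sup>+\<omega>. F (restrict \<omega> {0..<Suc t}) (fst (\<omega> (Suc t))) \<partial>process_law D ini \<theta> \<pi>) =
    (\<integral>\<^sup>+\<omega>. \<integral>\<^sup>+s. \<integral>\<^sup>+a. F (restrict \<omega> {0..<Suc t}) s \<partial>\<pi> (Suc t) (restrict \<omega> {0..<Suc t}, s)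
        \<partial>state_kernel (Suc t) (restrict \<omega> {0..<Suc t}) \<partial>process_law D ini \<theta> \<pi>)"
    using nn_integral_process_step[OF F1] by simp
  also have "\<dots> = (\<integral>\<^sup>+\<omega>. \<integral>\<^sup>+s. ennreal (tdens D \<theta> (fst (\<omega> t)) (snd (\<omega> t)) s) * F (restrict \<omega> {0..<Suc t}) s
      \<partial>states D \<partial>process_law D ini \<theta> \<pi>)"
  proof (intro nn_integral_cong)
    fix \<omega> assume \<omega>: "\<omega> \<in> space (process_law D ini \<theta> \<pi>)"
    have r: "restrict \<omega> {0..<Suc t} \<in> space ?X"
      using \<omega> by (auto simp: space_process_law space_PiM PiE_iff)
    have "state_kernel (Suc t) (restrict \<omega> {0..<Suc t}) \<in> space (prob_algebra (states D))"
      using measurable_space[OF measurable_state_kernel r] .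
    then have sp: "space (state_kernel (Suc t) (restrict \<omega> {0..<Suc t})) = space (states D)"
      by (auto simp: space_prob_algebra dest: sets_eq_imp_space_eq)
    have "(\<integral>\<^sup>+s. \<integral>\<^sup>+a. F (restrict \<omega> {0..<Suc t}) s \<partial>\<pi> (Suc t) (restrict \<omega> {0..<Suc t}, s)
        \<partial>state_kernel (Suc t) (restrict \<omega> {0..<Suc t})) =
        (\<integral>\<^sup>+s. F (restrict \<omega> {0..<Suc t}) s \<partial>state_kernel (Suc t) (restrict \<omega> {0..<Suc t}))"
    proof (intro nn_integral_cong)
      fix s assume "s \<in> space (state_kernel (Suc t) (restrict \<omega> {0..<Suc t}))"
      then have "(restrict \<omega> {0..<Suc t}, s) \<in> space (hist_space D (Suc t))"
        using r sp by (simp add: space_hist_space)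
      from prob_space.emeasure_space_1[OF policy_prob_space(1)[OF this]]
      show "(\<integral>\<^sup>+a. F (restrict \<omega> {0..<Suc t}) s \<partial>\<pi> (Suc t) (restrict \<omega> {0..<Suc t}, s)) = F (restrict \<omega> {0..<Suc t}) s"
        by simp
    qed
    also have "\<dots> = (\<integral>\<^sup>+s. ennreal (tdens D \<theta> (fst (\<omega> t)) (snd (\<omega> t)) s) * F (restrict \<omega> {0..<Suc t}) s \<partial>states D)"
      using nn_integral_state_kernel_Suc[OF r, of "F (restrict \<omega> {0..<Suc t})"]
        measurable_compose[OF measurable_Pair1'[OF r] F] by simp
    finally show "(\<integral>\<^sup>+s. \<integral>\<^sup>+a. F (restrict \<omega> {0..<Suc t}) s \<partial>\<pi> (Suc t) (restrict \<omega> {0..<Suc t}, s)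
        \<partial>state_kernel (Suc t) (restrict \<omega> {0..<Suc t})) =
       (\<integral>\<^sup>+s. ennreal (tdens D \<theta> (fst (\<omega> t)) (snd (\<omega> t)) s) * F (restrict \<omega> {0..<Suc t}) s \<partial>states D)" .
  qed
  finally show ?thesis .
qed

lemma sets_hist_law: "sets (hist_law D ini \<theta> \<pi> t) = sets (hist_space D t)"
  by (simp add: hist_law_def)

lemma space_hist_law: "space (hist_law D ini \<theta> \<pi> t) = space (hist_space D t)"
  by (simp add: hist_law_def)

lemma prob_space_hist_law: "prob_space (hist_law D ini \<theta> \<pi> t)"
  unfolding hist_law_def
  by (rule prob_space.prob_space_distr[OF prob_space_process_law]) (simp add: measurable_process_law)

lemma nn_integral_hist_law:
  "F \<in> borel_measurable (hist_space D t) \<Longrightarrow>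
    (\<integral>\<^sup>+H. F H \<partial>hist_law D ini \<theta> \<pi> t) = (\<integral>\<^sup>+\<omega>. F (hist_at t \<omega>) \<partial>process_law D ini \<theta> \<pi>)"
  unfolding hist_law_def by (rule nn_integral_distr) (simp_all add: measurable_process_law)

lemma nn_integral_hist_law_0:
  assumes F[measurable]: "F \<in> borel_measurable (hist_space D 0)"
  shows "(\<integral>\<^sup>+H. F H \<partial>hist_law D ini \<theta> \<pi> 0) = (\<integral>\<^sup>+s. F (\<lambda>_. undefined, s) \<partial>ini)"
proof -
  let ?u = "\<lambda>_::nat. undefined :: 's \<times> 'a"
  have u: "?u \<in> space (PiM {0..<0} (\<lambda>_. state_actions D))" by simp
  have h0: "(\<lambda>s. (?u, s)) \<in> states D \<rightarrow>\<^sub>M hist_space D 0"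
    unfolding hist_space_def by (intro measurable_Pair1' u)
  have F1: "(\<lambda>(x, y). F (?u, fst y)) \<in> borel_measurable (PiM {0..<0} (\<lambda>_. state_actions D) \<Otimes>\<^sub>M state_actions D)"
    unfolding case_prod_beta
    by (rule measurable_compose[OF _ F], rule measurable_compose[OF _ h0]) measurable
  interpret pl: prob_space "process_law D ini \<theta> \<pi>" by (rule prob_space_process_law)
  have "(\<integral>\<^sup>+H. F H \<partial>hist_law D ini \<theta> \<pi> 0) = (\<integral>\<^sup>+\<omega>. F (?u, fst (\<omega> 0)) \<partial>process_law D ini \<theta> \<pi>)"
    by (simp add: nn_integral_hist_law hist_at_def restrict_def)
  also have "\<dots> = (\<integral>\<^sup>+\<omega>. \<integral>\<^sup>+s. \<integral>\<^sup>+a. F (?u, s) \<partial>\<pi> 0 (?u, s) \<partial>ini \<partial>process_law D ini \<theta> \<pi>)"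
    using nn_integral_process_step[OF F1] by (simp add: state_kernel_def restrict_def)
  also have "\<dots> = (\<integral>\<^sup>+\<omega>. \<integral>\<^sup>+s. F (?u, s) \<partial>ini \<partial>process_law D ini \<theta> \<pi>)"
  proof (rule nn_integral_cong, rule nn_integral_cong)
    fix s assume "s \<in> space ini"
    then have "(?u, s) \<in> space (hist_space D 0)" by (simp add: space_hist_space space_ini)
    from prob_space.emeasure_space_1[OF policy_prob_space(1)[OF this]]
    show "(\<integral>\<^sup>+a. F (?u, s) \<partial>\<pi> 0 (?u, s)) = F (?u, s)" by simp
  qed
  also have "\<dots> = (\<integral>\<^sup>+s. F (?u, s) \<partial>ini)"
    by (simp add: pl.emeasure_space_1)
  finally show ?thesis .
qed

text \<open>Coordinates of a trajectory are pairs of a state and an action, whereas a history ends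
  with a state. Extending it therefore joins the action half of step t to the state half of step t +
  1.\<close>

lemma nn_integral_hist_law_Suc:
  assumes F[measurable]: "F \<in> borel_measurable (hist_space D (Suc t))"
  shows "(\<integral>\<^sup>+H. F H \<partial>hist_law D ini \<theta> \<pi> (Suc t)) =
    (\<integral>\<^sup>+H. \<integral>\<^sup>+a. \<integral>\<^sup>+s. ennreal (tdens D \<theta> (snd H) a s) * F (hist_ext t H a s) \<partial>states D \<partial>\<pi> t H
       \<partial>hist_law D ini \<theta> \<pi> t)"
proof -
  have F1: "(\<lambda>(x, s). F (x, s)) \<in> borel_measurable (PiM {0..<Suc t} (\<lambda>_. state_actions D) \<Otimes>\<^sub>M states D)"
    using F by (simp add: hist_space_def)
  have G: "(\<lambda>(H, a). \<integral>\<^sup>+s. ennreal (tdens D \<theta> (snd H) a s) * F (hist_ext t H a s) \<partial>states D)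
    \<in> borel_measurable (hist_space D t \<Otimes>\<^sub>M actions D)"
    unfolding case_prod_beta
    by (rule states.borel_measurable_nn_integral) (use \<theta> in \<open>simp add: case_prod_beta, measurable\<close>)
  have "(\<integral>\<^sup>+H. F H \<partial>hist_law D ini \<theta> \<pi> (Suc t)) =
    (\<integral>\<^sup>+\<omega>. F (restrict \<omega> {0..<Suc t}, fst (\<omega> (Suc t))) \<partial>process_law D ini \<theta> \<pi>)"
    by (simp add: nn_integral_hist_law hist_at_def)
  also have "\<dots> = (\<integral>\<^sup>+\<omega>. \<integral>\<^sup>+s. ennreal (tdens D \<theta> (fst (\<omega> t)) (snd (\<omega> t)) s) * F (restrict \<omega> {0..<Suc t}, s)
      \<partial>states D \<partial>process_law D ini \<theta> \<pi>)"
    by (rule nn_integral_process_state[OF F1])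
  also have "\<dots> = (\<integral>\<^sup>+\<omega>. \<integral>\<^sup>+s. ennreal (tdens D \<theta> (snd (hist_at t \<omega>)) (snd (\<omega> t)) s)
       * F (hist_ext t (hist_at t \<omega>) (snd (\<omega> t)) s) \<partial>states D \<partial>process_law D ini \<theta> \<pi>)"
  proof -
    have "(restrict \<omega> {0..<Suc t}, s) = hist_ext t (hist_at t \<omega>) (snd (\<omega> t)) s" for \<omega> :: "nat \<Rightarrow> 's \<times> 'a" and s
      by (auto simp: hist_at_def hist_ext_def restrict_def fun_eq_iff less_Suc_eq)
    then show ?thesis by (simp add: hist_at_def)
  qed
  also have "\<dots> = (\<integral>\<^sup>+\<omega>. \<integral>\<^sup>+a. \<integral>\<^sup>+s. ennreal (tdens D \<theta> (snd (hist_at t \<omega>)) a s)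
       * F (hist_ext t (hist_at t \<omega>) a s) \<partial>states D \<partial>\<pi> t (hist_at t \<omega>) \<partial>process_law D ini \<theta> \<pi>)"
    by (rule nn_integral_process_action[OF G])
  also have "\<dots> = (\<integral>\<^sup>+H. \<integral>\<^sup>+a. \<integral>\<^sup>+s. ennreal (tdens D \<theta> (snd H) a s) * F (hist_ext t H a s) \<partial>states D \<partial>\<pi> t H
       \<partial>hist_law D ini \<theta> \<pi> t)"
    by (rule nn_integral_hist_law[symmetric, OF measurable_policy_integral[OF G]])
  finally show ?thesis .
qed

end

text \<open>Histories have a common dominating law: the one under which every transition is drawn from the
  normalised reference measure, whatever the current state and action.\<close>

definition uniform_family :: "('s, 'a, 'p) mdp_family \<Rightarrow> ('s, 'a, 'p) mdp_family" where
  "uniform_family D = D\<lparr>tdens := \<lambda>_ _ _ _. 1 / measure (states D) (space (states D))\<rparr>"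

lemma uniform_family_simps [simp]:
  "states (uniform_family D) = states D" "actions (uniform_family D) = actions D"
  "params (uniform_family D) = params D" "reward (uniform_family D) = reward D"
  "tdens (uniform_family D) = (\<lambda>_ _ _ _. 1 / measure (states D) (space (states D)))"
  "state_actions (uniform_family D) = state_actions D" "hist_space (uniform_family D) = hist_space D"
  "is_policy (uniform_family D) = is_policy D"
  by (auto simp: uniform_family_def state_actions_def hist_space_def[abs_def] is_policy_def fun_eq_iff)

locale finite_mdp_control = mdp_control +
  assumes finite_states: "emeasure (states D) (space (states D)) \<noteq> \<infinity>"
begin

definition mass :: real where "mass = measure (states D) (space (states D))"

lemma emeasure_states: "emeasure (states D) (space (states D)) = ennreal mass"
  using finite_states by (simp add: mass_def emeasure_eq_ennreal_measure)

lemma states_not_empty: "space (states D) \<noteq> {}"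
  using prob_space.not_empty[OF prob_ini] by (simp add: space_ini)

lemma actions_not_empty: "space (actions D) \<noteq> {}"
proof -
  obtain s where "s \<in> space (states D)" using states_not_empty by blast
  then have "(\<lambda>_. undefined, s) \<in> space (hist_space D 0)" by (simp add: space_hist_space)
  from prob_space.not_empty[OF policy_prob_space(1)[OF this]] policy_prob_space(3)[OF this] show ?thesis by simp
qed

lemma mass_pos: "0 < mass"
proof (rule ccontr)
  assume "\<not> 0 < mass"
  then have 0: "emeasure (states D) (space (states D)) = 0"
    by (simp add: emeasure_states not_less ennreal_neg)
  obtain s a where sa: "s \<in> space (states D)" "a \<in> space (actions D)"
    using states_not_empty actions_not_empty by blast
  have "AE s' in states D. False"
    using 0 by (intro AE_I[where N="space (states D)"]) auto
  then have "(\<integral>\<^sup>+s'. ennreal (tdens D \<theta> s a s') \<partial>states D) = (\<integral>\<^sup>+s'. 0 \<partial>states D)"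
    by (intro nn_integral_cong_AE) auto
  then show False using nn_integral_tdens[OF \<theta> sa] by simp
qed

lemma wf_uniform_family: "wf_mdp_family (uniform_family D)"
proof -
  have "(\<integral>\<^sup>+s'. ennreal (1 / mass) \<partial>states D) = ennreal (1 / mass) * ennreal mass"
    by (simp add: emeasure_states)
  also have "\<dots> = 1"
    using mass_pos by (simp add: ennreal_mult[symmetric])
  finally have 1: "(\<integral>\<^sup>+s'. ennreal (1 / mass) \<partial>states D) = 1" .
  have 2: "(\<lambda>(\<theta>, (s, a), s'). 1 / mass) \<in> borel_measurable (params D \<Otimes>\<^sub>M (state_actions D \<Otimes>\<^sub>M states D))"
    unfolding case_prod_unfold by (rule measurable_const) simp
  have 3: "0 \<le> 1 / mass" using mass_pos by simp
  have 4: "(\<lambda>(s, a). reward D s a) \<in> borel_measurable (state_actions D)"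
    using wf unfolding wf_mdp_family_def by blast
  show ?thesis
    unfolding wf_mdp_family_def uniform_family_simps mass_def[symmetric]
    by (intro conjI ballI 1 2 3 4 states.sigma_finite_measure_axioms actions.sigma_finite_measure_axioms)
qed

lemma uniform_family_control: "mdp_control (uniform_family D) ini \<pi> \<theta>"
  unfolding mdp_control_def mdp_def mdp_control_axioms_def uniform_family_simps
  using wf_uniform_family prob_ini sets_ini policy \<theta> by blast

definition ref_law :: "nat \<Rightarrow> ('a, 'b) hist measure" where
  "ref_law t = hist_law (uniform_family D) ini \<theta> \<pi> t"

lemma sets_ref_law: "sets (ref_law t) = sets (hist_space D t)"
  by (simp add: ref_law_def hist_law_def)

lemma space_ref_law: "space (ref_law t) = space (hist_space D t)"
  by (simp add: ref_law_def hist_law_def)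

lemma prob_space_ref_law: "prob_space (ref_law t)"
  unfolding ref_law_def by (rule mdp_control.prob_space_hist_law[OF uniform_family_control])

lemma nn_integral_ref_law_Suc:
  assumes "F \<in> borel_measurable (hist_space D (Suc t))"
  shows "(\<integral>\<^sup>+H. F H \<partial>ref_law (Suc t)) =
    (\<integral>\<^sup>+H. \<integral>\<^sup>+a. \<integral>\<^sup>+s. ennreal (1 / mass) * F (hist_ext t H a s) \<partial>states D \<partial>\<pi> t H \<partial>ref_law t)"
  using mdp_control.nn_integral_hist_law_Suc[OF uniform_family_control, of F t] assms
  by (simp add: ref_law_def mass_def)

text \<open>A transition has density \<open>mass * tdens\<close> with respect to the normalised
  reference measure, which gives the factor \<open>mass ^ t\<close>. The initial law and the policy
  are the same under both laws and cancel.\<close>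

lemma nn_integral_hist_law_density:
  assumes "F \<in> borel_measurable (hist_space D t)"
  shows "(\<integral>\<^sup>+H. F H \<partial>hist_law D ini \<theta> \<pi> t) =
     (\<integral>\<^sup>+H. ennreal (mass ^ t * likelihood D t H \<theta>) * F H \<partial>ref_law t)"
  using assms
proof (induction t arbitrary: F)
  case 0
  then show ?case
    using mdp_control.nn_integral_hist_law_0[OF uniform_family_control, of F]
    by (simp add: nn_integral_hist_law_0 likelihood_def ref_law_def)
next
  case (Suc t)
  note [measurable] = Suc.prems
  let ?c = "\<lambda>t H. ennreal (mass ^ t * likelihood D t H \<theta>)"
  have Gm: "(\<lambda>(H, a). \<integral>\<^sup>+s. ennreal (tdens D \<theta> (snd H) a s) * F (hist_ext t H a s) \<partial>states D)
    \<in> borel_measurable (hist_space D t \<Otimes>\<^sub>M actions D)"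
    unfolding case_prod_beta
    by (rule states.borel_measurable_nn_integral) (use \<theta> in \<open>simp add: case_prod_beta, measurable\<close>)
  have "(\<integral>\<^sup>+H. F H \<partial>hist_law D ini \<theta> \<pi> (Suc t)) =
    (\<integral>\<^sup>+H. ?c t H * (\<integral>\<^sup>+a. \<integral>\<^sup>+s. ennreal (tdens D \<theta> (snd H) a s) * F (hist_ext t H a s) \<partial>states D \<partial>\<pi> t H) \<partial>ref_law t)"
    unfolding nn_integral_hist_law_Suc[OF Suc.prems]
    by (rule Suc.IH[OF measurable_policy_integral[OF Gm]])
  also have "\<dots> = (\<integral>\<^sup>+H. \<integral>\<^sup>+a. \<integral>\<^sup>+s. ennreal (1 / mass) * (?c (Suc t) (hist_ext t H a s) * F (hist_ext t H a s))
      \<partial>states D \<partial>\<pi> t H \<partial>ref_law t)"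
  proof (intro nn_integral_cong)
    fix H assume "H \<in> space (ref_law t)"
    then have H[measurable]: "H \<in> space (hist_space D t)" by (simp add: space_ref_law)
    note spc = policy_prob_space[OF H]
    have sH: "snd H \<in> space (states D)" using H by (simp add: space_hist_space)
    have m1: "(\<lambda>a. \<integral>\<^sup>+s. ennreal (tdens D \<theta> (snd H) a s) * F (hist_ext t H a s) \<partial>states D) \<in> borel_measurable (\<pi> t H)"
      using measurable_compose[OF measurable_Pair1'[OF H] Gm] by (simp add: measurable_cong_sets[OF spc(2) refl])
    have "?c t H * (\<integral>\<^sup>+a. \<integral>\<^sup>+s. ennreal (tdens D \<theta> (snd H) a s) * F (hist_ext t H a s) \<partial>states D \<partial>\<pi> t H) =
      (\<integral>\<^sup>+a. ?c t H * (\<integral>\<^sup>+s. ennreal (tdens D \<theta> (snd H) a s) * F (hist_ext t H a s) \<partial>states D) \<partial>\<pi> t H)"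
      by (rule nn_integral_cmult[symmetric, OF m1])
    also have "\<dots> = (\<integral>\<^sup>+a. \<integral>\<^sup>+s. ennreal (1 / mass) * (?c (Suc t) (hist_ext t H a s) * F (hist_ext t H a s))
      \<partial>states D \<partial>\<pi> t H)"
    proof (intro nn_integral_cong)
      fix a assume "a \<in> space (\<pi> t H)"
      then have a[measurable]: "a \<in> space (actions D)" by (simp add: spc)
      have m2: "(\<lambda>s. ennreal (tdens D \<theta> (snd H) a s) * F (hist_ext t H a s)) \<in> borel_measurable (states D)"
        using \<theta> sH by measurable
      have "?c t H * (\<integral>\<^sup>+s. ennreal (tdens D \<theta> (snd H) a s) * F (hist_ext t H a s) \<partial>states D) =
        (\<integral>\<^sup>+s. ?c t H * (ennreal (tdens D \<theta> (snd H) a s) * F (hist_ext t H a s)) \<partial>states D)"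
        by (rule nn_integral_cmult[symmetric, OF m2])
      also have "\<dots> = (\<integral>\<^sup>+s. ennreal (1 / mass) * (?c (Suc t) (hist_ext t H a s) * F (hist_ext t H a s)) \<partial>states D)"
      proof (intro nn_integral_cong)
        fix s assume s: "s \<in> space (states D)"
        have nn: "0 \<le> likelihood D t H \<theta>" "0 \<le> tdens D \<theta> (snd H) a s"
          using likelihood_nonneg[OF H \<theta>] tdens_nonneg[OF \<theta> sH a s] by auto
        have "ennreal (1 / mass) * ?c (Suc t) (hist_ext t H a s) =
            ennreal (1 / mass * (mass ^ Suc t * (likelihood D t H \<theta> * tdens D \<theta> (snd H) a s)))"
          using mass_pos unfolding likelihood_hist_ext by (subst ennreal_mult') auto
        also have "1 / mass * (mass ^ Suc t * (likelihood D t H \<theta> * tdens D \<theta> (snd H) a s)) =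
            mass ^ t * likelihood D t H \<theta> * tdens D \<theta> (snd H) a s"
          using mass_pos by simp
        also have "ennreal \<dots> = ?c t H * ennreal (tdens D \<theta> (snd H) a s)"
          using nn(2) by (rule ennreal_mult'')
        finally show "?c t H * (ennreal (tdens D \<theta> (snd H) a s) * F (hist_ext t H a s)) =
          ennreal (1 / mass) * (?c (Suc t) (hist_ext t H a s) * F (hist_ext t H a s))"
          unfolding mult.assoc[symmetric] by (simp only:)
      qed
      finally show "?c t H * (\<integral>\<^sup>+s. ennreal (tdens D \<theta> (snd H) a s) * F (hist_ext t H a s) \<partial>states D) =
        (\<integral>\<^sup>+s. ennreal (1 / mass) * (?c (Suc t) (hist_ext t H a s) * F (hist_ext t H a s)) \<partial>states D)" .
    qed
    finally show "?c t H * (\<integral>\<^sup>+a. \<integral>\<^sup>+s. ennreal (tdens D \<theta> (snd H) a s) * F (hist_ext t H a s) \<partial>states D \<partial>\<pi> t H) =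
      (\<integral>\<^sup>+a. \<integral>\<^sup>+s. ennreal (1 / mass) * (?c (Suc t) (hist_ext t H a s) * F (hist_ext t H a s)) \<partial>states D \<partial>\<pi> t H)" .
  qed
  also have "\<dots> = (\<integral>\<^sup>+H. ?c (Suc t) H * F H \<partial>ref_law (Suc t))"
  proof -
    have "(\<lambda>H. ?c (Suc t) H * F H) \<in> borel_measurable (hist_space D (Suc t))"
      using \<theta> by measurable
    from nn_integral_ref_law_Suc[OF this] show ?thesis by simp
  qed
  finally show ?case .
qed

lemma hist_law_eq_density:
  "hist_law D ini \<theta> \<pi> t = density (ref_law t) (\<lambda>H. ennreal (mass ^ t * likelihood D t H \<theta>))"
proof (rule measure_eqI)
  show "sets (hist_law D ini \<theta> \<pi> t) = sets (density (ref_law t) (\<lambda>H. ennreal (mass ^ t * likelihood D t H \<theta>)))"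
    by (simp add: sets_hist_law sets_ref_law)
  fix X assume "X \<in> sets (hist_law D ini \<theta> \<pi> t)"
  then have X[measurable]: "X \<in> sets (hist_space D t)" by (simp add: sets_hist_law)
  have "(\<lambda>H. ennreal (mass ^ t * likelihood D t H \<theta>)) \<in> borel_measurable (ref_law t)"
    unfolding measurable_cong_sets[OF sets_ref_law refl] using \<theta> by measurable
  then show "emeasure (hist_law D ini \<theta> \<pi> t) X =
      emeasure (density (ref_law t) (\<lambda>H. ennreal (mass ^ t * likelihood D t H \<theta>))) X"
    using nn_integral_hist_law_density[of "indicator X" t] X
    by (simp add: emeasure_density sets_ref_law sets_hist_law)
qed

text \<open>Uniform transitions ignore the parameter, so all parameters share one dominating law.
  This allows likelihoods of different parameters to be compared at the same history and averaged
  over the prior.\<close>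

lemma ref_law_any: "hist_law (uniform_family D) ini \<theta>' \<pi> t = ref_law t"
proof -
  have "step_kernel (uniform_family D) ini \<theta>' \<pi> = step_kernel (uniform_family D) ini \<theta> \<pi>"
    by (auto simp: step_kernel_def[abs_def] fun_eq_iff split: nat.split)
  then show ?thesis
    by (simp add: ref_law_def hist_law_def process_law_def frozen_law_def)
qed

end

section \<open>Likelihood ratios and Hellinger distances\<close>

text \<open>Where g < exp (- 2 c) f, the logarithm of f / g exceeds 2 c. Its mean under the law with
  density f is at most c, so it deviates from the mean by at least c, and Markov's inequality
  applies to the n-th power of the deviation.\<close>

lemma KL_likelihood_ratio:
  fixes f g :: "'b \<Rightarrow> real"
  assumes R: "prob_space R" and P: "prob_space (density R f)" and Q: "prob_space (density R g)"
    and f[measurable]: "f \<in> borel_measurable R" and g[measurable]: "g \<in> borel_measurable R"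
    and fg: "\<And>x. x \<in> space R \<Longrightarrow> 0 \<le> f x" "\<And>x. x \<in> space R \<Longrightarrow> 0 \<le> g x"
    and KL: "KL (density R f) (density R g) \<le> ereal c" and c: "0 < c"
    and mom: "KL_moment n (density R f) (density R g) \<le> ennreal v"
  shows "emeasure (density R f) {x \<in> space R. g x < exp (- 2 * c) * f x} \<le> ennreal (v / c ^ n)"
proof -
  define P where "P = density R f"
  define Q where "Q = density R g"
  define \<kappa> where "\<kappa> = KL_divergence (exp 1) Q P"
  define e where "e = entropy_density (exp 1) Q P"
  interpret R: prob_space R by fact
  interpret P: prob_space P unfolding P_def by fact
  interpret Q: prob_space Q unfolding Q_def by fact
  have "KL P Q \<noteq> \<infinity>" using KL unfolding P_def Q_def by auto
  then have ac: "absolutely_continuous Q P" and KLe: "KL P Q = ereal \<kappa>"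
    unfolding KL_def \<kappa>_def by (auto split: if_splits)
  have \<kappa>: "\<kappa> \<le> c" using KL KLe unfolding P_def Q_def by simp
  have sets: "sets P = sets R" "sets Q = sets R" "space P = space R" by (simp_all add: P_def Q_def)
  have [measurable]: "e \<in> borel_measurable R"
    using measurable_entropy_density[of "exp 1" Q P] unfolding e_def by (simp add: measurable_cong_sets[OF sets(2) refl])
  have mom': "(\<integral>\<^sup>+x. ennreal (\<bar>e x - \<kappa>\<bar> ^ n) \<partial>P) \<le> ennreal v"
    using mom KLe by (simp add: KL_moment_def P_def[symmetric] Q_def[symmetric] e_def \<kappa>_def)
  have [measurable]: "RN_deriv Q P \<in> borel_measurable R"
    using borel_measurable_RN_deriv[of Q P] by (simp add: measurable_cong_sets[OF sets(2) refl])
  \<comment> \<open>The hypotheses speak of the Radon-Nikodym derivative of \<open>P\<close> by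
    \<open>Q\<close>. Uniqueness of densities with respect to \<open>R\<close> identifies it with f
    / g wherever f is positive.\<close>
  have "density R (\<lambda>x. ennreal (g x) * RN_deriv Q P x) = density Q (RN_deriv Q P)"
    unfolding Q_def by (rule density_density_eq[symmetric]) (simp_all add: Q_def[symmetric])
  also have "\<dots> = density R f"
    using Q.density_RN_deriv[OF ac] sets by (simp add: P_def)
  finally have "AE x in R. ennreal (g x) * RN_deriv Q P x = ennreal (f x)"
    by (subst (asm) R.density_unique_iff) simp_all
  then have "AE x in R. 0 < ennreal (f x) \<longrightarrow> 0 < g x \<and> e x = ln (f x / g x)"
  proof (rule AE_mp, intro AE_I2 impI)
    fix x assume x: "x \<in> space R" and eq: "ennreal (g x) * RN_deriv Q P x = ennreal (f x)" and pos: "0 < ennreal (f x)"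
    have f0: "0 < f x" using pos by (simp add: ennreal_eq_0_iff)
    have g0: "0 < g x" using eq pos fg(2)[OF x] by (cases "g x = 0") auto
    have "RN_deriv Q P x \<noteq> \<top>" using eq g0 by (auto simp: ennreal_mult_top)
    then obtain r where r: "RN_deriv Q P x = ennreal r" "0 \<le> r" by (cases "RN_deriv Q P x") auto
    have "g x * r = f x" using eq g0 f0 r by (simp add: ennreal_mult[symmetric])
    then have "r = f x / g x" using g0 by (simp add: field_simps)
    then show "0 < g x \<and> e x = ln (f x / g x)"
      using g0 r by (simp add: e_def entropy_density_def log_def)
  qed
  then have AEP: "AE x in P. 0 < f x \<and> 0 < g x \<and> e x = ln (f x / g x)"
    unfolding P_def by (subst AE_density) (auto simp: ennreal_eq_0_iff elim!: AE_mp)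
  have "emeasure P {x \<in> space R. g x < exp (- 2 * c) * f x} \<le>
      emeasure P {x \<in> space P. 1 \<le> ennreal (1 / c ^ n) * ennreal (\<bar>e x - \<kappa>\<bar> ^ n)}"
  proof (rule emeasure_mono_AE)
    show "AE x in P. x \<in> {x \<in> space R. g x < exp (- 2 * c) * f x} \<longrightarrow>
       x \<in> {x \<in> space P. 1 \<le> ennreal (1 / c ^ n) * ennreal (\<bar>e x - \<kappa>\<bar> ^ n)}"
      using AEP
    proof (rule AE_mp, intro AE_I2 impI)
      fix x assume x: "x \<in> space P" and h: "0 < f x \<and> 0 < g x \<and> e x = ln (f x / g x)"
        and "x \<in> {x \<in> space R. g x < exp (- 2 * c) * f x}"
      then have "g x < exp (- 2 * c) * f x" by simp
      then have "exp (2 * c) < f x / g x"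
        using h by (simp add: exp_minus field_simps)
      then have "2 * c < e x" using h by (metis exp_gt_zero less_trans ln_exp ln_less_cancel_iff)
      then have "c \<le> \<bar>e x - \<kappa>\<bar>" using \<kappa> by linarith
      then have "c ^ n \<le> \<bar>e x - \<kappa>\<bar> ^ n" using c by (intro power_mono) auto
      then have "1 \<le> 1 / c ^ n * \<bar>e x - \<kappa>\<bar> ^ n" using c by (simp add: field_simps)
      then show "x \<in> {x \<in> space P. 1 \<le> ennreal (1 / c ^ n) * ennreal (\<bar>e x - \<kappa>\<bar> ^ n)}"
        using x c by (simp add: ennreal_mult[symmetric])
    qed
    show "{x \<in> space P. 1 \<le> ennreal (1 / c ^ n) * ennreal (\<bar>e x - \<kappa>\<bar> ^ n)} \<in> sets P"
      unfolding sets by measurable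
  qed
  also have "\<dots> \<le> ennreal (1 / c ^ n) * (\<integral>\<^sup>+x. ennreal (\<bar>e x - \<kappa>\<bar> ^ n) * indicator (space P) x \<partial>P)"
    by (rule nn_integral_Markov_inequality)
       (unfold measurable_cong_sets[OF sets(1) refl] sets(3), measurable, simp add: sets)
  also have "\<dots> = ennreal (1 / c ^ n) * (\<integral>\<^sup>+x. ennreal (\<bar>e x - \<kappa>\<bar> ^ n) \<partial>P)"
    by (intro arg_cong2[where f="\<lambda>a b. a * b"] refl nn_integral_cong) auto
  also have "\<dots> \<le> ennreal (1 / c ^ n) * ennreal v"
    by (intro mult_left_mono mom') simp
  also have "\<dots> = ennreal (v / c ^ n)"
    using c by (simp add: ennreal_mult'[symmetric])
  finally show ?thesis by (simp add: P_def)
qed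

lemma hellinger_sq_commute: "hellinger_sq m p q = hellinger_sq m q p"
  by (simp add: hellinger_sq_def power2_commute)

text \<open>The integral inside \<open>hdist\<close>. It has no case distinction and obeys the
  linearity of the integral, so the geometric estimates are carried out on this square.\<close>

definition hdist_sq :: "('s, 'a, 'p) mdp_family \<Rightarrow> ('s \<times> 'a \<Rightarrow> real) \<Rightarrow> 'p \<Rightarrow> 'p \<Rightarrow> ennreal" where
  "hdist_sq D w \<theta> \<theta>' = (\<integral>\<^sup>+(s, a). hellinger_sq (states D) (tdens D \<theta> s a) (tdens D \<theta>' s a)
                 * ennreal (w (s, a)) \<partial>state_actions D)"

lemma hdist_commute: "hdist D w \<theta> \<theta>' = hdist D w \<theta>' \<theta>"
  by (simp add: hdist_def hellinger_sq_commute)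

lemma hdist_sq_commute: "hdist_sq D w \<theta> \<theta>' = hdist_sq D w \<theta>' \<theta>"
  by (simp add: hdist_sq_def hellinger_sq_commute)

lemma hdist_eq: "hdist D w \<theta> \<theta>' = (if hdist_sq D w \<theta> \<theta>' = \<top> then \<top> else ennreal (sqrt (enn2real (hdist_sq D w \<theta> \<theta>'))))"
  by (simp add: hdist_def hdist_sq_def Let_def)

lemma hdist_le_iff: "0 \<le> r \<Longrightarrow> hdist D w \<theta> \<theta>' \<le> ennreal r \<longleftrightarrow> hdist_sq D w \<theta> \<theta>' \<le> ennreal (r\<^sup>2)"
  by (cases "hdist_sq D w \<theta> \<theta>'") (auto simp: hdist_eq real_sqrt_le_iff' top_unique ennreal_le_iff real_le_lsqrt sqrt_le_D)

context mdp
begin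

text \<open>Dropping the cross term of the square leaves the sum of two densities of total mass
  one.\<close>

lemma hellinger_sq_le_2:
  assumes "\<theta> \<in> space (params D)" "\<theta>' \<in> space (params D)" "s \<in> space (states D)" "a \<in> space (actions D)"
  shows "hellinger_sq (states D) (tdens D \<theta> s a) (tdens D \<theta>' s a) \<le> 2"
proof -
  have [measurable]: "(\<lambda>s'. tdens D \<theta> s a s') \<in> borel_measurable (states D)"
    "(\<lambda>s'. tdens D \<theta>' s a s') \<in> borel_measurable (states D)"
    using assms by measurable
  have "hellinger_sq (states D) (tdens D \<theta> s a) (tdens D \<theta>' s a) \<le>
    (\<integral>\<^sup>+s'. ennreal (tdens D \<theta> s a s') + ennreal (tdens D \<theta>' s a s') \<partial>states D)"
    unfolding hellinger_sq_def
  proof (rule nn_integral_mono)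
    fix s' assume "s' \<in> space (states D)"
    then have nn: "0 \<le> tdens D \<theta> s a s'" "0 \<le> tdens D \<theta>' s a s'" using assms by (auto intro: tdens_nonneg)
    then have "(sqrt (tdens D \<theta> s a s') - sqrt (tdens D \<theta>' s a s'))\<^sup>2 \<le> tdens D \<theta> s a s' + tdens D \<theta>' s a s'"
      by (simp add: power2_diff)
    then show "ennreal ((sqrt (tdens D \<theta> s a s') - sqrt (tdens D \<theta>' s a s'))\<^sup>2)
        \<le> ennreal (tdens D \<theta> s a s') + ennreal (tdens D \<theta>' s a s')"
      using nn by (simp add: ennreal_plus[symmetric] ennreal_leI del: ennreal_plus)
  qed
  also have "\<dots> = 2"
    using assms by (simp add: nn_integral_add nn_integral_tdens)
  finally show ?thesis .
qed

lemma measurable_hellinger [measurable (raw)]: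
  assumes [measurable]: "f \<in> N \<rightarrow>\<^sub>M params D" "f' \<in> N \<rightarrow>\<^sub>M params D" "g \<in> N \<rightarrow>\<^sub>M states D" "h \<in> N \<rightarrow>\<^sub>M actions D"
  shows "(\<lambda>x. hellinger_sq (states D) (tdens D (f x) (g x) (h x)) (tdens D (f' x) (g x) (h x))) \<in> borel_measurable N"
  unfolding hellinger_sq_def
  by (rule states.borel_measurable_nn_integral) measurable

lemma measurable_hdist_sq:
  assumes [measurable]: "w \<in> borel_measurable (state_actions D)" and \<theta>': "\<theta>' \<in> space (params D)"
  shows "(\<lambda>\<theta>. hdist_sq D w \<theta> \<theta>') \<in> borel_measurable (params D)"
  unfolding hdist_sq_def case_prod_unfold
  by (rule state_actions.borel_measurable_nn_integral) (use \<theta>' in measurable)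

lemma measurable_hdist:
  assumes [measurable]: "w \<in> borel_measurable (state_actions D)" and \<theta>': "\<theta>' \<in> space (params D)"
  shows "(\<lambda>\<theta>. hdist D w \<theta> \<theta>') \<in> borel_measurable (params D)"
  unfolding hdist_eq using measurable_hdist_sq[OF assms] by measurable

text \<open>Pointwise in the next state this is Euclidean: with p, q, r and t the square roots of
  the densities, the right side exceeds the left side by (p + q + r - 3 t)^2.\<close>

lemma hellinger_three_points:
  assumes "x \<in> space (params D)" "y \<in> space (params D)" "z \<in> space (params D)" "c \<in> space (params D)"
    "s \<in> space (states D)" "a \<in> space (actions D)"
  defines "h \<equiv> \<lambda>u v. hellinger_sq (states D) (tdens D u s a) (tdens D v s a)"
  shows "h x y + h y z + h z x \<le> 3 * (h x c + h y c + h z c)"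
proof -
  have [measurable]: "(\<lambda>s'. tdens D u s a s') \<in> borel_measurable (states D)" if "u \<in> space (params D)" for u
    using assms that by measurable
  note assms(1-4)[simp]
  let ?d = "\<lambda>u v s'. (sqrt (tdens D u s a s') - sqrt (tdens D v s a s'))\<^sup>2"
  have "h x y + h y z + h z x = (\<integral>\<^sup>+s'. ennreal (?d x y s' + ?d y z s' + ?d z x s') \<partial>states D)"
    unfolding h_def hellinger_sq_def by (simp add: nn_integral_add ennreal_plus)
  also have "\<dots> \<le> (\<integral>\<^sup>+s'. ennreal (3 * (?d x c s' + ?d y c s' + ?d z c s')) \<partial>states D)"
  proof (intro nn_integral_mono ennreal_leI)
    fix s'
    have "(p - q)\<^sup>2 + (q - r)\<^sup>2 + (r - p)\<^sup>2 \<le> 3 * ((p - t)\<^sup>2 + (q - t)\<^sup>2 + (r - t)\<^sup>2)" for p q r t :: real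
    proof -
      have "3 * ((p - t)\<^sup>2 + (q - t)\<^sup>2 + (r - t)\<^sup>2) - ((p - q)\<^sup>2 + (q - r)\<^sup>2 + (r - p)\<^sup>2) = (p + q + r - 3 * t)\<^sup>2"
        by (simp add: power2_eq_square algebra_simps)
      moreover have "0 \<le> (p + q + r - 3 * t)\<^sup>2" by simp
      ultimately show ?thesis by linarith
    qed
    then show "?d x y s' + ?d y z s' + ?d z x s' \<le> 3 * (?d x c s' + ?d y c s' + ?d z c s')" .
  qed
  also have "\<dots> = 3 * (h x c + h y c + h z c)"
    unfolding h_def hellinger_sq_def
    by (simp add: ennreal_mult nn_integral_cmult nn_integral_add ennreal_plus)
  finally show ?thesis .
qed

text \<open>The squared distance comes from an inner product, so three points in a ball of radius \<open>r\<close> cannot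
  have all mutual distances above \<open>sqrt 3 * r\<close>; the triangle inequality would only give \<open>2 * r\<close>.\<close>

lemma hdist_three_points:
  assumes pts: "x \<in> space (params D)" "y \<in> space (params D)" "z \<in> space (params D)" "c \<in> space (params D)"
    and w[measurable]: "w \<in> borel_measurable (state_actions D)"
    and r: "hdist_sq D w x c \<le> ennreal r" "hdist_sq D w y c \<le> ennreal r" "hdist_sq D w z c \<le> ennreal r" "0 \<le> r"
  shows "hdist_sq D w x y \<le> ennreal (3 * r) \<or> hdist_sq D w y z \<le> ennreal (3 * r) \<or> hdist_sq D w z x \<le> ennreal (3 * r)"
proof -
  let ?I = "hdist_sq D w"
  let ?h = "\<lambda>u v p. hellinger_sq (states D) (tdens D u (fst p) (snd p)) (tdens D v (fst p) (snd p)) * ennreal (w p)"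
  have I: "?I u v = (\<integral>\<^sup>+p. ?h u v p \<partial>state_actions D)" for u v
    by (simp add: hdist_sq_def case_prod_unfold)
  have [measurable]: "?h u v \<in> borel_measurable (state_actions D)" if "u \<in> space (params D)" "v \<in> space (params D)" for u v
    using that by measurable
  note pts[simp]
  have "?I x y + ?I y z + ?I z x = (\<integral>\<^sup>+p. ?h x y p + ?h y z p + ?h z x p \<partial>state_actions D)"
    unfolding I by (simp add: nn_integral_add)
  also have "\<dots> \<le> (\<integral>\<^sup>+p. 3 * (?h x c p + ?h y c p + ?h z c p) \<partial>state_actions D)"
  proof (rule nn_integral_mono)
    fix p assume "p \<in> space (state_actions D)"
    then have "fst p \<in> space (states D)" "snd p \<in> space (actions D)"
      by (auto simp: space_state_actions mem_Times_iff)
    from mult_right_mono[OF hellinger_three_points[OF pts this], of "ennreal (w p)"]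
    show "?h x y p + ?h y z p + ?h z x p \<le> 3 * (?h x c p + ?h y c p + ?h z c p)"
      by (simp add: distrib_right distrib_left mult.assoc)
  qed
  also have "\<dots> = 3 * (?I x c + ?I y c + ?I z c)"
    unfolding I by (simp add: nn_integral_add nn_integral_cmult)
  also have "\<dots> \<le> 3 * (ennreal r + ennreal r + ennreal r)"
    using r by (intro mult_left_mono add_mono) auto
  also have "\<dots> = ennreal (9 * r)"
  proof -
    have "3 * (ennreal r + ennreal r + ennreal r) = ennreal 3 * ennreal (r + r + r)"
      using r(4) by (simp only: ennreal_plus ennreal_numeral add_nonneg_nonneg)
    also have "\<dots> = ennreal (3 * (r + r + r))"
      using r(4) by (intro ennreal_mult[symmetric]) auto
    also have "3 * (r + r + r) = 9 * r" by simp
    finally show ?thesis .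
  qed
  finally have sum: "?I x y + ?I y z + ?I z x \<le> ennreal (9 * r)" .
  show ?thesis
  proof (rule ccontr)
    assume "\<not> ?thesis"
    \<comment> \<open>The bound 9 r on the sum makes all three values finite and leaves no room for
      three values above 3 r.\<close>
    then have lt: "ennreal (3 * r) < ?I x y" "ennreal (3 * r) < ?I y z" "ennreal (3 * r) < ?I z x" by auto
    have "?I x y + ?I y z + ?I z x < \<top>" using sum by (meson ennreal_less_top order_le_less_trans)
    then have fin: "?I x y < \<top>" "?I y z < \<top>" "?I z x < \<top>" by (auto simp: less_top)
    then obtain p q s where pqs: "?I x y = ennreal p" "?I y z = ennreal q" "?I z x = ennreal s" "0 \<le> p" "0 \<le> q" "0 \<le> s"
      by (metis ennreal_cases less_irrefl)
    then have "3 * r < p" "3 * r < q" "3 * r < s"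
      using lt r(4) by (simp_all add: ennreal_less_iff)
    moreover have "p + q + s \<le> 9 * r"
      using sum pqs r(4) by (simp add: ennreal_plus[symmetric] del: ennreal_plus)
    ultimately show False by linarith
  qed
qed

text \<open>Recentring a covering ball at a point of the covered set by the triangle inequality doubles the
  radius, which is slightly too much for the tests; two centres with a radius factor \<open>sqrt 3\<close> suffice.\<close>

lemma two_centres:
  assumes S: "S \<subseteq> space (params D)" and c: "c \<in> space (params D)"
    and w: "w \<in> borel_measurable (state_actions D)" and r: "0 \<le> r"
    and ball: "\<And>x. x \<in> S \<Longrightarrow> hdist_sq D w x c \<le> ennreal r"
  shows "\<exists>F\<subseteq>S. finite F \<and> card F \<le> 2 \<and> (\<forall>x\<in>S. \<exists>y\<in>F. hdist_sq D w x y \<le> ennreal (3 * r))"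
proof (cases "S = {}")
  case False
  then obtain x where x: "x \<in> S" by blast
  have self: "hdist_sq D w u u \<le> ennreal (3 * r)" for u
    by (simp add: hdist_sq_def hellinger_sq_def case_prod_unfold)
  show ?thesis
  proof (cases "\<forall>y\<in>S. hdist_sq D w y x \<le> ennreal (3 * r)")
    case True
    then show ?thesis using x by (intro exI[of _ "{x}"]) auto
  next
    case False
    \<comment> \<open>Two points of \<open>S\<close> that are far from each other serve as centres:
      by the three-point estimate every further point of \<open>S\<close> is close to one of
      them.\<close>
    then obtain y where y: "y \<in> S" "\<not> hdist_sq D w y x \<le> ennreal (3 * r)" by blast
    have "hdist_sq D w z x \<le> ennreal (3 * r) \<or> hdist_sq D w z y \<le> ennreal (3 * r)" if z: "z \<in> S" for z
      using hdist_three_points[of x y z c w r] S x y z c w r ball[OF x] ball[OF y(1)] ball[OF z]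
      by (auto simp: hdist_sq_commute[of D w x y] hdist_sq_commute[of D w y z])
    then show ?thesis using x y card_insert_le_m1[of 2 "{y}" x] by (intro exI[of _ "{x, y}"]) auto
  qed
qed auto

end

section \<open>Tests for shells\<close>

text \<open>The bound rules out the infimum of the empty set, which is infinite, and a nonempty set
  of extended naturals attains its infimum. Hence there is an actual cover of minimal size.\<close>

lemma covering_number_finite_cover:
  assumes "log_enat (covering_number X e T d) \<le> ereal c"
  shows "\<exists>C\<subseteq>X. finite C \<and> real (card C) \<le> exp c \<and> (\<forall>\<theta>\<in>T. \<exists>y\<in>C. d \<theta> y \<le> e)"
proof -
  let ?\<C> = "{C. C \<subseteq> X \<and> finite C \<and> (\<forall>\<theta>\<in>T. \<exists>y\<in>C. d \<theta> y \<le> e)}"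
  let ?N = "(\<lambda>C. enat (card C)) ` ?\<C>"
  have cov: "covering_number X e T d = Inf ?N" unfolding covering_number_def ..
  have "?N \<noteq> {}"
  proof
    assume "?N = {}"
    then have "covering_number X e T d = Inf {}" unfolding cov by (rule arg_cong)
    then have "covering_number X e T d = \<infinity>" by (simp add: Inf_enat_def top_enat_def)
    then show False using assms by (simp add: log_enat_def)
  qed
  then obtain n where "n \<in> ?N" by blast
  then have "Inf ?N \<in> ?N"
    unfolding Inf_enat_def using LeastI[of "\<lambda>n. n \<in> ?N" n] by (simp only: if_False split: if_split) blast
  then obtain C where C: "C \<in> ?\<C>" "covering_number X e T d = enat (card C)"
    unfolding cov by blast
  have "real (card C) \<le> exp c"
  \<comment> \<open>For the empty cover \<open>log_enat\<close> has the value minus infinity, and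
    the bound on the cardinality is trivial.\<close>
  proof (cases "card C = 0")
    case False
    then have "ln (real (card C)) \<le> c" using assms C(2) by (simp add: log_enat_def)
    then have "exp (ln (real (card C))) \<le> exp c" by simp
    then show ?thesis using False by simp
  qed simp
  then show ?thesis using C by blast
qed

context mdp_control
begin

lemma other_parameter: "\<theta>' \<in> space (params D) \<Longrightarrow> mdp_control D ini \<pi> \<theta>'"
  unfolding mdp_control_def mdp_control_axioms_def
  using mdp_axioms prob_ini sets_ini policy by blast

text \<open>The factor \<open>23 / 20\<close> is admissible because \<open>j + 1 < 23 / 20 * j\<close> for \<open>j \<ge> 8\<close>, so the balls cover
  the whole shell, and because \<open>3 / 4 * (23 / 20)\<^sup>2 \<le> 1\<close>, so the recentred balls fit the tests.\<close>

lemma test_for_shell: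
  assumes tc: "testing_constants D \<theta> \<pi> k l \<alpha> \<mu> \<nu> K \<xi>" and t: "k + l \<le> t"
    and \<nu>: "\<nu> \<in> borel_measurable (state_actions D)" and \<alpha>: "\<And>i. 0 < \<alpha> i"
    and \<epsilon>: "0 < (\<epsilon>::real)" and j: "8 \<le> j"
    and cover: "log_enat (covering_number (space (params D))
          (ennreal (1 / 2 * sqrt (alpha_last k l \<alpha> t) * \<xi> * (23 / 20 * real j * \<epsilon>)))
          {\<theta>' \<in> space (params D). hdist D \<mu> \<theta>' \<theta> < ennreal (23 / 20 * real j * \<epsilon>)} (hdist D \<nu>)) \<le> ereal c"
  defines "S \<equiv> {\<theta>' \<in> space (params D). ennreal (real j * \<epsilon>) < hdist D \<mu> \<theta>' \<theta> \<and>
          hdist D \<mu> \<theta>' \<theta> \<le> ennreal ((real j + 1) * \<epsilon>)}"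
    and "E \<equiv> exp (- K * (alpha_sum k l \<alpha> t * (real j * \<epsilon>)\<^sup>2))"
  shows "\<exists>\<phi>\<in>borel_measurable (hist_space D t). (\<forall>H\<in>space (hist_space D t). 0 \<le> \<phi> H \<and> \<phi> H \<le> (1::real)) \<and>
    (\<integral>\<^sup>+H. ennreal (\<phi> H) \<partial>hist_law D ini \<theta> \<pi> t) \<le> ennreal (2 * exp c * E) \<and>
    (\<forall>\<theta>'\<in>S. (\<integral>\<^sup>+H. ennreal (1 - \<phi> H) \<partial>hist_law D ini \<theta>' \<pi> t) \<le> ennreal E)"
proof -
  define r where "r = 1 / 2 * sqrt (alpha_last k l \<alpha> t) * \<xi> * (23 / 20 * real j * \<epsilon>)"
  have al: "0 < alpha_last k l \<alpha> t" using \<alpha> by (simp add: alpha_last_def)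
  have As: "0 \<le> alpha_sum k l \<alpha> t" unfolding alpha_sum_def using \<alpha> by (intro sum_nonneg less_imp_le)
  have K: "0 < K" and \<xi>: "0 < \<xi>" using tc by (auto simp: testing_constants_def)
  have r0: "0 \<le> r" using al \<xi> \<epsilon> by (simp add: r_def)
  obtain C where C: "C \<subseteq> space (params D)" "finite C" "real (card C) \<le> exp c"
    and Cov: "\<And>\<theta>'. \<theta>' \<in> space (params D) \<Longrightarrow> hdist D \<mu> \<theta>' \<theta> < ennreal (23 / 20 * real j * \<epsilon>) \<Longrightarrow>
        \<exists>y\<in>C. hdist D \<nu> \<theta>' y \<le> ennreal r"
    using covering_number_finite_cover[OF cover] unfolding r_def by auto
  \<comment> \<open>The centres of the cover may lie anywhere, but the error of a test is governed
    by the distance of its own centre from \<theta>. So the part of the shell in each ball receives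
    new centres that belong to the shell.\<close>
  define P where "P y = {\<theta>' \<in> S. hdist_sq D \<nu> \<theta>' y \<le> ennreal (r\<^sup>2)}" for y
  have "\<exists>F. F \<subseteq> P y \<and> finite F \<and> card F \<le> 2 \<and> (\<forall>x\<in>P y. \<exists>z\<in>F. hdist_sq D \<nu> x z \<le> ennreal (3 * r\<^sup>2))" if "y \<in> C" for y
  proof (rule two_centres[OF _ _ \<nu>])
    show "P y \<subseteq> space (params D)" by (auto simp: P_def S_def)
    show "y \<in> space (params D)" using that C(1) by blast
    show "\<And>x. x \<in> P y \<Longrightarrow> hdist_sq D \<nu> x y \<le> ennreal (r\<^sup>2)" by (simp add: P_def)
  qed simp
  then have "\<forall>y\<in>C. \<exists>F. F \<subseteq> P y \<and> finite F \<and> card F \<le> 2 \<and> (\<forall>x\<in>P y. \<exists>z\<in>F. hdist_sq D \<nu> x z \<le> ennreal (3 * r\<^sup>2))"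
    by blast
  from bchoice[OF this] obtain F where F': "\<forall>y\<in>C. F y \<subseteq> P y \<and> finite (F y) \<and> card (F y) \<le> 2 \<and>
      (\<forall>x\<in>P y. \<exists>z\<in>F y. hdist_sq D \<nu> x z \<le> ennreal (3 * r\<^sup>2))" ..
  have F: "\<And>y. y \<in> C \<Longrightarrow> F y \<subseteq> P y" "\<And>y. y \<in> C \<Longrightarrow> finite (F y)" "\<And>y. y \<in> C \<Longrightarrow> card (F y) \<le> 2"
    "\<And>y x. y \<in> C \<Longrightarrow> x \<in> P y \<Longrightarrow> \<exists>z\<in>F y. hdist_sq D \<nu> x z \<le> ennreal (3 * r\<^sup>2)"
    using F' by blast+
  define G where "G = (\<Union>y\<in>C. F y)"
  have finG: "finite G" using C F by (auto simp: G_def)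
  \<comment> \<open>Two new centres for each of at most exp c balls: this is the factor 2 in the
    bound on the first error.\<close>
  have "card G \<le> (\<Sum>y\<in>C. card (F y))" unfolding G_def by (rule card_UN_le[OF C(2)])
  also have "\<dots> \<le> (\<Sum>y\<in>C. 2)" by (intro sum_mono F(3))
  finally have cardG: "real (card G) \<le> 2 * exp c" using C(3) by simp
  have GS: "G \<subseteq> S" using F(1) by (auto simp: G_def P_def)
  have dG: "enn2real (hdist D \<mu> \<theta> g) \<ge> real j * \<epsilon>" "hdist D \<mu> \<theta> g \<ge> ennreal (real j * \<epsilon>)" if "g \<in> G" for g
  proof -
    have g: "ennreal (real j * \<epsilon>) < hdist D \<mu> \<theta> g" "hdist D \<mu> \<theta> g \<le> ennreal ((real j + 1) * \<epsilon>)"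
      using that GS by (auto simp: S_def hdist_commute[of D \<mu> \<theta>])
    then show "hdist D \<mu> \<theta> g \<ge> ennreal (real j * \<epsilon>)" by simp
    \<comment> \<open>The outer radius of the shell excludes an infinite distance, which
      \<open>enn2real\<close> would send to 0.\<close>
    have "hdist D \<mu> \<theta> g \<noteq> \<top>" using g(2) by (auto simp: top_unique)
    then show "enn2real (hdist D \<mu> \<theta> g) \<ge> real j * \<epsilon>"
      using g(1) \<epsilon> by (cases "hdist D \<mu> \<theta> g") (auto simp: ennreal_less_iff)
  qed
  let ?X = "\<lambda>g. exp (- K * (alpha_sum k l \<alpha> t * (enn2real (hdist D \<mu> \<theta> g))\<^sup>2))"
  define good where "good g \<phi> \<longleftrightarrow> \<phi> \<in> borel_measurable (hist_space D t) \<and>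
          (\<forall>H\<in>space (hist_space D t). 0 \<le> \<phi> H \<and> \<phi> H \<le> (1::real)) \<and>
          (\<integral>H. \<phi> H \<partial>hist_law D ini \<theta> \<pi> t) \<le> ?X g \<and>
          (\<forall>\<theta>'\<in>space (params D).
                hdist D \<nu> \<theta>' g \<le> ennreal (\<xi> * sqrt (alpha_last k l \<alpha> t)) * hdist D \<mu> \<theta> g \<longrightarrow>
                (\<integral>H. 1 - \<phi> H \<partial>hist_law D ini \<theta>' \<pi> t) \<le> ?X g)" for g \<phi>
  have "\<exists>\<phi>. good g \<phi>" if g: "g \<in> G" for g
  proof -
    have "g \<in> space (params D)" using g GS by (auto simp: S_def)
    with tc t obtain \<phi> where \<phi>: "\<phi> \<in> borel_measurable (hist_space D t)"
        "\<forall>H\<in>space (hist_space D t). 0 \<le> \<phi> H \<and> \<phi> H \<le> (1::real)"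
      and \<phi>': "\<forall>ini. prob_space ini \<and> sets ini = sets (states D) \<longrightarrow>
             (\<integral>H. \<phi> H \<partial>hist_law D ini \<theta> \<pi> t) \<le> ?X g \<and>
             (\<forall>\<theta>'\<in>space (params D).
                hdist D \<nu> \<theta>' g \<le> ennreal (\<xi> * sqrt (alpha_last k l \<alpha> t)) * hdist D \<mu> \<theta> g \<longrightarrow>
                (\<integral>H. 1 - \<phi> H \<partial>hist_law D ini \<theta>' \<pi> t) \<le> ?X g)"
      unfolding testing_constants_def by meson
    from \<phi>'[rule_format, OF conjI[OF prob_ini sets_ini]] \<phi> show ?thesis unfolding good_def by blast
  qed
  then obtain \<phi> where good: "\<And>g. g \<in> G \<Longrightarrow> good g (\<phi> g)" by metis
  have \<phi>[measurable]: "\<And>g. g \<in> G \<Longrightarrow> \<phi> g \<in> borel_measurable (hist_space D t)"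
    and \<phi>01: "\<And>g H. g \<in> G \<Longrightarrow> H \<in> space (hist_space D t) \<Longrightarrow> 0 \<le> \<phi> g H \<and> \<phi> g H \<le> 1"
    and \<phi>1: "\<And>g. g \<in> G \<Longrightarrow> (\<integral>H. \<phi> g H \<partial>hist_law D ini \<theta> \<pi> t) \<le> ?X g"
    and \<phi>2: "\<And>g \<theta>'. g \<in> G \<Longrightarrow> \<theta>' \<in> space (params D) \<Longrightarrow>
                hdist D \<nu> \<theta>' g \<le> ennreal (\<xi> * sqrt (alpha_last k l \<alpha> t)) * hdist D \<mu> \<theta> g \<Longrightarrow>
                (\<integral>H. 1 - \<phi> g H \<partial>hist_law D ini \<theta>' \<pi> t) \<le> ?X g"
    using good unfolding good_def by blast+
  have expE: "exp (- K * (alpha_sum k l \<alpha> t * (enn2real (hdist D \<mu> \<theta> g))\<^sup>2)) \<le> E" if "g \<in> G" for g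
  proof -
    have "(real j * \<epsilon>)\<^sup>2 \<le> (enn2real (hdist D \<mu> \<theta> g))\<^sup>2"
      using dG(1)[OF that] \<epsilon> by (intro power_mono) simp_all
    then have "K * (alpha_sum k l \<alpha> t * (real j * \<epsilon>)\<^sup>2) \<le> K * (alpha_sum k l \<alpha> t * (enn2real (hdist D \<mu> \<theta> g))\<^sup>2)"
      using K As by (intro mult_left_mono) simp_all
    then show ?thesis unfolding E_def by simp
  qed
  have nn: "(\<integral>\<^sup>+H. ennreal (\<psi> H) \<partial>hist_law D ini \<theta>' \<pi> t) = ennreal (\<integral>H. \<psi> H \<partial>hist_law D ini \<theta>' \<pi> t)"
    if \<psi>: "\<psi> \<in> borel_measurable (hist_space D t)" "\<And>H. H \<in> space (hist_space D t) \<Longrightarrow> 0 \<le> \<psi> H \<and> \<psi> H \<le> (1::real)"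
      and \<theta>': "\<theta>' \<in> space (params D)" for \<psi> \<theta>'
  proof -
    interpret o: mdp_control D ini \<pi> \<theta>'
      using \<theta>' by (rule other_parameter)
    interpret H: prob_space "hist_law D ini \<theta>' \<pi> t" by (rule o.prob_space_hist_law)
    show ?thesis
    proof (rule nn_integral_eq_integral)
      have "\<psi> \<in> borel_measurable (hist_law D ini \<theta>' \<pi> t)"
        unfolding measurable_cong_sets[OF o.sets_hist_law refl] by (rule \<psi>)
      moreover have "AE x in hist_law D ini \<theta>' \<pi> t. norm (\<psi> x) \<le> 1"
        using \<psi>(2) by (intro AE_I2) (simp add: o.space_hist_law)
      ultimately show "integrable (hist_law D ini \<theta>' \<pi> t) \<psi>"
        by (intro H.integrable_const_bound)
      show "AE x in hist_law D ini \<theta>' \<pi> t. 0 \<le> \<psi> x"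
        using \<psi>(2) by (intro AE_I2) (simp add: o.space_hist_law)
    qed
  qed
  \<comment> \<open>Under \<theta> the errors of the single tests add up. On the other side
    \<open>\<Phi>\<close> dominates every single test, so against a parameter its second error is at
    most that of any test whose ball contains the parameter.\<close>
  define \<Phi> where "\<Phi> H = min 1 (\<Sum>g\<in>G. \<phi> g H)" for H
  have \<Phi>m[measurable]: "\<Phi> \<in> borel_measurable (hist_space D t)" unfolding \<Phi>_def[abs_def] by measurable
  have \<Phi>01: "0 \<le> \<Phi> H \<and> \<Phi> H \<le> 1" if "H \<in> space (hist_space D t)" for H
  proof -
    have "0 \<le> (\<Sum>g\<in>G. \<phi> g H)" using \<phi>01[OF _ that] by (intro sum_nonneg) blast
    then show ?thesis by (simp add: \<Phi>_def)
  qed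
  have "(\<integral>\<^sup>+H. ennreal (\<Phi> H) \<partial>hist_law D ini \<theta> \<pi> t) \<le> (\<integral>\<^sup>+H. (\<Sum>g\<in>G. ennreal (\<phi> g H)) \<partial>hist_law D ini \<theta> \<pi> t)"
  proof (rule nn_integral_mono)
    fix H assume "H \<in> space (hist_law D ini \<theta> \<pi> t)"
    then have "H \<in> space (hist_space D t)" by (simp add: space_hist_law)
    then have "(\<Sum>g\<in>G. ennreal (\<phi> g H)) = ennreal (\<Sum>g\<in>G. \<phi> g H)"
      using \<phi>01 by (intro sum_ennreal) auto
    then show "ennreal (\<Phi> H) \<le> (\<Sum>g\<in>G. ennreal (\<phi> g H))" by (simp add: \<Phi>_def ennreal_leI)
  qed
  also have "\<dots> = (\<Sum>g\<in>G. \<integral>\<^sup>+H. ennreal (\<phi> g H) \<partial>hist_law D ini \<theta> \<pi> t)"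
    by (rule nn_integral_sum) (simp add: measurable_cong_sets[OF sets_hist_law refl])
  also have "\<dots> \<le> (\<Sum>g\<in>G. ennreal E)"
  proof (rule sum_mono)
    fix g assume g: "g \<in> G"
    show "(\<integral>\<^sup>+H. ennreal (\<phi> g H) \<partial>hist_law D ini \<theta> \<pi> t) \<le> ennreal E"
      using nn[OF \<phi>[OF g] _ \<theta>] \<phi>01[OF g] order_trans[OF \<phi>1[OF g] expE[OF g]] by (simp add: ennreal_leI)
  qed
  also have "\<dots> = ennreal (real (card G) * E)" by (simp add: ennreal_mult' ennreal_of_nat_eq_real_of_nat)
  also have "\<dots> \<le> ennreal (2 * exp c * E)" using cardG by (intro ennreal_leI mult_right_mono) (auto simp: E_def)
  finally have 1: "(\<integral>\<^sup>+H. ennreal (\<Phi> H) \<partial>hist_law D ini \<theta> \<pi> t) \<le> ennreal (2 * exp c * E)" .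
  have 2: "(\<integral>\<^sup>+H. ennreal (1 - \<Phi> H) \<partial>hist_law D ini \<theta>' \<pi> t) \<le> ennreal E" if \<theta>': "\<theta>' \<in> S" for \<theta>'
  proof -
    have p: "\<theta>' \<in> space (params D)" using \<theta>' by (simp add: S_def)
    interpret o: mdp_control D ini \<pi> \<theta>'
      using p by (rule other_parameter)
    have "hdist D \<mu> \<theta>' \<theta> \<le> ennreal ((real j + 1) * \<epsilon>)" using \<theta>' by (simp add: S_def)
    also have "\<dots> < ennreal (23 / 20 * real j * \<epsilon>)"
    proof (rule ennreal_lessI)
      show "0 < 23 / 20 * real j * \<epsilon>" using j \<epsilon> by simp
      have "real j + 1 < 23 / 20 * real j" using j by simp
      then show "(real j + 1) * \<epsilon> < 23 / 20 * real j * \<epsilon>" using \<epsilon> by (intro mult_strict_right_mono)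
    qed
    finally obtain y where y: "y \<in> C" "hdist D \<nu> \<theta>' y \<le> ennreal r" using Cov[OF p] by blast
    then have "\<theta>' \<in> P y" using \<theta>' r0 by (simp add: P_def hdist_le_iff)
    with F(4)[OF y(1)] obtain g where g: "g \<in> F y" "hdist_sq D \<nu> \<theta>' g \<le> ennreal (3 * r\<^sup>2)" by blast
    then have gG: "g \<in> G" using y(1) by (auto simp: G_def)
    let ?a = "\<xi> * sqrt (alpha_last k l \<alpha> t)"
    have a0: "0 \<le> ?a" using \<xi> al by simp
    \<comment> \<open>In 3 / 4 the 3 is the square of the recentring factor and 1 / 4 is the square
      of the 1 / 2 in the radius of the entropy condition.\<close>
    have "3 * r\<^sup>2 = 3 / 4 * (23 / 20)\<^sup>2 * (?a * (real j * \<epsilon>))\<^sup>2"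
      by (simp add: r_def power_mult_distrib power_divide algebra_simps)
    also have "\<dots> \<le> 1 * (?a * (real j * \<epsilon>))\<^sup>2"
      by (intro mult_right_mono) (auto simp: power2_eq_square)
    finally have "hdist_sq D \<nu> \<theta>' g \<le> ennreal ((?a * (real j * \<epsilon>))\<^sup>2)"
      using g(2) by (simp add: order_trans[OF _ ennreal_leI])
    then have "hdist D \<nu> \<theta>' g \<le> ennreal (?a * (real j * \<epsilon>))"
      using a0 \<epsilon> by (subst hdist_le_iff) auto
    also have "\<dots> = ennreal ?a * ennreal (real j * \<epsilon>)" using a0 by (rule ennreal_mult')
    also have "\<dots> \<le> ennreal ?a * hdist D \<mu> \<theta> g" by (intro mult_left_mono dG(2) gG) simp
    finally have *: "(\<integral>H. 1 - \<phi> g H \<partial>hist_law D ini \<theta>' \<pi> t) \<le> E"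
      using order_trans[OF \<phi>2[OF gG p] expE[OF gG]] by simp
    have "(\<integral>\<^sup>+H. ennreal (1 - \<Phi> H) \<partial>hist_law D ini \<theta>' \<pi> t) \<le> (\<integral>\<^sup>+H. ennreal (1 - \<phi> g H) \<partial>hist_law D ini \<theta>' \<pi> t)"
    proof (rule nn_integral_mono, rule ennreal_leI)
      fix H assume "H \<in> space (hist_law D ini \<theta>' \<pi> t)"
      then have H: "H \<in> space (hist_space D t)" by (simp add: o.space_hist_law)
      have "\<phi> g H \<le> (\<Sum>g\<in>G. \<phi> g H)" using \<phi>01 H finG gG by (intro member_le_sum) auto
      then show "1 - \<Phi> H \<le> 1 - \<phi> g H" using \<phi>01[OF gG H] by (simp add: \<Phi>_def)
    qed
    also have "\<dots> = ennreal (\<integral>H. 1 - \<phi> g H \<partial>hist_law D ini \<theta>' \<pi> t)"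
      by (rule nn[OF _ _ p]) (use \<phi>[OF gG] \<phi>01[OF gG] in auto)
    also have "\<dots> \<le> ennreal E" by (rule ennreal_leI[OF *])
    finally show ?thesis .
  qed
  show ?thesis using \<Phi>m \<Phi>01 1 2 by blast
qed

end

section \<open>Posterior distributions\<close>

definition evidence :: "('s, 'a, 'p) mdp_family \<Rightarrow> 'p measure \<Rightarrow> nat \<Rightarrow> ('s, 'a) hist \<Rightarrow> ennreal" where
  "evidence D prior t H = (\<integral>\<^sup>+\<theta>. ennreal (likelihood D t H \<theta>) \<partial>prior)"

lemma posterior_eq: "posterior D prior t H =
    (if 0 < evidence D prior t H \<and> evidence D prior t H < \<top>
     then density prior (\<lambda>\<theta>. ennreal (likelihood D t H \<theta>) / evidence D prior t H) else prior)"
  by (simp add: posterior_def evidence_def Let_def)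

locale mdp_prior = mdp D for D :: "('s, 'a, 'p) mdp_family" +
  fixes prior :: "'p measure"
  assumes prob_prior: "prob_space prior" and sets_prior[measurable_cong]: "sets prior = sets (params D)"
begin

sublocale prior: prob_space prior by (rule prob_prior)

lemma space_prior: "space prior = space (params D)"
  by (rule sets_eq_imp_space_eq) (rule sets_prior)

lemma sets_posterior [simp]: "sets (posterior D prior t H) = sets (params D)"
  by (simp add: posterior_eq sets_prior)

lemma measurable_lik_prior:
  assumes H: "H \<in> space (hist_space D t)"
  shows "(\<lambda>\<theta>. ennreal (likelihood D t H \<theta>)) \<in> borel_measurable prior"
  using H by measurable

lemma measurable_evidence [measurable]: "evidence D prior t \<in> borel_measurable (hist_space D t)"
  unfolding evidence_def[abs_def]
  by (rule prior.borel_measurable_nn_integral) measurable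

lemma emeasure_posterior:
  assumes H: "H \<in> space (hist_space D t)" and A[measurable]: "A \<in> sets (params D)"
  shows "emeasure (posterior D prior t H) A =
    (if 0 < evidence D prior t H \<and> evidence D prior t H < \<top>
     then (\<integral>\<^sup>+\<theta>. ennreal (likelihood D t H \<theta>) * indicator A \<theta> \<partial>prior) / evidence D prior t H else emeasure prior A)"
proof -
  note [measurable] = measurable_lik_prior[OF H]
  have "emeasure (density prior (\<lambda>\<theta>. ennreal (likelihood D t H \<theta>) / evidence D prior t H)) A =
    (\<integral>\<^sup>+\<theta>. ennreal (likelihood D t H \<theta>) / evidence D prior t H * indicator A \<theta> \<partial>prior)"
    by (rule emeasure_density) (simp_all add: sets_prior)
  also have "\<dots> = (\<integral>\<^sup>+\<theta>. ennreal (likelihood D t H \<theta>) * indicator A \<theta> / evidence D prior t H \<partial>prior)"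
    by (simp add: divide_ennreal_def mult_ac)
  also have "\<dots> = (\<integral>\<^sup>+\<theta>. ennreal (likelihood D t H \<theta>) * indicator A \<theta> \<partial>prior) / evidence D prior t H"
    by (rule nn_integral_divide) measurable
  finally show ?thesis by (simp add: posterior_eq)
qed

text \<open>The fallback to the prior covers zero and infinite evidence, so the posterior is a
  probability measure at every history and Thompson sampling is a policy without exceptional
  histories.\<close>

lemma prob_space_posterior:
  assumes H: "H \<in> space (hist_space D t)"
  shows "prob_space (posterior D prior t H)"
proof
  have sp: "space (posterior D prior t H) = space (params D)"
    by (rule sets_eq_imp_space_eq) simp
  have "(\<integral>\<^sup>+\<theta>. ennreal (likelihood D t H \<theta>) * indicator (space (params D)) \<theta> \<partial>prior) = evidence D prior t H"
    unfolding evidence_def by (intro nn_integral_cong) (auto simp: space_prior)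
  then show "emeasure (posterior D prior t H) (space (posterior D prior t H)) = 1"
    using emeasure_posterior[OF H sets.top] prior.emeasure_space_1
    by (auto simp: sp space_prior[symmetric] intro: ennreal_divide_self)
qed

lemma measurable_posterior: "posterior D prior t \<in> hist_space D t \<rightarrow>\<^sub>M prob_algebra (params D)"
proof (rule measurable_prob_algebraI[OF prob_space_posterior], assumption)
  show "posterior D prior t \<in> hist_space D t \<rightarrow>\<^sub>M subprob_algebra (params D)"
  proof (rule measurable_subprob_algebra)
    fix H assume "H \<in> space (hist_space D t)"
    then show "subprob_space (posterior D prior t H)"
      by (intro prob_space_imp_subprob_space prob_space_posterior)
  next
    fix A assume A[measurable]: "A \<in> sets (params D)"
    have [measurable]: "(\<lambda>H. \<integral>\<^sup>+\<theta>. ennreal (likelihood D t H \<theta>) * indicator A \<theta> \<partial>prior) \<in> borel_measurable (hist_space D t)"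
      by (rule prior.borel_measurable_nn_integral) measurable
    have "(\<lambda>H. if 0 < evidence D prior t H \<and> evidence D prior t H < \<top>
       then (\<integral>\<^sup>+\<theta>. ennreal (likelihood D t H \<theta>) * indicator A \<theta> \<partial>prior) / evidence D prior t H
       else emeasure prior A) \<in> borel_measurable (hist_space D t)"
      by measurable
    then show "(\<lambda>H. emeasure (posterior D prior t H) A) \<in> borel_measurable (hist_space D t)"
      by (rule measurable_cong[THEN iffD2, rotated]) (simp add: emeasure_posterior)
  qed simp
qed

end

section \<open>Evidence bounds and posterior mass of shells\<close>

context finite_mdp_control
begin

lemma hist_law_density_other:
  assumes \<theta>': "\<theta>' \<in> space (params D)"
  shows "hist_law D ini \<theta>' \<pi> t = density (ref_law t) (\<lambda>H. ennreal (mass ^ t * likelihood D t H \<theta>'))"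
proof -
  interpret o: finite_mdp_control D ini \<pi> \<theta>'
    unfolding finite_mdp_control_def finite_mdp_control_axioms_def
    using other_parameter[OF \<theta>'] finite_states by blast
  show ?thesis
    using o.hist_law_eq_density[of t] ref_law_any[of \<theta>' t] by (simp add: o.ref_law_def)
qed

end

locale posterior_model = finite_mdp_control D ini \<pi> \<theta> + mdp_prior D prior
  for D :: "('s, 'a, 'p) mdp_family" and ini \<pi> \<theta> prior
begin

lemma measurable_hist_law_iff: "f \<in> hist_law D ini \<theta> \<pi> t \<rightarrow>\<^sub>M N \<longleftrightarrow> f \<in> hist_space D t \<rightarrow>\<^sub>M N"
  by (simp add: measurable_cong_sets[OF sets_hist_law])

lemma measurable_ref_law_iff: "f \<in> ref_law t \<rightarrow>\<^sub>M N \<longleftrightarrow> f \<in> hist_space D t \<rightarrow>\<^sub>M N"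
  by (simp add: measurable_cong_sets[OF sets_ref_law])

lemma measurable_restricted_evidence:
  assumes [measurable]: "B \<in> sets (params D)"
  shows "(\<lambda>H. \<integral>\<^sup>+\<theta>'. ennreal (likelihood D t H \<theta>') * indicator B \<theta>' \<partial>prior) \<in> borel_measurable (hist_space D t)"
  by (rule prior.borel_measurable_nn_integral) measurable

text \<open>Call a parameter of \<open>B\<close> bad at H if its likelihood is below x times the
  true one. By Fubini the expected prior mass of the bad parameters is at most q times that of
  \<open>B\<close>. Low evidence forces at least half of \<open>B\<close> to be bad, so Markov's
  inequality gives the bound 2 q.\<close>

lemma low_evidence:
  assumes B: "B \<in> sets (params D)" and w: "0 < measure prior B" and q: "0 \<le> q"
    and ratio: "\<And>\<theta>'. \<theta>' \<in> B \<Longrightarrow>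
      emeasure (hist_law D ini \<theta> \<pi> t) {H \<in> space (hist_space D t). likelihood D t H \<theta>' < x * likelihood D t H \<theta>} \<le> ennreal q"
    and x: "0 \<le> x"
  shows "emeasure (hist_law D ini \<theta> \<pi> t) {H \<in> space (hist_space D t).
      (\<integral>\<^sup>+\<theta>'. ennreal (likelihood D t H \<theta>') * indicator B \<theta>' \<partial>prior)
        < ennreal (measure prior B / 2 * x) * ennreal (likelihood D t H \<theta>)} \<le> ennreal (2 * q)"
    (is "emeasure ?P ?L \<le> _")
proof -
  note [measurable] = B \<theta>
  define w where "w = measure prior B"
  have w0: "0 < w" using w by (simp add: w_def)
  have pB: "emeasure prior B = ennreal w" by (simp add: w_def prior.emeasure_eq_measure)
  define bad where "bad H \<theta>' = (indicator {\<theta>' \<in> B. likelihood D t H \<theta>' < x * likelihood D t H \<theta>} \<theta>' :: ennreal)" for H \<theta>'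
  define m where "m H = (\<integral>\<^sup>+\<theta>'. bad H \<theta>' \<partial>prior)" for H
  have badm: "(\<lambda>(H, \<theta>'). bad H \<theta>') \<in> borel_measurable (hist_space D t \<Otimes>\<^sub>M params D)"
    unfolding bad_def[abs_def] case_prod_unfold by measurable
  have badm': "(\<lambda>(H, \<theta>'). bad H \<theta>') \<in> borel_measurable (?P \<Otimes>\<^sub>M prior)"
    using badm by (simp add: measurable_cong_sets[OF sets_pair_measure_cong[OF sets_hist_law sets_prior] refl])
  have mm: "m \<in> borel_measurable (hist_space D t)"
    unfolding m_def[abs_def] using badm
    by (intro prior.borel_measurable_nn_integral)
       (simp add: measurable_cong_sets[OF sets_pair_measure_cong[OF refl sets_prior] refl])
  have mP: "m \<in> borel_measurable ?P" unfolding measurable_hist_law_iff by (rule mm)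
  interpret P: prob_space ?P by (rule prob_space_hist_law)
  interpret PP: pair_sigma_finite ?P prior ..
  have "(\<integral>\<^sup>+H. m H \<partial>?P) = (\<integral>\<^sup>+\<theta>'. \<integral>\<^sup>+H. bad H \<theta>' \<partial>?P \<partial>prior)"
    unfolding m_def by (rule PP.Fubini'[OF badm', symmetric])
  also have "\<dots> \<le> (\<integral>\<^sup>+\<theta>'. ennreal q * indicator B \<theta>' \<partial>prior)"
  proof (rule nn_integral_mono)
    fix \<theta>' assume "\<theta>' \<in> space prior"
    then have \<theta>': "\<theta>' \<in> space (params D)" by (simp add: space_prior)
    show "(\<integral>\<^sup>+H. bad H \<theta>' \<partial>?P) \<le> ennreal q * indicator B \<theta>'"
    proof (cases "\<theta>' \<in> B")
      case True
      let ?A = "{H \<in> space (hist_space D t). likelihood D t H \<theta>' < x * likelihood D t H \<theta>}"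
      have A: "?A \<in> sets (hist_space D t)" using \<theta>' by measurable
      have "(\<integral>\<^sup>+H. bad H \<theta>' \<partial>?P) = (\<integral>\<^sup>+H. indicator ?A H \<partial>?P)"
        using True by (intro nn_integral_cong) (auto simp: bad_def space_hist_law split: split_indicator)
      also have "\<dots> = emeasure ?P ?A" using A by (simp add: sets_hist_law)
      finally show ?thesis using ratio[OF True] True by simp
    qed (simp add: bad_def)
  qed
  also have "\<dots> = ennreal q * ennreal w"
    using B by (subst nn_integral_cmult_indicator) (simp_all add: sets_prior pB)
  finally have Em: "(\<integral>\<^sup>+H. m H \<partial>?P) \<le> ennreal q * ennreal w" .
  have "emeasure ?P ?L \<le> emeasure ?P {H \<in> space (hist_space D t). 1 \<le> ennreal (2 / w) * m H}"
  proof (rule emeasure_mono)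
    show "{H \<in> space (hist_space D t). 1 \<le> ennreal (2 / w) * m H} \<in> sets ?P"
      unfolding sets_hist_law using mm by measurable
    show "?L \<subseteq> {H \<in> space (hist_space D t). 1 \<le> ennreal (2 / w) * m H}"
    proof (rule subsetI)
      fix H assume "H \<in> ?L"
      then have H: "H \<in> space (hist_space D t)"
        and low: "(\<integral>\<^sup>+\<theta>'. ennreal (likelihood D t H \<theta>') * indicator B \<theta>' \<partial>prior)
          < ennreal (w / 2 * x) * ennreal (likelihood D t H \<theta>)"
        by (simp_all add: w_def)
      let ?C = "{\<theta>' \<in> B. likelihood D t H \<theta>' < x * likelihood D t H \<theta>}"
      have Cm: "?C \<in> sets prior"
      proof -
        have "{\<theta>' \<in> space (params D). \<theta>' \<in> B \<and> likelihood D t H \<theta>' < x * likelihood D t H \<theta>} \<in> sets (params D)"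
          using H by measurable
        moreover have "{\<theta>' \<in> space (params D). \<theta>' \<in> B \<and> likelihood D t H \<theta>' < x * likelihood D t H \<theta>} = ?C"
          using sets.sets_into_space[OF B] by auto
        ultimately show ?thesis by (simp add: sets_prior)
      qed
      have mH: "m H = ennreal (measure prior ?C)"
        unfolding m_def bad_def using Cm by (simp add: prior.emeasure_eq_measure)
      \<comment> \<open>Otherwise the parameters of \<open>B\<close> that are not bad carry at least
        half of its mass, and they alone lift the restricted evidence to the threshold.\<close>
      have "w / 2 \<le> measure prior ?C"
      proof (rule ccontr)
        assume "\<not> w / 2 \<le> measure prior ?C"
        then have "w / 2 \<le> measure prior (B - ?C)"
          using prior.finite_measure_Diff[of B ?C] B Cm by (auto simp: w_def sets_prior)
        then have "ennreal (w / 2) * (ennreal x * ennreal (likelihood D t H \<theta>)) \<le>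
          emeasure prior (B - ?C) * (ennreal x * ennreal (likelihood D t H \<theta>))"
          by (intro mult_right_mono) (simp_all add: prior.emeasure_eq_measure)
        also have "\<dots> = (\<integral>\<^sup>+\<theta>'. (ennreal x * ennreal (likelihood D t H \<theta>)) * indicator (B - ?C) \<theta>' \<partial>prior)"
          using B Cm by (subst nn_integral_cmult_indicator) (auto simp: sets_prior mult.commute)
        also have "\<dots> \<le> (\<integral>\<^sup>+\<theta>'. ennreal (likelihood D t H \<theta>') * indicator B \<theta>' \<partial>prior)"
          using x by (intro nn_integral_mono) (auto split: split_indicator simp: ennreal_mult'[symmetric] intro!: ennreal_leI)
        also have "\<dots> < ennreal (w / 2 * x) * ennreal (likelihood D t H \<theta>)" by (rule low)
        also have "\<dots> = ennreal (w / 2) * (ennreal x * ennreal (likelihood D t H \<theta>))"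
          by (simp only: ennreal_mult''[OF x] mult.assoc)
        finally show False by simp
      qed
      then have "1 \<le> 2 / w * measure prior ?C" using w0 by (simp add: field_simps)
      then show "H \<in> {H \<in> space (hist_space D t). 1 \<le> ennreal (2 / w) * m H}"
        using H w0 mH by (simp add: ennreal_mult'[symmetric])
    qed
  qed
  also have "\<dots> \<le> ennreal (2 / w) * (\<integral>\<^sup>+H. m H * indicator (space ?P) H \<partial>?P)"
    unfolding space_hist_law[of t, symmetric]
    by (rule nn_integral_Markov_inequality)
       (use mP in auto)
  also have "(\<integral>\<^sup>+H. m H * indicator (space ?P) H \<partial>?P) = (\<integral>\<^sup>+H. m H \<partial>?P)"
    by (intro nn_integral_cong) simp
  also have "ennreal (2 / w) * \<dots> \<le> ennreal (2 / w) * (ennreal q * ennreal w)"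
    by (intro mult_left_mono Em) simp
  also have "\<dots> = ennreal (2 * q)"
    using w0 q by (simp add: ennreal_mult'[symmetric] ennreal_mult''[symmetric])
  finally show ?thesis .
qed

text \<open>Split the posterior mass of \<open>S\<close> into the parts weighted by \<phi> and by 1
  - \<phi>. The first is at most the first error. In the second, off \<open>L\<close>, the true
  likelihood is at most the evidence divided by \<kappa>, and the evidence cancels against the
  denominator of Bayes' formula. What remains is, by Fubini, the second error of each parameter of
  \<open>S\<close> under its own law, averaged over the prior.\<close>

lemma posterior_shell:
  assumes B: "B \<in> sets (params D)" and S: "S \<in> sets (params D)" and \<kappa>: "0 < \<kappa>"
    and \<phi>: "\<phi> \<in> borel_measurable (hist_space D t)" "\<And>H. H \<in> space (hist_space D t) \<Longrightarrow> 0 \<le> \<phi> H \<and> \<phi> H \<le> (1::real)"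
    and type1: "(\<integral>\<^sup>+H. ennreal (\<phi> H) \<partial>hist_law D ini \<theta> \<pi> t) \<le> ennreal a"
    and type2: "\<And>\<theta>'. \<theta>' \<in> S \<Longrightarrow> (\<integral>\<^sup>+H. ennreal (1 - \<phi> H) \<partial>hist_law D ini \<theta>' \<pi> t) \<le> ennreal b"
    and fin: "\<And>H. H \<in> space (hist_space D t) \<Longrightarrow> evidence D prior t H < \<top>" and b: "0 \<le> b" and a: "0 \<le> a"
  defines "L \<equiv> {H \<in> space (hist_space D t).
      (\<integral>\<^sup>+\<theta>'. ennreal (likelihood D t H \<theta>') * indicator B \<theta>' \<partial>prior) < ennreal \<kappa> * ennreal (likelihood D t H \<theta>)}"
  shows "(\<integral>\<^sup>+H. emeasure (posterior D prior t H) S * indicator (space (hist_space D t) - L) H \<partial>hist_law D ini \<theta> \<pi> t)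
    \<le> ennreal (a + measure prior S * b / \<kappa>)"
proof -
  note [measurable] = B S \<theta> \<phi>(1) measurable_restricted_evidence[OF B] measurable_restricted_evidence[OF S]
  have Lm[measurable]: "L \<in> sets (hist_space D t)" unfolding L_def by measurable
  let ?P = "hist_law D ini \<theta> \<pi> t"
  let ?G = "space (hist_space D t) - L"
  let ?l = "\<lambda>\<theta>' H. ennreal (likelihood D t H \<theta>')"
  let ?c = "ennreal (mass ^ t)"
  have pm[measurable]: "(\<lambda>H. emeasure (posterior D prior t H) S) \<in> borel_measurable (hist_space D t)"
    using measurable_prob_algebraD[OF measurable_posterior] by measurable
  have l_eq: "hist_law D ini \<theta>' \<pi> t = density (ref_law t) (\<lambda>H. ?c * ?l \<theta>' H)" if "\<theta>' \<in> space (params D)" for \<theta>'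
    unfolding hist_law_density_other[OF that] using mass_pos by (simp add: ennreal_mult')
  have nn: "(\<integral>\<^sup>+H. F H \<partial>hist_law D ini \<theta>' \<pi> t) = (\<integral>\<^sup>+H. ?c * ?l \<theta>' H * F H \<partial>ref_law t)"
    if "\<theta>' \<in> space (params D)" "F \<in> borel_measurable (hist_space D t)" for F \<theta>'
    unfolding l_eq[OF that(1)]
    by (rule nn_integral_density) (use that in \<open>simp_all add: measurable_ref_law_iff\<close>)
  define post where "post H = emeasure (posterior D prior t H) S" for H
  have post1: "post H \<le> 1" if "H \<in> space (hist_space D t)" for H
    unfolding post_def using prob_space.measure_le_1[OF prob_space_posterior[OF that]] by simp
  have post_m[measurable]: "post \<in> borel_measurable (hist_space D t)" unfolding post_def[abs_def] by measurable
  have "(\<integral>\<^sup>+H. post H * indicator ?G H \<partial>?P) \<le> (\<integral>\<^sup>+H. ennreal (\<phi> H) + ennreal (1 - \<phi> H) * post H * indicator ?G H \<partial>?P)"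
  proof (rule nn_integral_mono)
    fix H assume "H \<in> space ?P"
    then have H: "H \<in> space (hist_space D t)" by (simp add: space_hist_law)
    have "ennreal (\<phi> H) + ennreal (1 - \<phi> H) = 1"
      using \<phi>(2)[OF H] by (simp add: ennreal_plus[symmetric] del: ennreal_plus)
    then have "post H * indicator ?G H = ennreal (\<phi> H) * (post H * indicator ?G H) + ennreal (1 - \<phi> H) * (post H * indicator ?G H)"
      unfolding distrib_right[symmetric] by simp
    also have "ennreal (\<phi> H) * (post H * indicator ?G H) \<le> ennreal (\<phi> H) * 1"
      using post1[OF H] by (intro mult_left_mono) (auto split: split_indicator)
    finally show "post H * indicator ?G H \<le> ennreal (\<phi> H) + ennreal (1 - \<phi> H) * post H * indicator ?G H"
      by (simp add: mult.assoc add_right_mono)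
  qed
  also have "\<dots> = (\<integral>\<^sup>+H. ennreal (\<phi> H) \<partial>?P) + (\<integral>\<^sup>+H. ennreal (1 - \<phi> H) * post H * indicator ?G H \<partial>?P)"
    by (rule nn_integral_add) (unfold measurable_hist_law_iff, measurable)
  also have "(\<integral>\<^sup>+H. ennreal (1 - \<phi> H) * post H * indicator ?G H \<partial>?P) =
      (\<integral>\<^sup>+H. ?c * ?l \<theta> H * (ennreal (1 - \<phi> H) * post H * indicator ?G H) \<partial>ref_law t)"
    by (rule nn[OF \<theta>]) measurable
  also have "\<dots> \<le> (\<integral>\<^sup>+H. \<integral>\<^sup>+\<theta>'. ennreal (1 / \<kappa>) * (?c * ?l \<theta>' H * ennreal (1 - \<phi> H) * indicator S \<theta>') \<partial>prior \<partial>ref_law t)"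
  proof (rule nn_integral_mono)
    fix H assume "H \<in> space (ref_law t)"
    then have H: "H \<in> space (hist_space D t)" by (simp add: space_ref_law)
    note [measurable] = measurable_lik_prior[OF H]
    let ?I = "\<integral>\<^sup>+\<theta>'. ?l \<theta>' H * indicator S \<theta>' \<partial>prior"
    let ?e = "evidence D prior t H"
    have "?l \<theta> H * (post H * indicator ?G H) \<le> ennreal (1 / \<kappa>) * ?I"
    proof (cases "H \<in> L")
      case False
      then have good: "ennreal \<kappa> * ?l \<theta> H \<le> ?e"
      proof -
        have "ennreal \<kappa> * ?l \<theta> H \<le> (\<integral>\<^sup>+\<theta>'. ?l \<theta>' H * indicator B \<theta>' \<partial>prior)"
          using False H by (auto simp: L_def not_less)
        also have "\<dots> \<le> ?e" unfolding evidence_def by (intro nn_integral_mono) (auto split: split_indicator)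
        finally show ?thesis .
      qed
      have "?l \<theta> H = ennreal (1 / \<kappa>) * (ennreal \<kappa> * ?l \<theta> H)"
        using \<kappa> by (simp add: mult.assoc[symmetric] ennreal_mult'[symmetric])
      also have "\<dots> \<le> ennreal (1 / \<kappa>) * ?e" using good by (intro mult_left_mono) auto
      finally have le: "?l \<theta> H \<le> ennreal (1 / \<kappa>) * ?e" .
      show ?thesis
      \<comment> \<open>At zero evidence the posterior falls back to the prior, but there
        \<open>le\<close> makes the true likelihood vanish too.\<close>
      proof (cases "?e = 0")
        case True
        then show ?thesis using le by simp
      next
        case e0: False
        have "?l \<theta> H * post H \<le> ennreal (1 / \<kappa>) * ?e * (?I / ?e)"
          using le fin[OF H] e0 emeasure_posterior[OF H S]
          by (intro mult_mono) (auto simp: post_def zero_less_iff_neq_zero)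
        also have "\<dots> = ennreal (1 / \<kappa>) * (?e * (?I / ?e))" by (simp add: mult.assoc)
        also have "?e * (?I / ?e) = ?I"
          unfolding ennreal_times_divide mult.commute[of ?e ?I]
          by (rule mult_divide_eq_ennreal) (use e0 fin[OF H] in auto)
        finally show ?thesis using False H by simp
      qed
    qed simp
    then have "?c * ennreal (1 - \<phi> H) * (?l \<theta> H * (post H * indicator ?G H)) \<le> ?c * ennreal (1 - \<phi> H) * (ennreal (1 / \<kappa>) * ?I)"
      by (intro mult_left_mono) auto
    also have "\<dots> = (\<integral>\<^sup>+\<theta>'. (?c * ennreal (1 - \<phi> H) * ennreal (1 / \<kappa>)) * (?l \<theta>' H * indicator S \<theta>') \<partial>prior)"
      by (subst nn_integral_cmult) (measurable, simp add: mult.assoc)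
    finally show "?c * ?l \<theta> H * (ennreal (1 - \<phi> H) * post H * indicator ?G H) \<le>
      (\<integral>\<^sup>+\<theta>'. ennreal (1 / \<kappa>) * (?c * ?l \<theta>' H * ennreal (1 - \<phi> H) * indicator S \<theta>') \<partial>prior)"
      by (simp add: mult_ac)
  qed
  also have "\<dots> = (\<integral>\<^sup>+\<theta>'. \<integral>\<^sup>+H. ennreal (1 / \<kappa>) * (?c * ?l \<theta>' H * ennreal (1 - \<phi> H) * indicator S \<theta>') \<partial>ref_law t \<partial>prior)"
  proof -
    interpret R: prob_space "ref_law t" by (rule prob_space_ref_law)
    interpret RP: pair_sigma_finite "ref_law t" prior ..
    show ?thesis
      by (rule RP.Fubini'[symmetric])
         (unfold measurable_cong_sets[OF sets_pair_measure_cong[OF sets_ref_law sets_prior] refl] case_prod_unfold, measurable)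
  qed
  also have "\<dots> \<le> (\<integral>\<^sup>+\<theta>'. ennreal (b / \<kappa>) * indicator S \<theta>' \<partial>prior)"
  proof (rule nn_integral_mono)
    fix \<theta>' assume "\<theta>' \<in> space prior"
    then have \<theta>'[measurable]: "\<theta>' \<in> space (params D)" by (simp add: space_prior)
    show "(\<integral>\<^sup>+H. ennreal (1 / \<kappa>) * (?c * ?l \<theta>' H * ennreal (1 - \<phi> H) * indicator S \<theta>') \<partial>ref_law t) \<le>
        ennreal (b / \<kappa>) * indicator S \<theta>'"
    proof (cases "\<theta>' \<in> S")
      case True
      have "(\<integral>\<^sup>+H. ennreal (1 / \<kappa>) * (?c * ?l \<theta>' H * ennreal (1 - \<phi> H) * indicator S \<theta>') \<partial>ref_law t) =
        (\<integral>\<^sup>+H. ennreal (1 / \<kappa>) * (?c * ?l \<theta>' H * ennreal (1 - \<phi> H)) \<partial>ref_law t)"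
        using True by simp
      also have "\<dots> = ennreal (1 / \<kappa>) * (\<integral>\<^sup>+H. ?c * ?l \<theta>' H * ennreal (1 - \<phi> H) \<partial>ref_law t)"
        by (rule nn_integral_cmult) (unfold measurable_ref_law_iff, measurable)
      also have "\<dots> = ennreal (1 / \<kappa>) * (\<integral>\<^sup>+H. ennreal (1 - \<phi> H) \<partial>hist_law D ini \<theta>' \<pi> t)"
        using nn[OF \<theta>', of "\<lambda>H. ennreal (1 - \<phi> H)"] by simp
      also have "\<dots> \<le> ennreal (1 / \<kappa>) * ennreal b" by (intro mult_left_mono type2 True) simp
      also have "\<dots> = ennreal (b / \<kappa>)" using \<kappa> b by (simp add: ennreal_mult'[symmetric])
      finally show ?thesis using True by simp
    qed simp
  qed
  also have "\<dots> = ennreal (b / \<kappa>) * ennreal (measure prior S)"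
    using S by (subst nn_integral_cmult_indicator) (simp_all add: sets_prior prior.emeasure_eq_measure)
  also have "\<dots> = ennreal (measure prior S * b / \<kappa>)"
    using \<kappa> b by (simp add: ennreal_mult'[symmetric] mult_ac)
  also have "(\<integral>\<^sup>+H. ennreal (\<phi> H) \<partial>?P) + ennreal (measure prior S * b / \<kappa>) \<le> ennreal a + ennreal (measure prior S * b / \<kappa>)"
    by (intro add_right_mono type1)
  also have "\<dots> = ennreal (a + measure prior S * b / \<kappa>)"
    using a b \<kappa> by simp
  finally show ?thesis by (simp add: post_def)
qed

text \<open>The term with the power of c = t * eps_bar^2 is the probability of low evidence, and 8
  exp (- c) is the geometric sum over the shells. The condition \<open>6 \<le> K * real J\<close>
  lets the exponent of the tests pay for the factor exp (2 c) lost with the evidence and still leave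
  exp (- c) together with a geometric factor in j; \<open>8 \<le> J\<close> is what the tests for
  shells require.\<close>

lemma posterior_contraction:
  assumes tc: "testing_constants D \<theta> \<pi> k l \<alpha> \<mu> \<nu> K \<xi>" and t: "k + l \<le> t"
    and \<mu>: "\<mu> \<in> borel_measurable (state_actions D)" and \<nu>: "\<nu> \<in> borel_measurable (state_actions D)"
    and \<alpha>: "\<And>i. 0 < \<alpha> i" and \<epsilon>: "0 < \<epsilon> t"
    and dist_fin: "\<And>\<theta>'. \<theta>' \<in> space (params D) \<Longrightarrow> hdist D \<mu> \<theta>' \<theta> < \<top>"
    and ev_fin: "\<And>H. H \<in> space (hist_space D t) \<Longrightarrow> evidence D prior t H < \<top>"
    and entropy: "(SUP e\<in>{\<epsilon> t<..}. log_enat (covering_number (space (params D))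
          (ennreal (1 / 2 * sqrt (alpha_last k l \<alpha> t) * \<xi> * e))
          {\<theta>' \<in> space (params D). hdist D \<mu> \<theta>' \<theta> < ennreal e} (hdist D \<nu>)))
        \<le> ereal (real t * (eps_bar k l \<alpha> \<epsilon> t)\<^sup>2)"
    and nbhd: "0 < measure prior (KL_nbhd D ini \<pi> t \<theta> (eps_bar k l \<alpha> \<epsilon> t) n)"
    and prior_ratio: "\<And>j. J \<le> j \<Longrightarrow> measure prior {\<theta>' \<in> space (params D).
          ennreal (real j * \<epsilon> t) < hdist D \<mu> \<theta>' \<theta> \<and>
          hdist D \<mu> \<theta>' \<theta> \<le> ennreal ((real j + 1) * \<epsilon> t)}
        / measure prior (KL_nbhd D ini \<pi> t \<theta> (eps_bar k l \<alpha> \<epsilon> t) n)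
        \<le> exp (K * real t * (eps_bar k l \<alpha> \<epsilon> t)\<^sup>2 * (real j)\<^sup>2 / 2)"
    and J: "8 \<le> J" "6 \<le> K * real J"
    and c1: "1 \<le> real t * (eps_bar k l \<alpha> \<epsilon> t)\<^sup>2"
  shows "(\<integral>\<^sup>+H. emeasure (posterior D prior t H) {\<theta>' \<in> space (params D). ennreal (real J * \<epsilon> t) < hdist D \<mu> \<theta>' \<theta>}
      \<partial>hist_law D ini \<theta> \<pi> t)
    \<le> ennreal (2 * (real t * (eps_bar k l \<alpha> \<epsilon> t)\<^sup>2) powr (- real n / 2) + 8 * exp (- (real t * (eps_bar k l \<alpha> \<epsilon> t)\<^sup>2)))"
proof -
  define eb where "eb = eps_bar k l \<alpha> \<epsilon> t"
  define c where "c = real t * eb\<^sup>2"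
  define B where "B = KL_nbhd D ini \<pi> t \<theta> eb n"
  define w where "w = measure prior B"
  \<comment> \<open>Half of the prior mass of the neighbourhood times the lower bound exp (- 2 c)
    for likelihood ratios.\<close>
  define \<kappa> where "\<kappa> = w / 2 * exp (- 2 * c)"
  define S where "S j = {\<theta>' \<in> space (params D). ennreal (real j * \<epsilon> t) < hdist D \<mu> \<theta>' \<theta> \<and>
          hdist D \<mu> \<theta>' \<theta> \<le> ennreal ((real j + 1) * \<epsilon> t)}" for j
  define A where "A = {\<theta>' \<in> space (params D). ennreal (real J * \<epsilon> t) < hdist D \<mu> \<theta>' \<theta>}"
  define q where "q = c powr (- real n / 2)"
  have c: "1 \<le> c" using c1 by (simp add: c_def eb_def)
  have t0: "0 < real t" using c by (cases "t = 0") (auto simp: c_def)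
  have K: "0 < K" using tc by (simp add: testing_constants_def)
  have As: "0 \<le> alpha_sum k l \<alpha> t" unfolding alpha_sum_def using \<alpha> by (intro sum_nonneg less_imp_le)
  have eb2: "eb\<^sup>2 = alpha_sum k l \<alpha> t * (\<epsilon> t)\<^sup>2 / real t"
  proof -
    have "(\<Sum>i<t div (k + l). \<alpha> (i * (k + l)) * (\<epsilon> t)\<^sup>2 / real t) = alpha_sum k l \<alpha> t * (\<epsilon> t)\<^sup>2 / real t"
      by (simp add: alpha_sum_def sum_distrib_right sum_divide_distrib)
    then show ?thesis using As t0 by (simp add: eb_def eps_bar_def)
  qed
  \<comment> \<open>This ties the two scales together: a test at distance j \<epsilon>_t has error
    exp (- K c j^2) with the same c that bounds the Kullback-Leibler divergence.\<close>
  then have cA: "alpha_sum k l \<alpha> t * (\<epsilon> t)\<^sup>2 = c" using t0 by (simp add: c_def)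
  have eb0: "0 < eb"
  proof -
    have "0 \<le> eb" using As t0 unfolding eb_def eps_bar_def alpha_sum_def
      by (intro real_sqrt_ge_zero sum_nonneg) (simp add: \<alpha> less_imp_le)
    moreover have "eb \<noteq> 0" using c by (auto simp: c_def)
    ultimately show ?thesis by simp
  qed
  have w: "0 < w" using nbhd by (simp add: w_def B_def eb_def)
  \<comment> \<open>\<open>measure\<close> is 0 outside the sigma-algebra, so the positive value
    assumed for the neighbourhood yields its measurability.\<close>
  have Bs: "B \<in> sets (params D)"
    using w measure_notin_sets[of B prior] by (auto simp: w_def sets_prior)
  have \<kappa>: "0 < \<kappa>" using w by (simp add: \<kappa>_def)
  have hm[measurable]: "(\<lambda>\<theta>'. hdist D \<mu> \<theta>' \<theta>) \<in> borel_measurable (params D)"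
    by (rule measurable_hdist[OF \<mu> \<theta>])
  have Ss[measurable]: "S j \<in> sets (params D)" for j unfolding S_def by measurable
  let ?P = "hist_law D ini \<theta> \<pi> t"
  let ?A = "\<lambda>\<theta>'. {H \<in> space (hist_space D t). likelihood D t H \<theta>' < exp (- 2 * c) * likelihood D t H \<theta>}"
  \<comment> \<open>The moment bound t^(n/2) eps_bar^n equals c^(n/2); dividing by c^n leaves
    c^(-n/2).\<close>
  have v: "real t powr (real n / 2) * eb ^ n / c ^ n = q"
  proof -
    have "eb ^ n = (eb\<^sup>2) powr (real n / 2)"
      using eb0 by (simp add: powr_realpow[symmetric] powr_powr[symmetric] powr_powr power2_eq_square powr_mult powr_add[symmetric])
    then have "real t powr (real n / 2) * eb ^ n = c powr (real n / 2)"
      using t0 by (simp add: c_def powr_mult)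
    moreover have "c ^ n = c powr real n" using c by (simp add: powr_realpow)
    ultimately show ?thesis using c by (simp add: q_def powr_diff[symmetric])
  qed
  have ratio: "emeasure ?P (?A \<theta>') \<le> ennreal q" if \<theta>': "\<theta>' \<in> B" for \<theta>'
  proof -
    have p: "\<theta>' \<in> space (params D)"
      and kl: "KL ?P (hist_law D ini \<theta>' \<pi> t) \<le> ereal c"
        "KL_moment n ?P (hist_law D ini \<theta>' \<pi> t) \<le> ennreal (real t powr (real n / 2) * eb ^ n)"
      using \<theta>' by (simp_all add: B_def KL_nbhd_def c_def)
    interpret o: mdp_control D ini \<pi> \<theta>' by (rule other_parameter[OF p])
    have m: "(\<lambda>H. mass ^ t * likelihood D t H u) \<in> borel_measurable (ref_law t)" if "u \<in> space (params D)" for u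
      unfolding measurable_ref_law_iff using that by measurable
    have nn: "0 \<le> mass ^ t * likelihood D t H u" if "u \<in> space (params D)" "H \<in> space (ref_law t)" for u H
      using likelihood_nonneg[of H t u] that mass_pos by (simp add: space_ref_law)
    have "emeasure (density (ref_law t) (\<lambda>H. ennreal (mass ^ t * likelihood D t H \<theta>)))
      {x \<in> space (ref_law t). mass ^ t * likelihood D t x \<theta>' < exp (- 2 * c) * (mass ^ t * likelihood D t x \<theta>)}
      \<le> ennreal (real t powr (real n / 2) * eb ^ n / c ^ n)"
    proof (rule KL_likelihood_ratio[OF prob_space_ref_law])
      show "prob_space (density (ref_law t) (\<lambda>H. ennreal (mass ^ t * likelihood D t H \<theta>)))"
        using prob_space_hist_law[of t] by (simp only: hist_law_density_other[OF \<theta>])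
      show "prob_space (density (ref_law t) (\<lambda>H. ennreal (mass ^ t * likelihood D t H \<theta>')))"
        using o.prob_space_hist_law[of t] by (simp only: hist_law_density_other[OF p])
      show "KL (density (ref_law t) (\<lambda>H. ennreal (mass ^ t * likelihood D t H \<theta>)))
         (density (ref_law t) (\<lambda>H. ennreal (mass ^ t * likelihood D t H \<theta>'))) \<le> ereal c"
        using kl(1) by (simp only: hist_law_density_other[OF \<theta>] hist_law_density_other[OF p])
      show "KL_moment n (density (ref_law t) (\<lambda>H. ennreal (mass ^ t * likelihood D t H \<theta>)))
         (density (ref_law t) (\<lambda>H. ennreal (mass ^ t * likelihood D t H \<theta>')))
         \<le> ennreal (real t powr (real n / 2) * eb ^ n)"
        using kl(2) by (simp only: hist_law_density_other[OF \<theta>] hist_law_density_other[OF p])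
      show "0 < c" using c by simp
    qed (use m[OF \<theta>] m[OF p] nn[OF \<theta>] nn[OF p] in blast)+
    moreover have "{x \<in> space (ref_law t). mass ^ t * likelihood D t x \<theta>' < exp (- 2 * c) * (mass ^ t * likelihood D t x \<theta>)} = ?A \<theta>'"
    proof -
      have "mass ^ t * u < exp (- 2 * c) * (mass ^ t * u') \<longleftrightarrow> u < exp (- 2 * c) * u'" for u u'
        using mass_pos mult_less_cancel_left_pos[of "mass ^ t" u "exp (- 2 * c) * u'"] by (simp add: mult.left_commute)
      then show ?thesis by (simp add: space_ref_law)
    qed
    ultimately show ?thesis by (simp only: hist_law_density_other[OF \<theta>] v)
  qed
  let ?L = "{H \<in> space (hist_space D t). (\<integral>\<^sup>+\<theta>'. ennreal (likelihood D t H \<theta>') * indicator B \<theta>' \<partial>prior)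
        < ennreal \<kappa> * ennreal (likelihood D t H \<theta>)}"
  have Lm[measurable]: "?L \<in> sets (hist_space D t)"
    using measurable_restricted_evidence[OF Bs] \<theta> by measurable
  have low: "emeasure ?P ?L \<le> ennreal (2 * q)"
    unfolding \<kappa>_def w_def by (rule low_evidence[OF Bs _ _ ratio]) (use w in \<open>simp_all add: q_def w_def\<close>)
  have shell: "(\<integral>\<^sup>+H. emeasure (posterior D prior t H) (S j) * indicator (space (hist_space D t) - ?L) H \<partial>?P)
      \<le> ennreal (4 * exp (- c) * (1 / 2) ^ (j - J))" if j: "J \<le> j" for j
  proof -
    define E where "E = exp (- (K * c * (real j)\<^sup>2))"
    have E: "exp (- K * (alpha_sum k l \<alpha> t * (real j * \<epsilon> t)\<^sup>2)) = E"
      unfolding E_def cA[symmetric] by (simp add: power_mult_distrib mult_ac)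
    \<comment> \<open>The entropy condition is used at the radius of the enlarged shell, which
      exceeds \<epsilon>_t as required.\<close>
    have e: "\<epsilon> t < 23 / 20 * real j * \<epsilon> t" using j J(1) \<epsilon> by simp
    have "log_enat (covering_number (space (params D))
          (ennreal (1 / 2 * sqrt (alpha_last k l \<alpha> t) * \<xi> * (23 / 20 * real j * \<epsilon> t)))
          {\<theta>' \<in> space (params D). hdist D \<mu> \<theta>' \<theta> < ennreal (23 / 20 * real j * \<epsilon> t)} (hdist D \<nu>)) \<le> ereal c"
      unfolding c_def eb_def
      by (rule order_trans[OF SUP_upper entropy]) (use e in simp)
    from test_for_shell[where \<epsilon>="\<epsilon> t", OF tc t \<nu> \<alpha> \<epsilon> order_trans[OF J(1) j] this]
    obtain \<phi> where \<phi>: "\<phi> \<in> borel_measurable (hist_space D t)"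
        "\<And>H. H \<in> space (hist_space D t) \<Longrightarrow> 0 \<le> \<phi> H \<and> \<phi> H \<le> (1::real)"
        "(\<integral>\<^sup>+H. ennreal (\<phi> H) \<partial>?P) \<le> ennreal (2 * exp c * E)"
        "\<And>\<theta>'. \<theta>' \<in> S j \<Longrightarrow> (\<integral>\<^sup>+H. ennreal (1 - \<phi> H) \<partial>hist_law D ini \<theta>' \<pi> t) \<le> ennreal E"
      unfolding E S_def by blast
    have "(\<integral>\<^sup>+H. emeasure (posterior D prior t H) (S j) * indicator (space (hist_space D t) - ?L) H \<partial>?P)
      \<le> ennreal (2 * exp c * E + measure prior (S j) * E / \<kappa>)"
      by (rule posterior_shell[OF Bs Ss \<kappa> \<phi> ev_fin]) (simp_all add: E_def)
    also have "\<dots> \<le> ennreal (4 * exp (- c) * (1 / 2) ^ (j - J))"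
    proof (rule ennreal_leI)
      have pr: "measure prior (S j) / w \<le> exp (K * c * (real j)\<^sup>2 / 2)"
        using prior_ratio[OF j] unfolding S_def w_def B_def c_def eb_def by (simp add: mult.assoc)
      \<comment> \<open>Division by \<open>\<kappa>\<close> costs the factor 2 exp (2 c) and turns
        the prior mass of the shell into the ratio controlled by hypothesis. That ratio uses up half
        of the exponent in \<open>E\<close>.\<close>
      have "measure prior (S j) * E / \<kappa> = 2 * exp (2 * c) * E * (measure prior (S j) / w)"
        using w by (simp add: \<kappa>_def exp_minus field_simps)
      also have "\<dots> \<le> 2 * exp (2 * c) * E * exp (K * c * (real j)\<^sup>2 / 2)"
        by (intro mult_left_mono pr) (simp add: E_def)
      also have "\<dots> = 2 * exp (2 * c - K * c * (real j)\<^sup>2 / 2)"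
        by (simp add: E_def exp_add[symmetric] exp_diff[symmetric] field_simps)
      finally have 1: "measure prior (S j) * E / \<kappa> \<le> 2 * exp (2 * c - K * c * (real j)\<^sup>2 / 2)" .
      have "c - K * c * (real j)\<^sup>2 \<le> 2 * c - K * c * (real j)\<^sup>2 / 2"
        using c K by (simp add: field_simps)
      then have 2: "2 * exp c * E \<le> 2 * exp (2 * c - K * c * (real j)\<^sup>2 / 2)"
        by (simp add: E_def exp_add[symmetric])
      have Kj: "6 * real j \<le> K * (real j)\<^sup>2"
      proof -
        have "6 \<le> K * real j" using J(2) K j by (meson mult_left_mono of_nat_mono order_trans less_imp_le)
        then show ?thesis by (simp add: power2_eq_square mult_right_mono mult.assoc[symmetric])
      qed
      \<comment> \<open>As K j^2 is at least 6 j, the exponent is at most 2 c - 3 c j, hence at most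
        - c j, and c j is at least c + (j - J) because c and J are at least 1.\<close>
      have "2 * c - K * c * (real j)\<^sup>2 / 2 \<le> - c - real (j - J)"
      proof -
        have "c * (6 * real j) \<le> c * (K * (real j)\<^sup>2)" using Kj c by (intro mult_left_mono) simp_all
        moreover have "c * real j \<le> c * (3 * real j) - 2 * c" using c j J(1)
          mult_left_mono[of 1 "real j" c] by (simp add: algebra_simps)
        moreover have "c + real (j - J) \<le> c * real j"
        proof -
          have "real (j - J) \<le> c * real (j - J)" using c by (simp add: mult_le_cancel_right1)
          moreover have "c * 1 \<le> c * real J" using c J(1) by (intro mult_left_mono) simp_all
          ultimately show ?thesis using j by (simp add: of_nat_diff algebra_simps)
        qed
        ultimately show ?thesis by (simp add: algebra_simps)
      qed
      then have "exp (2 * c - K * c * (real j)\<^sup>2 / 2) \<le> exp (- c) * exp (- real (j - J))"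
        by (simp add: exp_add[symmetric])
      also have "exp (- real (j - J)) \<le> (1 / 2) ^ (j - J)"
      proof -
        have "exp (- real (j - J)) = (exp (- 1)) ^ (j - J)" by (simp add: exp_of_nat_mult[symmetric])
        also have "\<dots> \<le> (1 / 2) ^ (j - J)"
        proof (rule power_mono)
          show "exp (- 1) \<le> 1 / (2::real)" using exp_ge_add_one_self[of 1] by (simp add: exp_minus field_simps)
        qed simp
        finally show ?thesis .
      qed
      finally have "exp (2 * c - K * c * (real j)\<^sup>2 / 2) \<le> exp (- c) * (1 / 2) ^ (j - J)" by simp
      then show "2 * exp c * E + measure prior (S j) * E / \<kappa> \<le> 4 * exp (- c) * (1 / 2) ^ (j - J)"
        using 1 2 by linarith
    qed
    finally show ?thesis .
  qed
  \<comment> \<open>Finiteness of the distance puts each parameter of \<open>A\<close> into a shell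
    of finite index.\<close>
  have A_sub: "A \<subseteq> (\<Union>i. S (J + i))"
  proof
    fix \<theta>' assume "\<theta>' \<in> A"
    then have p: "\<theta>' \<in> space (params D)" and d: "ennreal (real J * \<epsilon> t) < hdist D \<mu> \<theta>' \<theta>" by (simp_all add: A_def)
    obtain x where x: "hdist D \<mu> \<theta>' \<theta> = ennreal x" "0 \<le> x"
      using dist_fin[OF p] by (cases "hdist D \<mu> \<theta>' \<theta>") auto
    have Jx: "real J * \<epsilon> t < x" using d x \<epsilon> by (simp add: ennreal_less_iff)
    define N where "N = nat \<lceil>x / \<epsilon> t\<rceil>"
    have N: "real N - 1 < x / \<epsilon> t" "x / \<epsilon> t \<le> real N"
      using x \<epsilon> by (auto simp: N_def) linarith+
    have "real J < x / \<epsilon> t" using Jx \<epsilon> by (simp add: field_simps)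
    then have JN: "J < N" using N by simp
    \<comment> \<open>Shells are open at the inner and closed at the outer radius, so the index is
      the ceiling of the scaled distance minus one.\<close>
    have "\<theta>' \<in> S (N - 1)"
      using p x N JN \<epsilon> by (simp add: S_def of_nat_diff ennreal_less_iff field_simps ennreal_leI)
    then show "\<theta>' \<in> (\<Union>i. S (J + i))"
      using JN by (intro UN_I[of "N - 1 - J"]) auto
  qed
  have As': "A \<in> sets (params D)" unfolding A_def by measurable
  note [measurable] = measurable_prob_algebraD[OF measurable_posterior]
  have pm[measurable]: "(\<lambda>H. emeasure (posterior D prior t H) X) \<in> borel_measurable (hist_space D t)" if "X \<in> sets (params D)" for X
    using that by measurable
  have "(\<integral>\<^sup>+H. emeasure (posterior D prior t H) A \<partial>?P) \<le>
    (\<integral>\<^sup>+H. indicator ?L H + (\<Sum>i. emeasure (posterior D prior t H) (S (J + i)) * indicator (space (hist_space D t) - ?L) H) \<partial>?P)"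
  proof (rule nn_integral_mono)
    fix H assume "H \<in> space ?P"
    then have H: "H \<in> space (hist_space D t)" by (simp add: space_hist_law)
    show "emeasure (posterior D prior t H) A \<le> indicator ?L H +
      (\<Sum>i. emeasure (posterior D prior t H) (S (J + i)) * indicator (space (hist_space D t) - ?L) H)"
    \<comment> \<open>At histories of low evidence the posterior mass is only bounded by 1;
      elsewhere it is summed over the shells.\<close>
    proof (cases "H \<in> ?L")
      case True
      have "emeasure (posterior D prior t H) A \<le> 1"
        using prob_space.measure_le_1[OF prob_space_posterior[OF H]] .
      also have "1 \<le> indicator ?L H + (\<Sum>i. emeasure (posterior D prior t H) (S (J + i)) * indicator (space (hist_space D t) - ?L) H)"
        using True by simp
      finally show ?thesis .
    next
      case False
      have "emeasure (posterior D prior t H) A \<le> emeasure (posterior D prior t H) (\<Union>i. S (J + i))"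
        by (intro emeasure_mono A_sub) auto
      also have "\<dots> \<le> (\<Sum>i. emeasure (posterior D prior t H) (S (J + i)))"
        by (rule emeasure_subadditive_countably) auto
      also have "\<dots> = indicator ?L H + (\<Sum>i. emeasure (posterior D prior t H) (S (J + i)) * indicator (space (hist_space D t) - ?L) H)"
        using False H by (simp add: indicator_def)
      finally show ?thesis .
    qed
  qed
  also have "\<dots> = emeasure ?P ?L + (\<integral>\<^sup>+H. (\<Sum>i. emeasure (posterior D prior t H) (S (J + i)) * indicator (space (hist_space D t) - ?L) H) \<partial>?P)"
  proof (subst nn_integral_add)
    show "indicator ?L \<in> borel_measurable ?P" unfolding measurable_hist_law_iff by measurable
    show "(\<lambda>H. \<Sum>i. emeasure (posterior D prior t H) (S (J + i)) * indicator (space (hist_space D t) - ?L) H) \<in> borel_measurable ?P"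
      unfolding measurable_hist_law_iff
      by (intro borel_measurable_suminf_order borel_measurable_times_ennreal pm Ss borel_measurable_indicator sets.Diff sets.top Lm)
  qed (simp add: sets_hist_law)
  also have "(\<integral>\<^sup>+H. (\<Sum>i. emeasure (posterior D prior t H) (S (J + i)) * indicator (space (hist_space D t) - ?L) H) \<partial>?P) =
    (\<Sum>i. \<integral>\<^sup>+H. emeasure (posterior D prior t H) (S (J + i)) * indicator (space (hist_space D t) - ?L) H \<partial>?P)"
    by (rule nn_integral_suminf)
       (unfold measurable_hist_law_iff, intro borel_measurable_times_ennreal pm Ss borel_measurable_indicator sets.Diff sets.top Lm)
  also have "\<dots> \<le> (\<Sum>i. ennreal (4 * exp (- c) * (1 / 2) ^ i))"
    by (intro suminf_le) (use shell[of "J + i" for i] in auto)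
  also have "\<dots> = ennreal (8 * exp (- c))"
  proof (rule suminf_ennreal_eq)
    have "(\<lambda>i. 4 * exp (- c) * (1 / 2) ^ i) sums (4 * exp (- c) * (1 / (1 - 1 / 2)))"
      by (intro sums_mult geometric_sums) simp
    then show "(\<lambda>i. 4 * exp (- c) * (1 / 2) ^ i) sums (8 * exp (- c))" by simp
  qed simp
  also have "emeasure ?P ?L + ennreal (8 * exp (- c)) \<le> ennreal (2 * q) + ennreal (8 * exp (- c))"
    by (intro add_right_mono low)
  also have "\<dots> = ennreal (2 * q + 8 * exp (- c))"
    by (simp add: q_def)
  finally show ?thesis by (simp add: A_def q_def c_def eb_def)
qed

end

section \<open>The uniform exploration law\<close>

context mdp
begin

lemma
  assumes ne: "emeasure (actions D) (space (actions D)) \<noteq> 0" and fin: "emeasure (actions D) (space (actions D)) \<noteq> \<infinity>"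
  shows prob_space_equal_prob: "prob_space (equal_prob (actions D))"
    and sets_equal_prob: "sets (equal_prob (actions D)) = sets (actions D)"
proof -
  show "prob_space (equal_prob (actions D))"
  proof (cases "finite (space (actions D))")
    case True
    have "space (actions D) \<noteq> {}" using ne by auto
    then have "prob_space (uniform_count_measure (space (actions D)))"
      using True by (intro prob_space_uniform_count_measure)
    moreover have "(\<lambda>a. a) \<in> uniform_count_measure (space (actions D)) \<rightarrow>\<^sub>M actions D"
      by (rule measurableI) (auto simp: sets_uniform_count_measure space_uniform_count_measure dest: sets.sets_into_space)
    ultimately show ?thesis using True by (simp add: equal_prob_def prob_space.prob_space_distr)
  next
    case False
    then show ?thesis using ne fin by (simp add: equal_prob_def prob_space_uniform_measure)
  qed
  show "sets (equal_prob (actions D)) = sets (actions D)"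
    by (simp add: equal_prob_def)
qed

text \<open>On a finite action space each measurable singleton has probability one over the number
  of actions. On an infinite one an atom of mass at least 1 / C keeps at least that mass divided by
  the total. The bound is the same for all such atoms, so it will not depend on the state; the
  minimum with 1 secures \<open>c \<le> 1\<close>.\<close>

lemma equal_prob_avoid:
  assumes ne: "emeasure (actions D) (space (actions D)) \<noteq> 0" and fin: "emeasure (actions D) (space (actions D)) \<noteq> \<infinity>"
    and C: "0 < (C::real)"
  shows "\<exists>c>0. c \<le> 1 \<and> (\<forall>a\<in>space (actions D). {a} \<in> sets (actions D) \<and> 1 / C \<le> measure (actions D) {a} \<longrightarrow>
    emeasure (equal_prob (actions D)) (space (actions D) - {a}) \<le> ennreal (1 - c))"
proof -
  interpret E: prob_space "equal_prob (actions D)" by (rule prob_space_equal_prob[OF ne fin])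
  have sp: "space (equal_prob (actions D)) = space (actions D)"
    by (rule sets_eq_imp_space_eq[OF sets_equal_prob[OF ne fin]])
  have compl: "emeasure (equal_prob (actions D)) (space (actions D) - {a}) = ennreal (1 - measure (equal_prob (actions D)) {a})"
    if "{a} \<in> sets (actions D)" for a
    using E.prob_compl[of "{a}"] that by (simp add: sp sets_equal_prob[OF ne fin] E.emeasure_eq_measure)
  show ?thesis
  proof (cases "finite (space (actions D))")
    case True
    have ne': "space (actions D) \<noteq> {}" using ne by auto
    have "measure (equal_prob (actions D)) {a} = 1 / card (space (actions D))"
      if a: "a \<in> space (actions D)" "{a} \<in> sets (actions D)" for a
    proof -
      have m: "(\<lambda>a. a) \<in> uniform_count_measure (space (actions D)) \<rightarrow>\<^sub>M actions D"
        by (rule measurableI) (auto simp: sets_uniform_count_measure space_uniform_count_measure dest: sets.sets_into_space)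
      have "measure (equal_prob (actions D)) {a} = measure (uniform_count_measure (space (actions D))) {a}"
        using True a measure_distr[OF m, of "{a}"] by (simp add: equal_prob_def space_uniform_count_measure Int_absorb2)
      also have "\<dots> = 1 / card (space (actions D))"
        using True a by (simp add: measure_uniform_count_measure)
      finally show ?thesis .
    qed
    moreover have "0 < card (space (actions D))" using True ne' by (simp add: card_gt_0_iff)
    ultimately show ?thesis
      by (intro exI[of _ "1 / card (space (actions D))"]) (auto simp: compl field_simps)
  next
    case False
    define \<kappa> where "\<kappa> = measure (actions D) (space (actions D))"
    have \<kappa>: "0 < \<kappa>" using ne fin by (simp add: \<kappa>_def measure_def enn2real_positive_iff less_top zero_less_iff_neq_zero)
    have "1 - measure (equal_prob (actions D)) {a} \<le> 1 - min 1 (1 / (C * \<kappa>))"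
      if a: "a \<in> space (actions D)" "{a} \<in> sets (actions D)" "1 / C \<le> measure (actions D) {a}" for a
    proof -
      have "measure (equal_prob (actions D)) {a} = measure (actions D) {a} / \<kappa>"
        using False a measure_uniform_measure[OF ne, of "{a}"] fin by (simp add: equal_prob_def \<kappa>_def Int_absorb1)
      moreover have "1 / C / \<kappa> \<le> measure (actions D) {a} / \<kappa>" using a(3) \<kappa> by (intro divide_right_mono) auto
      ultimately show ?thesis by simp
    qed
    then show ?thesis using C \<kappa>
      by (intro exI[of _ "min 1 (1 / (C * \<kappa>))"]) (auto simp: compl intro!: ennreal_leI)
  qed
qed

lemma measurable_select_policy:
  assumes astar: "(\<lambda>(\<theta>, s). astar \<theta> s) \<in> params D \<Otimes>\<^sub>M states D \<rightarrow>\<^sub>M actions D"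
    and f: "f \<in> N \<rightarrow>\<^sub>M params D" and g: "g \<in> N \<rightarrow>\<^sub>M hist_space D t"
  shows "(\<lambda>x. select_policy D (astar (f x)) t (g x)) \<in> N \<rightarrow>\<^sub>M prob_algebra (actions D)"
proof -
  have "(\<lambda>x. (f x, snd (g x))) \<in> N \<rightarrow>\<^sub>M params D \<Otimes>\<^sub>M states D" using f g by measurable
  from measurable_compose[OF measurable_compose[OF this astar] measurable_return_prob_space]
  show ?thesis by (simp add: select_policy_def)
qed

end

section \<open>Thompson sampling\<close>

lemma prob_space_unit_interval: "prob_space (uniform_measure lborel {0<..<1::real})"
  by (rule prob_space_uniform_measure) auto

locale thompson = mdp D for D :: "('s, 'a, 'p) mdp_family" +
  fixes astar :: "'p \<Rightarrow> 's \<Rightarrow> 'a" and \<delta> :: "nat \<Rightarrow> real" and prior :: "nat \<Rightarrow> 'p measure"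
  assumes astar: "(\<lambda>(\<theta>, s). astar \<theta> s) \<in> params D \<Otimes>\<^sub>M states D \<rightarrow>\<^sub>M actions D"
    and rates: "\<And>t. 0 \<le> \<delta> t"
    and priors: "\<And>t. prob_space (prior t)" "\<And>t. sets (prior t) = sets (params D)"
    and actions_nonzero: "emeasure (actions D) (space (actions D)) \<noteq> 0"
    and actions_finite: "emeasure (actions D) (space (actions D)) \<noteq> \<infinity>"
begin

lemma mdp_prior: "mdp_prior D (prior t)"
  unfolding mdp_prior_def mdp_prior_axioms_def using mdp_axioms priors by blast

lemma unit_interval_in: "uniform_measure lborel {0<..<1::real} \<in> space (prob_algebra borel)"
  by (simp add: space_prob_algebra prob_space_unit_interval)

lemma equal_prob_in: "equal_prob (actions D) \<in> space (prob_algebra (actions D))"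
  using prob_space_equal_prob[OF actions_nonzero actions_finite] sets_equal_prob[OF actions_nonzero actions_finite]
  by (simp add: space_prob_algebra)

lemma measurable_posterior_action:
  "(\<lambda>H. posterior D (prior t) t H \<bind> (\<lambda>\<theta>. select_policy D (astar \<theta>) t H))
     \<in> hist_space D t \<rightarrow>\<^sub>M prob_algebra (actions D)"
proof (rule measurable_bind_prob_space2)
  interpret p: mdp_prior D "prior t" by (rule mdp_prior)
  show "posterior D (prior t) t \<in> hist_space D t \<rightarrow>\<^sub>M prob_algebra (params D)"
    by (rule p.measurable_posterior)
  show "(\<lambda>(H, \<theta>). select_policy D (astar \<theta>) t H) \<in> hist_space D t \<Otimes>\<^sub>M params D \<rightarrow>\<^sub>M prob_algebra (actions D)"
    unfolding case_prod_unfold by (rule measurable_select_policy[OF astar]) auto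
qed

lemma measurable_ts_kernel:
  "(\<lambda>(H, u). if u > \<delta> t then posterior D (prior t) t H \<bind> (\<lambda>\<theta>. select_policy D (astar \<theta>) t H)
     else equal_prob (actions D)) \<in> hist_space D t \<Otimes>\<^sub>M borel \<rightarrow>\<^sub>M prob_algebra (actions D)"
  unfolding case_prod_unfold
proof (rule measurable_If)
  show "(\<lambda>x. posterior D (prior t) t (fst x) \<bind> (\<lambda>\<theta>. select_policy D (astar \<theta>) t (fst x)))
    \<in> hist_space D t \<Otimes>\<^sub>M (borel :: real measure) \<rightarrow>\<^sub>M prob_algebra (actions D)"
    by (rule measurable_compose[OF measurable_fst measurable_posterior_action])
  show "(\<lambda>x. equal_prob (actions D)) \<in> hist_space D t \<Otimes>\<^sub>M (borel :: real measure) \<rightarrow>\<^sub>M prob_algebra (actions D)"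
    by (rule measurable_const[OF equal_prob_in])
qed measurable

lemma is_policy_ts: "is_policy D (ts_policy D astar \<delta> prior)"
  unfolding is_policy_def
proof
  fix t
  show "ts_policy D astar \<delta> prior t \<in> hist_space D t \<rightarrow>\<^sub>M prob_algebra (actions D)"
    unfolding ts_policy_def[abs_def]
    by (rule measurable_bind_prob_space2[OF measurable_const[OF unit_interval_in] measurable_ts_kernel])
qed

text \<open>A posterior draw can lead into \<open>X\<close> only from \<open>N\<close>. The bound
  adds the two branches and estimates the probability of the posterior branch by 1, so no upper
  bound on the exploration rate enters.\<close>

lemma emeasure_ts_policy_le:
  assumes H: "H \<in> space (hist_space D t)" and X: "X \<in> sets (actions D)" and N: "N \<in> sets (params D)"
    and avoid: "\<And>\<theta>. \<theta> \<in> space (params D) \<Longrightarrow> \<theta> \<notin> N \<Longrightarrow> astar \<theta> (snd H) \<notin> X"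
  shows "emeasure (ts_policy D astar \<delta> prior t H) X \<le>
    emeasure (posterior D (prior t) t H) N + ennreal (\<delta> t) * emeasure (equal_prob (actions D)) X"
proof -
  let ?U = "uniform_measure lborel {0<..<1::real}"
  interpret p: mdp_prior D "prior t" by (rule mdp_prior)
  let ?post = "posterior D (prior t) t H"
  have post: "?post \<in> space (prob_algebra (params D))"
    using measurable_space[OF p.measurable_posterior H] .
  have sel: "(\<lambda>\<theta>. select_policy D (astar \<theta>) t H) \<in> params D \<rightarrow>\<^sub>M prob_algebra (actions D)"
    by (rule measurable_select_policy[OF astar]) (use H in auto)
  have p1: "emeasure (?post \<bind> (\<lambda>\<theta>. select_policy D (astar \<theta>) t H)) X \<le> emeasure ?post N"
  proof -
    have "emeasure (?post \<bind> (\<lambda>\<theta>. select_policy D (astar \<theta>) t H)) X =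
      (\<integral>\<^sup>+\<theta>. emeasure (select_policy D (astar \<theta>) t H) X \<partial>?post)"
      by (rule emeasure_bind_prob_algebra[OF post sel X])
    also have "\<dots> \<le> (\<integral>\<^sup>+\<theta>. indicator N \<theta> \<partial>?post)"
    proof (rule nn_integral_mono)
      fix \<theta> assume "\<theta> \<in> space ?post"
      then have "\<theta> \<in> space (params D)" using sets_eq_imp_space_eq[OF p.sets_posterior] by blast
      then show "emeasure (select_policy D (astar \<theta>) t H) X \<le> indicator N \<theta>"
        using avoid[of \<theta>] X by (auto simp: select_policy_def split: split_indicator)
    qed
    finally show ?thesis using N by simp
  qed
  have k: "(\<lambda>u. if u > \<delta> t then ?post \<bind> (\<lambda>\<theta>. select_policy D (astar \<theta>) t H) else equal_prob (actions D))
    \<in> borel \<rightarrow>\<^sub>M prob_algebra (actions D)"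
    using measurable_compose[OF measurable_Pair1'[OF H] measurable_ts_kernel] by simp
  have "emeasure (ts_policy D astar \<delta> prior t H) X = (\<integral>\<^sup>+u. emeasure (if u > \<delta> t
      then ?post \<bind> (\<lambda>\<theta>. select_policy D (astar \<theta>) t H) else equal_prob (actions D)) X \<partial>?U)"
    unfolding ts_policy_def by (rule emeasure_bind_prob_algebra[OF unit_interval_in k X])
  also have "\<dots> \<le> (\<integral>\<^sup>+u. emeasure ?post N + emeasure (equal_prob (actions D)) X * indicator {..\<delta> t} u \<partial>?U)"
    by (rule nn_integral_mono) (auto split: split_indicator intro: p1)
  also have "\<dots> = emeasure ?post N + emeasure (equal_prob (actions D)) X * emeasure ?U {..\<delta> t}"
    using prob_space.emeasure_space_1[OF prob_space_unit_interval]
    by (subst nn_integral_add) (auto simp: nn_integral_cmult_indicator)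
  also have "\<dots> \<le> emeasure ?post N + emeasure (equal_prob (actions D)) X * ennreal (\<delta> t)"
  proof (intro add_left_mono mult_left_mono)
    have "emeasure ?U {..\<delta> t} = emeasure lborel ({0<..<1} \<inter> {..\<delta> t})"
      by (subst emeasure_uniform_measure) (auto simp: divide_ennreal_def)
    also have "\<dots> \<le> emeasure lborel {0..\<delta> t}" by (rule emeasure_mono) auto
    finally show "emeasure ?U {..\<delta> t} \<le> ennreal (\<delta> t)" using rates[of t] by simp
  qed simp
  finally show ?thesis by (simp add: mult.commute)
qed

end

section \<open>Optimal action values\<close>

locale mdp_optimal = mdp D for D :: "('s, 'a, 'p) mdp_family" +
  fixes ini :: "'s measure" and \<gamma> :: real and astar :: "'p \<Rightarrow> 's \<Rightarrow> 'a" and C\<^sub>4 :: real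
  assumes prob_ini: "prob_space ini" and sets_ini: "sets ini = sets (states D)"
    and \<gamma>: "0 < \<gamma>" "\<gamma> < 1"
    and astar: "(\<lambda>(\<theta>, s). astar \<theta> s) \<in> params D \<Otimes>\<^sub>M states D \<rightarrow>\<^sub>M actions D"
    and select: "\<And>\<theta>. \<theta> \<in> space (params D) \<Longrightarrow> is_policy D (select_policy D (astar \<theta>))"
    and argmax: "\<And>\<theta> s a. \<theta> \<in> space (params D) \<Longrightarrow> s \<in> space (states D) \<Longrightarrow> a \<in> space (actions D) \<Longrightarrow>
      Q_value D \<gamma> ini \<theta> (select_policy D (astar \<theta>)) s a
        \<le> Q_value D \<gamma> ini \<theta> (select_policy D (astar \<theta>)) s (astar \<theta> s)"
    and C\<^sub>4: "0 < C\<^sub>4"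
    and reward: "\<And>s a. s \<in> space (states D) \<Longrightarrow> a \<in> space (actions D) \<Longrightarrow> \<bar>reward D s a\<bar> \<le> C\<^sub>4"
begin

lemma measurable_astar [measurable (raw)]:
  assumes "f \<in> N \<rightarrow>\<^sub>M params D" "g \<in> N \<rightarrow>\<^sub>M states D"
  shows "(\<lambda>x. astar (f x) (g x)) \<in> N \<rightarrow>\<^sub>M actions D"
  using measurable_compose[OF measurable_Pair[OF assms] astar] by simp

lemma astar_in: "\<theta> \<in> space (params D) \<Longrightarrow> s \<in> space (states D) \<Longrightarrow> astar \<theta> s \<in> space (actions D)"
  using measurable_space[OF astar, of "(\<theta>, s)"] by (simp add: space_pair_measure)

lemma control: "\<theta> \<in> space (params D) \<Longrightarrow> mdp_control D ini (select_policy D (astar \<theta>)) \<theta>"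
  unfolding mdp_control_def mdp_control_axioms_def
  using mdp_axioms prob_ini sets_ini select by blast

text \<open>The expectation of g one step later when the next action follows
  \<open>astar \<theta>\<close>. On the action values of \<theta> themselves, where this action is
  maximal, it is the transition part of the Bellman optimality operator.\<close>

definition bellman :: "'p \<Rightarrow> ('s \<times> 'a \<Rightarrow> ennreal) \<Rightarrow> 's \<times> 'a \<Rightarrow> ennreal" where
  "bellman \<theta> g x = (\<integral>\<^sup>+s. ennreal (tdens D \<theta> (fst x) (snd x) s) * g (s, astar \<theta> s) \<partial>states D)"

lemma measurable_bellman:
  assumes [measurable]: "g \<in> borel_measurable (state_actions D)" and \<theta>: "\<theta> \<in> space (params D)"
  shows "bellman \<theta> g \<in> borel_measurable (state_actions D)"
  unfolding bellman_def[abs_def]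
  by (rule states.borel_measurable_nn_integral) (use \<theta> in measurable)

lemma measurable_bellman_funpow:
  assumes "g \<in> borel_measurable (state_actions D)" and \<theta>: "\<theta> \<in> space (params D)"
  shows "(bellman \<theta> ^^ t) g \<in> borel_measurable (state_actions D)"
  by (induction t) (simp_all add: assms measurable_bellman[OF _ \<theta>])

lemma nn_integral_frozen_next:
  assumes \<theta>: "\<theta> \<in> space (params D)" and x: "x \<in> space (state_actions D)"
    and g[measurable]: "g \<in> borel_measurable (state_actions D)"
  shows "(\<integral>\<^sup>+\<omega>. g (\<omega> (Suc t)) \<partial>frozen_law D ini \<theta> (select_policy D (astar \<theta>)) 1 (\<lambda>_. x)) =
    (\<integral>\<^sup>+\<omega>. bellman \<theta> g (\<omega> t) \<partial>frozen_law D ini \<theta> (select_policy D (astar \<theta>)) 1 (\<lambda>_. x))"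
proof -
  let ?\<pi> = "select_policy D (astar \<theta>)"
  let ?W = "frozen_law D ini \<theta> ?\<pi> 1 (\<lambda>_. x)"
  interpret c: mdp_control D ini ?\<pi> \<theta> by (rule control[OF \<theta>])
  have h: "\<And>i. i < 1 \<Longrightarrow> (\<lambda>_. x) i \<in> space (state_actions D)" using x by simp
  have spW: "space ?W = space (PiM UNIV (\<lambda>_. state_actions D))" by (rule c.space_frozen_law[OF h])
  have "(\<integral>\<^sup>+\<omega>. g (\<omega> (Suc t)) \<partial>?W) = (\<integral>\<^sup>+\<omega>. \<integral>\<^sup>+s. \<integral>\<^sup>+a. g (s, a) \<partial>?\<pi> (Suc t) (restrict \<omega> {0..<Suc t}, s)
        \<partial>c.state_kernel (Suc t) (restrict \<omega> {0..<Suc t}) \<partial>?W)"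
    by (rule c.nn_integral_frozen_step[OF h, where F="\<lambda>_. g"]) auto
  also have "\<dots> = (\<integral>\<^sup>+\<omega>. bellman \<theta> g (\<omega> t) \<partial>?W)"
  proof (rule nn_integral_cong)
    fix \<omega> assume "\<omega> \<in> space ?W"
    then have "\<omega> \<in> space (PiM UNIV (\<lambda>_. state_actions D))" unfolding spW .
    then have r: "restrict \<omega> {0..<Suc t} \<in> space (PiM {0..<Suc t} (\<lambda>_. state_actions D))"
      by (auto simp: space_PiM PiE_iff)
    have "c.state_kernel (Suc t) (restrict \<omega> {0..<Suc t}) \<in> space (prob_algebra (states D))"
      using measurable_space[OF c.measurable_state_kernel r] .
    then have sp: "space (c.state_kernel (Suc t) (restrict \<omega> {0..<Suc t})) = space (states D)"
      by (auto simp: space_prob_algebra dest: sets_eq_imp_space_eq)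
    have "(\<integral>\<^sup>+s. \<integral>\<^sup>+a. g (s, a) \<partial>?\<pi> (Suc t) (restrict \<omega> {0..<Suc t}, s) \<partial>c.state_kernel (Suc t) (restrict \<omega> {0..<Suc t})) =
      (\<integral>\<^sup>+s. g (s, astar \<theta> s) \<partial>c.state_kernel (Suc t) (restrict \<omega> {0..<Suc t}))"
    proof (rule nn_integral_cong)
      fix s assume "s \<in> space (c.state_kernel (Suc t) (restrict \<omega> {0..<Suc t}))"
      then have s: "s \<in> space (states D)" by (simp add: sp)
      show "(\<integral>\<^sup>+a. g (s, a) \<partial>?\<pi> (Suc t) (restrict \<omega> {0..<Suc t}, s)) = g (s, astar \<theta> s)"
        unfolding select_policy_def snd_conv
        by (rule nn_integral_return) (use s \<theta> in \<open>auto intro: astar_in\<close>)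
    qed
    also have "\<dots> = bellman \<theta> g (\<omega> t)"
      using c.nn_integral_state_kernel_Suc[OF r, of "\<lambda>s. g (s, astar \<theta> s)"] \<theta> by (simp add: bellman_def)
    finally show "(\<integral>\<^sup>+s. \<integral>\<^sup>+a. g (s, a) \<partial>?\<pi> (Suc t) (restrict \<omega> {0..<Suc t}, s)
      \<partial>c.state_kernel (Suc t) (restrict \<omega> {0..<Suc t})) = bellman \<theta> g (\<omega> t)" .
  qed
  finally show ?thesis .
qed

lemma nn_integral_frozen_iterate:
  assumes \<theta>: "\<theta> \<in> space (params D)" and x: "x \<in> space (state_actions D)"
    and g: "g \<in> borel_measurable (state_actions D)"
  shows "(\<integral>\<^sup>+\<omega>. g (\<omega> t) \<partial>frozen_law D ini \<theta> (select_policy D (astar \<theta>)) 1 (\<lambda>_. x)) = (bellman \<theta> ^^ t) g x"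
  using g
proof (induction t arbitrary: g)
  case 0
  interpret c: mdp_control D ini "select_policy D (astar \<theta>)" \<theta> by (rule control[OF \<theta>])
  show ?case using c.nn_integral_frozen_fixed[of 1 "\<lambda>_. x" 0 g] x 0 by simp
next
  case (Suc t)
  then show ?case
    using Suc.IH[OF measurable_bellman[OF Suc.prems \<theta>]] nn_integral_frozen_next[OF \<theta> x Suc.prems]
    by (simp add: funpow_swap1)
qed

text \<open>Rewards are shifted by their bound, which turns the value function into a series of nonnegative terms.\<close>

definition shifted_reward :: "'s \<times> 'a \<Rightarrow> ennreal" where
  "shifted_reward x = ennreal (reward D (fst x) (snd x) + C\<^sub>4)"

definition Qs :: "'p \<Rightarrow> 's \<times> 'a \<Rightarrow> ennreal" where
  "Qs \<theta> x = (\<Sum>t. ennreal (\<gamma> ^ t) * (bellman \<theta> ^^ t) shifted_reward x)"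

lemma measurable_shifted_reward [measurable]: "shifted_reward \<in> borel_measurable (state_actions D)"
  unfolding shifted_reward_def[abs_def] by measurable

lemma measurable_Qs: "\<theta> \<in> space (params D) \<Longrightarrow> Qs \<theta> \<in> borel_measurable (state_actions D)"
  unfolding Qs_def[abs_def]
  by (intro borel_measurable_suminf_order borel_measurable_times_ennreal borel_measurable_const
      measurable_bellman_funpow measurable_shifted_reward)

text \<open>Split off the term at time 0; monotone convergence moves the operator through the
  remaining series.\<close>

lemma Qs_bellman:
  assumes \<theta>: "\<theta> \<in> space (params D)" and x: "x \<in> space (state_actions D)"
  shows "Qs \<theta> x = shifted_reward x + ennreal \<gamma> * bellman \<theta> (Qs \<theta>) x"
proof -
  let ?g = "\<lambda>t. (bellman \<theta> ^^ t) shifted_reward"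
  note [measurable] = measurable_bellman_funpow[OF measurable_shifted_reward \<theta>]
  have x': "fst x \<in> space (states D)" "snd x \<in> space (actions D)"
    using x by (auto simp: space_state_actions mem_Times_iff)
  have td[measurable]: "(\<lambda>s. ennreal (tdens D \<theta> (fst x) (snd x) s)) \<in> borel_measurable (states D)"
    using x' \<theta> by measurable
  have gm[measurable]: "(\<lambda>s. ?g t (s, astar \<theta> s)) \<in> borel_measurable (states D)" for t
    using \<theta> by measurable
  have "ennreal \<gamma> * bellman \<theta> (Qs \<theta>) x =
    ennreal \<gamma> * (\<integral>\<^sup>+s. (\<Sum>t. ennreal (\<gamma> ^ t) * (ennreal (tdens D \<theta> (fst x) (snd x) s) * ?g t (s, astar \<theta> s))) \<partial>states D)"
    unfolding bellman_def Qs_def by (simp add: ennreal_suminf_cmult[symmetric] mult_ac)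
  also have "\<dots> = ennreal \<gamma> * (\<Sum>t. ennreal (\<gamma> ^ t) * bellman \<theta> (?g t) x)"
    by (subst nn_integral_suminf) (auto simp: nn_integral_cmult bellman_def)
  also have "\<dots> = (\<Sum>t. ennreal (\<gamma> ^ Suc t) * ?g (Suc t) x)"
    using \<gamma> by (simp add: ennreal_suminf_cmult[symmetric] mult.assoc[symmetric] ennreal_mult'[symmetric])
  finally have "ennreal \<gamma> * bellman \<theta> (Qs \<theta>) x = (\<Sum>t. ennreal (\<gamma> ^ Suc t) * ?g (Suc t) x)" .
  then show ?thesis
    unfolding Qs_def by (subst suminf_offset[where i=1]) (auto simp: add.commute)
qed

text \<open>The shift adds \<gamma>^t \<open>C\<^sub>4\<close> at time t, in total
  \<open>C\<^sub>4 / (1 - \<gamma>)\<close>. Shifted rewards lie between 0 and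
  \<open>2 * C\<^sub>4\<close>, which gives both bounds and the integrability behind the exchange of
  sum and integral.\<close>

lemma Qs_eq:
  assumes \<theta>: "\<theta> \<in> space (params D)" and x: "(s, a) \<in> space (state_actions D)"
  shows "Qs \<theta> (s, a) = ennreal (Q_value D \<gamma> ini \<theta> (select_policy D (astar \<theta>)) s a + C\<^sub>4 / (1 - \<gamma>))"
    and "0 \<le> Q_value D \<gamma> ini \<theta> (select_policy D (astar \<theta>)) s a + C\<^sub>4 / (1 - \<gamma>)"
    and "Q_value D \<gamma> ini \<theta> (select_policy D (astar \<theta>)) s a + C\<^sub>4 / (1 - \<gamma>) \<le> 2 * C\<^sub>4 / (1 - \<gamma>)"
proof -
  let ?\<pi> = "select_policy D (astar \<theta>)"
  let ?W = "frozen_law D ini \<theta> ?\<pi> 1 (\<lambda>_. (s, a))"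
  note One_nat_def [simp del]
  let ?r = "\<lambda>\<omega> t. reward D (fst (\<omega> t)) (snd (\<omega> t))"
  interpret c: mdp_control D ini ?\<pi> \<theta> by (rule control[OF \<theta>])
  have h: "\<And>i. i < 1 \<Longrightarrow> (\<lambda>_. (s, a)) i \<in> space (state_actions D)" using x by simp
  interpret W: prob_space ?W by (rule c.prob_space_frozen_law[OF h])
  have [measurable_cong]: "sets ?W = sets (PiM UNIV (\<lambda>_. state_actions D))" by (rule c.sets_frozen_law[OF h])
  have spW: "space ?W = space (PiM UNIV (\<lambda>_. state_actions D))" by (rule c.space_frozen_law[OF h])
  have bnd: "\<bar>?r \<omega> t\<bar> \<le> C\<^sub>4" if "\<omega> \<in> space ?W" for \<omega> t
  proof -
    have "\<omega> \<in> space (PiM UNIV (\<lambda>_. state_actions D))" using that unfolding spW .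
    then have "\<omega> t \<in> space (state_actions D)" by (simp add: space_PiM PiE_iff)
    then show ?thesis by (intro reward) (simp_all add: space_state_actions mem_Times_iff)
  qed
  have geo: "(\<lambda>t. C\<^sub>4 * \<gamma> ^ t) sums (C\<^sub>4 * (1 / (1 - \<gamma>)))" using \<gamma> by (intro sums_mult geometric_sums) simp
  have sm: "summable (\<lambda>t. \<gamma> ^ t * ?r \<omega> t)" if \<omega>: "\<omega> \<in> space ?W" for \<omega>
  proof (rule summable_comparison_test'[OF sums_summable[OF geo], of 0])
    fix t show "norm (\<gamma> ^ t * ?r \<omega> t) \<le> C\<^sub>4 * \<gamma> ^ t"
      using mult_right_mono[OF bnd[OF \<omega>, of t], of "\<gamma> ^ t"] \<gamma> by (simp add: abs_mult mult.commute)
  qed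
  have tr_sums: "(\<lambda>t. \<gamma> ^ t * (?r \<omega> t + C\<^sub>4)) sums (total_reward D \<gamma> \<omega> + C\<^sub>4 / (1 - \<gamma>))" if \<omega>: "\<omega> \<in> space ?W" for \<omega>
    using sums_add[OF summable_sums[OF sm[OF \<omega>]] geo] by (simp add: total_reward_def algebra_simps)
  have tr0: "0 \<le> total_reward D \<gamma> \<omega> + C\<^sub>4 / (1 - \<gamma>)" if \<omega>: "\<omega> \<in> space ?W" for \<omega>
  proof (rule sums_le[OF _ sums_zero tr_sums[OF \<omega>]])
    fix t show "0 \<le> \<gamma> ^ t * (?r \<omega> t + C\<^sub>4)" using bnd[OF \<omega>, of t] \<gamma> by (intro mult_nonneg_nonneg) auto
  qed
  have tr2: "total_reward D \<gamma> \<omega> + C\<^sub>4 / (1 - \<gamma>) \<le> 2 * C\<^sub>4 / (1 - \<gamma>)" if \<omega>: "\<omega> \<in> space ?W" for \<omega>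
  proof -
    have "(\<lambda>t. 2 * (C\<^sub>4 * \<gamma> ^ t)) sums (2 * (C\<^sub>4 * (1 / (1 - \<gamma>))))" by (rule sums_mult[OF geo])
    from sums_le[OF _ tr_sums[OF \<omega>] this] show ?thesis
    proof -
      assume *: "(\<And>t. \<gamma> ^ t * (?r \<omega> t + C\<^sub>4) \<le> 2 * (C\<^sub>4 * \<gamma> ^ t)) \<Longrightarrow>
        total_reward D \<gamma> \<omega> + C\<^sub>4 / (1 - \<gamma>) \<le> 2 * (C\<^sub>4 * (1 / (1 - \<gamma>)))"
      have "\<gamma> ^ t * (?r \<omega> t + C\<^sub>4) \<le> \<gamma> ^ t * (2 * C\<^sub>4)" for t
        using bnd[OF \<omega>, of t] \<gamma> by (intro mult_left_mono) (auto simp: abs_le_iff)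
      then show ?thesis using * by (simp add: mult_ac)
    qed
  qed
  have trm[measurable]: "total_reward D \<gamma> \<in> borel_measurable ?W"
    unfolding total_reward_def[abs_def] by measurable
  have int: "integrable ?W (\<lambda>\<omega>. total_reward D \<gamma> \<omega> + C\<^sub>4 / (1 - \<gamma>))"
  proof (rule W.integrable_const_bound[where B="2 * C\<^sub>4 / (1 - \<gamma>)"])
    show "AE \<omega> in ?W. norm (total_reward D \<gamma> \<omega> + C\<^sub>4 / (1 - \<gamma>)) \<le> 2 * C\<^sub>4 / (1 - \<gamma>)"
      using tr0 tr2 by (intro AE_I2) simp
  qed measurable
  have "integrable ?W (\<lambda>\<omega>. (total_reward D \<gamma> \<omega> + C\<^sub>4 / (1 - \<gamma>)) - C\<^sub>4 / (1 - \<gamma>))"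
    by (intro Bochner_Integration.integrable_diff int W.integrable_const)
  then have int': "integrable ?W (total_reward D \<gamma>)" by simp
  have QI: "Q_value D \<gamma> ini \<theta> ?\<pi> s a + C\<^sub>4 / (1 - \<gamma>) = (\<integral>\<omega>. total_reward D \<gamma> \<omega> + C\<^sub>4 / (1 - \<gamma>) \<partial>?W)"
    using int' by (simp add: Q_value_def W.prob_space)
  have "ennreal (Q_value D \<gamma> ini \<theta> ?\<pi> s a + C\<^sub>4 / (1 - \<gamma>)) = (\<integral>\<^sup>+\<omega>. ennreal (total_reward D \<gamma> \<omega> + C\<^sub>4 / (1 - \<gamma>)) \<partial>?W)"
    unfolding QI using tr0 by (intro nn_integral_eq_integral[symmetric] int AE_I2)
  also have "\<dots> = (\<integral>\<^sup>+\<omega>. (\<Sum>t. ennreal (\<gamma> ^ t) * shifted_reward (\<omega> t)) \<partial>?W)"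
  proof (rule nn_integral_cong)
    fix \<omega> assume \<omega>: "\<omega> \<in> space ?W"
    have "(\<Sum>t. ennreal (\<gamma> ^ t * (?r \<omega> t + C\<^sub>4))) = ennreal (total_reward D \<gamma> \<omega> + C\<^sub>4 / (1 - \<gamma>))"
    proof (rule suminf_ennreal_eq[OF _ tr_sums[OF \<omega>]])
      fix t show "0 \<le> \<gamma> ^ t * (?r \<omega> t + C\<^sub>4)" using bnd[OF \<omega>, of t] \<gamma> by (intro mult_nonneg_nonneg) auto
    qed
    then show "ennreal (total_reward D \<gamma> \<omega> + C\<^sub>4 / (1 - \<gamma>)) = (\<Sum>t. ennreal (\<gamma> ^ t) * shifted_reward (\<omega> t))"
      using \<gamma> by (simp add: shifted_reward_def ennreal_mult')
  qed
  also have "\<dots> = (\<Sum>t. ennreal (\<gamma> ^ t) * (\<integral>\<^sup>+\<omega>. shifted_reward (\<omega> t) \<partial>?W))"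
    by (subst nn_integral_suminf) (auto simp: nn_integral_cmult)
  also have "\<dots> = Qs \<theta> (s, a)"
    by (simp only: nn_integral_frozen_iterate[OF \<theta> x measurable_shifted_reward] Qs_def)
  finally show "Qs \<theta> (s, a) = ennreal (Q_value D \<gamma> ini \<theta> ?\<pi> s a + C\<^sub>4 / (1 - \<gamma>))" ..
  show "0 \<le> Q_value D \<gamma> ini \<theta> ?\<pi> s a + C\<^sub>4 / (1 - \<gamma>)"
    unfolding QI by (rule integral_nonneg_AE) (use tr0 in \<open>intro AE_I2\<close>)
  have "(\<integral>\<omega>. total_reward D \<gamma> \<omega> + C\<^sub>4 / (1 - \<gamma>) \<partial>?W) \<le> (\<integral>\<omega>. 2 * C\<^sub>4 / (1 - \<gamma>) \<partial>?W)"
    by (rule integral_mono[OF int]) (use tr2 in auto)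
  then show "Q_value D \<gamma> ini \<theta> ?\<pi> s a + C\<^sub>4 / (1 - \<gamma>) \<le> 2 * C\<^sub>4 / (1 - \<gamma>)"
    unfolding QI by (simp add: W.prob_space)
qed

end

section \<open>Perturbation of optimal action values\<close>

context mdp_optimal
begin

text \<open>The added constant changes neither maximisers nor gaps. It makes the values nonnegative,
  so that they agree with \<open>Qs\<close> and may be compared as real numbers.\<close>

definition Qr :: "'p \<Rightarrow> 's \<times> 'a \<Rightarrow> real" where
  "Qr \<theta> x = Q_value D \<gamma> ini \<theta> (select_policy D (astar \<theta>)) (fst x) (snd x) + C\<^sub>4 / (1 - \<gamma>)"

lemma
  assumes \<theta>: "\<theta> \<in> space (params D)" and x: "x \<in> space (state_actions D)"
  shows Qs_Qr: "Qs \<theta> x = ennreal (Qr \<theta> x)" and Qr_nonneg: "0 \<le> Qr \<theta> x"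
    and Qr_le: "Qr \<theta> x \<le> 2 * C\<^sub>4 / (1 - \<gamma>)"
  using Qs_eq[OF \<theta>, of "fst x" "snd x"] x by (auto simp: Qr_def)

lemma measurable_Qr:
  assumes \<theta>: "\<theta> \<in> space (params D)"
  shows "Qr \<theta> \<in> borel_measurable (state_actions D)"
proof -
  have "(\<lambda>x. enn2real (Qs \<theta> x)) \<in> borel_measurable (state_actions D)"
    using measurable_Qs[OF \<theta>] by measurable
  then show ?thesis
    by (rule measurable_cong[THEN iffD1, rotated]) (simp add: Qs_Qr[OF \<theta>] Qr_nonneg[OF \<theta>])
qed

lemma Qr_argmax:
  "\<theta> \<in> space (params D) \<Longrightarrow> s \<in> space (states D) \<Longrightarrow> a \<in> space (actions D) \<Longrightarrow> Qr \<theta> (s, a) \<le> Qr \<theta> (s, astar \<theta> s)"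
  using argmax by (simp add: Qr_def)

text \<open>A one-sided contraction estimate for the fixed point equations. Replacing the
  continuation value costs d, because maxima over actions are nonexpansive. Replacing the density
  costs h times the bound on the values times the mass of the state space. Both are discounted
  once.\<close>

lemma Qr_perturb_step:
  assumes \<theta>: "\<theta>\<^sub>1 \<in> space (params D)" "\<theta>\<^sub>2 \<in> space (params D)"
    and m: "emeasure (states D) (space (states D)) = ennreal m" "0 \<le> m"
    and h: "0 \<le> h" "\<And>s a s'. s \<in> space (states D) \<Longrightarrow> a \<in> space (actions D) \<Longrightarrow> s' \<in> space (states D) \<Longrightarrow>
      tdens D \<theta>\<^sub>1 s a s' \<le> tdens D \<theta>\<^sub>2 s a s' + h"
    and d: "0 \<le> d" "\<And>x. x \<in> space (state_actions D) \<Longrightarrow> Qr \<theta>\<^sub>1 x \<le> Qr \<theta>\<^sub>2 x + d"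
    and x: "x \<in> space (state_actions D)"
  shows "Qr \<theta>\<^sub>1 x \<le> Qr \<theta>\<^sub>2 x + \<gamma> * (h * (2 * C\<^sub>4 / (1 - \<gamma>)) * m + d)"
proof -
  let ?B = "2 * C\<^sub>4 / (1 - \<gamma>)"
  have B: "0 \<le> ?B" using C\<^sub>4 \<gamma> by simp
  have q: "0 \<le> \<gamma> * (h * ?B * m + d)"
    by (intro mult_nonneg_nonneg add_nonneg_nonneg h(1) B m(2) d(1) less_imp_le[OF \<gamma>(1)])
  have x': "fst x \<in> space (states D)" "snd x \<in> space (actions D)"
    using x by (auto simp: space_state_actions mem_Times_iff)
  let ?p = "\<lambda>\<theta> s. tdens D \<theta> (fst x) (snd x) s"
  let ?V = "\<lambda>\<theta> s. Qs \<theta> (s, astar \<theta> s)"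
  have [measurable]: "(\<lambda>s. ?p \<theta>\<^sub>1 s) \<in> borel_measurable (states D)" "(\<lambda>s. ?p \<theta>\<^sub>2 s) \<in> borel_measurable (states D)"
    using x' \<theta> by measurable
  have [measurable]: "?V \<theta>\<^sub>2 \<in> borel_measurable (states D)"
    using measurable_Qs[OF \<theta>(2)] \<theta>(2) by measurable
  have V: "?V \<theta>\<^sub>1 s \<le> ?V \<theta>\<^sub>2 s + ennreal d" if s: "s \<in> space (states D)" for s
  proof -
    have a: "astar \<theta>\<^sub>1 s \<in> space (actions D)" "astar \<theta>\<^sub>2 s \<in> space (actions D)" using \<theta> s by (auto intro: astar_in)
    then have sa: "(s, astar \<theta>\<^sub>1 s) \<in> space (state_actions D)" "(s, astar \<theta>\<^sub>2 s) \<in> space (state_actions D)"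
      using s by (auto simp: space_state_actions)
    \<comment> \<open>Compare at the action that is optimal for \<open>\<theta>\<^sub>1\<close>,
      then pass to the better one for \<open>\<theta>\<^sub>2\<close>.\<close>
    have "Qr \<theta>\<^sub>1 (s, astar \<theta>\<^sub>1 s) \<le> Qr \<theta>\<^sub>2 (s, astar \<theta>\<^sub>1 s) + d" by (rule d(2)[OF sa(1)])
    also have "\<dots> \<le> Qr \<theta>\<^sub>2 (s, astar \<theta>\<^sub>2 s) + d" using Qr_argmax[OF \<theta>(2) s a(1)] by simp
    finally show ?thesis
      using Qr_nonneg[OF \<theta>(2) sa(2)] d(1)
      by (simp add: Qs_Qr[OF \<theta>(1) sa(1)] Qs_Qr[OF \<theta>(2) sa(2)] ennreal_plus[symmetric] ennreal_leI del: ennreal_plus)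
  qed
  have V2: "?V \<theta>\<^sub>2 s \<le> ennreal ?B" if s: "s \<in> space (states D)" for s
  proof -
    have sa: "(s, astar \<theta>\<^sub>2 s) \<in> space (state_actions D)" using \<theta> s by (auto simp: space_state_actions intro: astar_in)
    show ?thesis unfolding Qs_Qr[OF \<theta>(2) sa] by (rule ennreal_leI[OF Qr_le[OF \<theta>(2) sa]])
  qed
  have "bellman \<theta>\<^sub>1 (Qs \<theta>\<^sub>1) x \<le> (\<integral>\<^sup>+s. (ennreal (?p \<theta>\<^sub>2 s) * ?V \<theta>\<^sub>2 s + ennreal (h * ?B)) + ennreal d * ennreal (?p \<theta>\<^sub>1 s) \<partial>states D)"
    unfolding bellman_def
  proof (rule nn_integral_mono)
    fix s assume s: "s \<in> space (states D)"
    have "ennreal (?p \<theta>\<^sub>1 s) * ?V \<theta>\<^sub>1 s \<le> ennreal (?p \<theta>\<^sub>1 s) * (?V \<theta>\<^sub>2 s + ennreal d)"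
      by (intro mult_left_mono V[OF s]) simp
    also have "\<dots> = ennreal (?p \<theta>\<^sub>1 s) * ?V \<theta>\<^sub>2 s + ennreal d * ennreal (?p \<theta>\<^sub>1 s)"
      by (simp add: distrib_left mult.commute)
    \<comment> \<open>The density is exchanged only in the term with the value of
      \<open>\<theta>\<^sub>2\<close>. The error d stays with the density of
      \<open>\<theta>\<^sub>1\<close>, whose mass is one, so it is not enlarged.\<close>
    also have "ennreal (?p \<theta>\<^sub>1 s) * ?V \<theta>\<^sub>2 s \<le> (ennreal (?p \<theta>\<^sub>2 s) + ennreal h) * ?V \<theta>\<^sub>2 s"
    proof (intro mult_right_mono)
      have "ennreal (?p \<theta>\<^sub>1 s) \<le> ennreal (?p \<theta>\<^sub>2 s + h)" by (rule ennreal_leI[OF h(2)[OF x' s]])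
      also have "\<dots> = ennreal (?p \<theta>\<^sub>2 s) + ennreal h"
        by (rule ennreal_plus[OF tdens_nonneg[OF \<theta>(2) x' s] h(1)])
      finally show "ennreal (?p \<theta>\<^sub>1 s) \<le> ennreal (?p \<theta>\<^sub>2 s) + ennreal h" .
    qed simp
    also have "\<dots> \<le> ennreal (?p \<theta>\<^sub>2 s) * ?V \<theta>\<^sub>2 s + ennreal (h * ?B)"
      unfolding distrib_right ennreal_mult'[OF h(1)] by (intro add_left_mono mult_left_mono V2[OF s]) simp
    finally show "ennreal (?p \<theta>\<^sub>1 s) * ?V \<theta>\<^sub>1 s \<le> (ennreal (?p \<theta>\<^sub>2 s) * ?V \<theta>\<^sub>2 s + ennreal (h * ?B)) + ennreal d * ennreal (?p \<theta>\<^sub>1 s)"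
      by (simp add: add_right_mono)
  qed
  also have "\<dots> = bellman \<theta>\<^sub>2 (Qs \<theta>\<^sub>2) x + ennreal (h * ?B * m + d)"
  proof -
    have "(\<integral>\<^sup>+s. (ennreal (?p \<theta>\<^sub>2 s) * ?V \<theta>\<^sub>2 s + ennreal (h * ?B)) + ennreal d * ennreal (?p \<theta>\<^sub>1 s) \<partial>states D) =
      (\<integral>\<^sup>+s. ennreal (?p \<theta>\<^sub>2 s) * ?V \<theta>\<^sub>2 s \<partial>states D) + (\<integral>\<^sup>+s. ennreal (h * ?B) \<partial>states D)
      + (\<integral>\<^sup>+s. ennreal d * ennreal (?p \<theta>\<^sub>1 s) \<partial>states D)"
      by (simp add: nn_integral_add)
    also have "(\<integral>\<^sup>+s. ennreal d * ennreal (?p \<theta>\<^sub>1 s) \<partial>states D) = ennreal d"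
      by (subst nn_integral_cmult) (simp_all add: nn_integral_tdens[OF \<theta>(1) x'])
    also have "(\<integral>\<^sup>+s. ennreal (h * ?B) \<partial>states D) = ennreal (h * ?B * m)"
      unfolding nn_integral_const m(1) by (rule ennreal_mult''[symmetric, OF m(2)])
    finally show ?thesis
      unfolding bellman_def ennreal_plus[OF mult_nonneg_nonneg[OF mult_nonneg_nonneg[OF h(1) B] m(2)] d(1)]
      by (simp only: add.assoc)
  qed
  finally have "Qs \<theta>\<^sub>1 x \<le> shifted_reward x + ennreal \<gamma> * (bellman \<theta>\<^sub>2 (Qs \<theta>\<^sub>2) x + ennreal (h * ?B * m + d))"
    unfolding Qs_bellman[OF \<theta>(1) x] by (intro add_left_mono mult_left_mono) simp_all
  also have "\<dots> = Qs \<theta>\<^sub>2 x + ennreal \<gamma> * ennreal (h * ?B * m + d)"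
    unfolding Qs_bellman[OF \<theta>(2) x] by (simp only: distrib_left add.assoc)
  also have "\<dots> = ennreal (Qr \<theta>\<^sub>2 x + \<gamma> * (h * ?B * m + d))"
    unfolding Qs_Qr[OF \<theta>(2) x] ennreal_plus[OF Qr_nonneg[OF \<theta>(2) x] q]
      ennreal_mult'[OF less_imp_le[OF \<gamma>(1)]] ..
  finally show ?thesis
    unfolding Qs_Qr[OF \<theta>(1) x]
    by (subst (asm) ennreal_le_iff) (intro add_nonneg_nonneg q Qr_nonneg[OF \<theta>(2) x])
qed

text \<open>The supremum d of the differences is finite since the values are bounded. The one-step
  estimate in both directions bounds d by \<gamma> times the density error plus \<gamma> d, and this
  is solved for d.\<close>

lemma Qr_perturb:
  assumes \<theta>: "\<theta>\<^sub>1 \<in> space (params D)" "\<theta>\<^sub>2 \<in> space (params D)"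
    and m: "emeasure (states D) (space (states D)) = ennreal m" "0 \<le> m"
    and h: "0 \<le> h" "\<And>s a s'. s \<in> space (states D) \<Longrightarrow> a \<in> space (actions D) \<Longrightarrow> s' \<in> space (states D) \<Longrightarrow>
      \<bar>tdens D \<theta>\<^sub>1 s a s' - tdens D \<theta>\<^sub>2 s a s'\<bar> \<le> h"
    and x: "x \<in> space (state_actions D)"
  shows "\<bar>Qr \<theta>\<^sub>1 x - Qr \<theta>\<^sub>2 x\<bar> \<le> \<gamma> * h * (2 * C\<^sub>4 / (1 - \<gamma>)) * m / (1 - \<gamma>)"
proof -
  let ?B = "2 * C\<^sub>4 / (1 - \<gamma>)"
  let ?f = "\<lambda>x. \<bar>Qr \<theta>\<^sub>1 x - Qr \<theta>\<^sub>2 x\<bar>"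
  define d where "d = (SUP x\<in>space (state_actions D). ?f x)"
  have bdd: "bdd_above (?f ` space (state_actions D))"
  proof (rule bdd_aboveI2)
    fix x assume x: "x \<in> space (state_actions D)"
    show "?f x \<le> ?B"
      using Qr_nonneg[OF \<theta>(1) x] Qr_nonneg[OF \<theta>(2) x] Qr_le[OF \<theta>(1) x] Qr_le[OF \<theta>(2) x] by linarith
  qed
  have le_d: "?f x \<le> d" if "x \<in> space (state_actions D)" for x
    unfolding d_def by (rule cSUP_upper[OF that bdd])
  have d0: "0 \<le> d" using le_d[OF x] by linarith
  have h12: "tdens D \<theta>\<^sub>1 s a s' \<le> tdens D \<theta>\<^sub>2 s a s' + h" "tdens D \<theta>\<^sub>2 s a s' \<le> tdens D \<theta>\<^sub>1 s a s' + h"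
    if "s \<in> space (states D)" "a \<in> space (actions D)" "s' \<in> space (states D)" for s a s'
    using h(2)[OF that] by linarith+
  have d12: "Qr \<theta>\<^sub>1 x \<le> Qr \<theta>\<^sub>2 x + d" "Qr \<theta>\<^sub>2 x \<le> Qr \<theta>\<^sub>1 x + d" if "x \<in> space (state_actions D)" for x
    using le_d[OF that] by linarith+
  have "d \<le> \<gamma> * (h * ?B * m + d)"
    unfolding d_def
  proof (rule cSUP_least)
    show "space (state_actions D) \<noteq> {}" using x by blast
    fix y assume y: "y \<in> space (state_actions D)"
    show "?f y \<le> \<gamma> * (h * ?B * m + (SUP x\<in>space (state_actions D). ?f x))"
      using Qr_perturb_step[OF \<theta> m h(1) h12(1) d0 d12(1) y] Qr_perturb_step[OF \<theta>(2,1) m h(1) h12(2) d0 d12(2) y]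
      unfolding d_def by linarith
  qed
  then have "d * (1 - \<gamma>) \<le> \<gamma> * h * ?B * m" by (simp add: algebra_simps)
  then have "d \<le> \<gamma> * h * ?B * m / (1 - \<gamma>)" using \<gamma> by (simp add: pos_le_divide_eq)
  then show ?thesis using le_d[OF x] by linarith
qed

text \<open>If the two optimal actions differed, the difference of their values would change by at
  least b between \<theta> and \<open>\<theta>\<^sub>0\<close>, whereas each value moves by less
  than b / 2.\<close>

lemma astar_stable:
  assumes \<theta>: "\<theta> \<in> space (params D)" "\<theta>\<^sub>0 \<in> space (params D)"
    and gap: "\<And>a. a \<in> space (actions D) \<Longrightarrow> a \<noteq> astar \<theta>\<^sub>0 s \<Longrightarrow> Qr \<theta>\<^sub>0 (s, a) + b \<le> Qr \<theta>\<^sub>0 (s, astar \<theta>\<^sub>0 s)"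
    and s: "s \<in> space (states D)"
    and m: "emeasure (states D) (space (states D)) = ennreal m" "0 \<le> m"
    and h: "0 \<le> h" "\<And>s a s'. s \<in> space (states D) \<Longrightarrow> a \<in> space (actions D) \<Longrightarrow> s' \<in> space (states D) \<Longrightarrow>
      \<bar>tdens D \<theta> s a s' - tdens D \<theta>\<^sub>0 s a s'\<bar> \<le> h"
    and small: "2 * (\<gamma> * h * (2 * C\<^sub>4 / (1 - \<gamma>)) * m / (1 - \<gamma>)) < b"
  shows "astar \<theta> s = astar \<theta>\<^sub>0 s"
proof (rule ccontr)
  assume ne: "astar \<theta> s \<noteq> astar \<theta>\<^sub>0 s"
  have a: "astar \<theta> s \<in> space (actions D)" "astar \<theta>\<^sub>0 s \<in> space (actions D)"
    using \<theta> s by (auto intro: astar_in)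
  then have sa: "(s, astar \<theta> s) \<in> space (state_actions D)" "(s, astar \<theta>\<^sub>0 s) \<in> space (state_actions D)"
    using s by (auto simp: space_state_actions)
  show False
    using gap[OF a(1) ne] Qr_argmax[OF \<theta>(1) s a(2)] small
      Qr_perturb[OF \<theta> m h sa(1)] Qr_perturb[OF \<theta> m h sa(2)] by linarith
qed

end

section \<open>An exponential moment for the number of wrong actions\<close>

context mdp
begin

text \<open>Histories before time t are functions of the first t coordinates. The induction for the
  exponential moment needs its weight to be measurable on those coordinates alone.\<close>

lemma measurable_hist_at_PiM:
  assumes "i < t"
  shows "hist_at i \<in> PiM {0..<t} (\<lambda>_. state_actions D) \<rightarrow>\<^sub>M hist_space D i"
  unfolding hist_at_def[abs_def] hist_space_def using assms
  by (intro measurable_Pair measurable_restrict_subset measurable_state_of measurable_component_singleton) auto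

end

context mdp_control
begin

text \<open>Given the history, the indicator multiplied by c has exponential moment at most 1 + (exp
  c - 1) p, which is at most exp ((exp c - 1) p). So one more step, corrected by its own p, does not
  increase the expectation.\<close>

lemma exponential_supermartingale:
  fixes Y :: "'s \<Rightarrow> 'a \<Rightarrow> bool" and p :: "nat \<Rightarrow> ('s, 'a) hist \<Rightarrow> real"
  assumes Y: "Measurable.pred (state_actions D) (\<lambda>x. Y (fst x) (snd x))"
    and p[measurable]: "\<And>t. p t \<in> borel_measurable (hist_space D t)"
    and p0: "\<And>t H. H \<in> space (hist_space D t) \<Longrightarrow> 0 \<le> p t H"
    and Yp: "\<And>t H. H \<in> space (hist_space D t) \<Longrightarrow>
      emeasure (\<pi> t H) {a \<in> space (actions D). Y (snd H) a} \<le> ennreal (p t H)"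
    and c: "0 \<le> (c::real)"
  shows "(\<integral>\<^sup>+\<omega>. ennreal (exp (c * (\<Sum>t<T. of_bool (Y (fst (\<omega> t)) (snd (\<omega> t))))
      - (exp c - 1) * (\<Sum>t<T. p t (hist_at t \<omega>)))) \<partial>process_law D ini \<theta> \<pi>) \<le> 1"
proof (induction T)
  case 0
  interpret prob_space "process_law D ini \<theta> \<pi>" by (rule prob_space_process_law)
  show ?case by (simp add: emeasure_space_1)
next
  case (Suc T)
  define g where "g = exp c - 1"
  have g0: "0 \<le> g" using c by (simp add: g_def)
  have exp_c: "ennreal (exp c) = 1 + ennreal g"
    using ennreal_plus[of 1 g] g0 by (simp add: g_def)
  let ?G = "\<lambda>\<omega>. exp (c * (\<Sum>t<T. of_bool (Y (fst (\<omega> t)) (snd (\<omega> t)))) - g * (\<Sum>t<T. p t (hist_at t \<omega>)))"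
  let ?F = "\<lambda>H a. ennreal (?G (fst H)) * ennreal (exp (c * of_bool (Y (snd H) a) - g * p T H))"
  have Ym[measurable (raw)]: "Measurable.pred N (\<lambda>x. Y (f x) (h x))"
    if "f \<in> N \<rightarrow>\<^sub>M states D" "h \<in> N \<rightarrow>\<^sub>M actions D" for f h and N :: "'z measure"
    using measurable_compose[OF measurable_state_action[OF that] Y] by simp
  have G: "?G \<in> borel_measurable (PiM {0..<T} (\<lambda>_. state_actions D))"
  proof -
    have [measurable]: "(\<lambda>\<omega>. \<omega> t) \<in> PiM {0..<T} (\<lambda>_. state_actions D) \<rightarrow>\<^sub>M state_actions D" if "t < T" for t
      using that by (intro measurable_component_singleton) simp
    have 1: "(\<lambda>\<omega>. of_bool (Y (fst (\<omega> t)) (snd (\<omega> t))) :: real) \<in> borel_measurable (PiM {0..<T} (\<lambda>_. state_actions D))" if "t < T" for t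
      using that Ym[of "\<lambda>\<omega>. fst (\<omega> t)" "PiM {0..<T} (\<lambda>_. state_actions D)" "\<lambda>\<omega>. snd (\<omega> t)"] by measurable
    have 2: "(\<lambda>\<omega>. p t (hist_at t \<omega>)) \<in> borel_measurable (PiM {0..<T} (\<lambda>_. state_actions D))" if "t < T" for t
      by (rule measurable_compose[OF measurable_hist_at_PiM[OF that] p])
    show ?thesis
      by (rule measurable_compose[OF _ borel_measurable_exp])
        (intro borel_measurable_diff borel_measurable_times borel_measurable_const borel_measurable_sum 1 2, auto)
  qed
  have GH: "(\<lambda>H. ?G (fst H)) \<in> borel_measurable (hist_space D T)"
    unfolding hist_space_def by (rule measurable_compose[OF measurable_fst G])
  have Y2: "Measurable.pred (hist_space D T \<Otimes>\<^sub>M actions D) (\<lambda>x. Y (snd (fst x)) (snd x))"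
    by (rule Ym) measurable
  have F: "(\<lambda>(H, a). ?F H a) \<in> borel_measurable (hist_space D T \<Otimes>\<^sub>M actions D)"
  proof -
    have [measurable]: "(\<lambda>x. ?G (fst (fst x))) \<in> borel_measurable (hist_space D T \<Otimes>\<^sub>M actions D)"
      by (rule measurable_compose[OF measurable_fst GH])
    show ?thesis unfolding case_prod_unfold using Y2 by measurable
  qed
  \<comment> \<open>The weight depends only on what precedes time T and can be read off the history,
    so it factors out of the integral over the next action.\<close>
  have Gr: "?G (fst (hist_at T \<omega>)) = ?G \<omega>" for \<omega>
  proof -
    have "hist_at t (fst (hist_at T \<omega>)) = hist_at t \<omega>" "fst (hist_at T \<omega>) t = \<omega> t" if "t < T" for t
      using that by (auto simp: hist_at_def restrict_def fun_eq_iff)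
    then show ?thesis by simp
  qed
  have "(\<integral>\<^sup>+\<omega>. ennreal (exp (c * (\<Sum>t<Suc T. of_bool (Y (fst (\<omega> t)) (snd (\<omega> t))))
      - g * (\<Sum>t<Suc T. p t (hist_at t \<omega>)))) \<partial>process_law D ini \<theta> \<pi>) =
    (\<integral>\<^sup>+\<omega>. ?F (hist_at T \<omega>) (snd (\<omega> T)) \<partial>process_law D ini \<theta> \<pi>)"
  proof (rule nn_integral_cong)
    fix \<omega> :: "nat \<Rightarrow> 's \<times> 'a"
    have "c * (\<Sum>t<Suc T. of_bool (Y (fst (\<omega> t)) (snd (\<omega> t)))) - g * (\<Sum>t<Suc T. p t (hist_at t \<omega>)) =
      (c * (\<Sum>t<T. of_bool (Y (fst (\<omega> t)) (snd (\<omega> t)))) - g * (\<Sum>t<T. p t (hist_at t \<omega>))) +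
      (c * of_bool (Y (fst (\<omega> T)) (snd (\<omega> T))) - g * p T (hist_at T \<omega>))"
      by (simp add: distrib_left)
    then show "ennreal (exp (c * (\<Sum>t<Suc T. of_bool (Y (fst (\<omega> t)) (snd (\<omega> t)))) - g * (\<Sum>t<Suc T. p t (hist_at t \<omega>)))) =
      ?F (hist_at T \<omega>) (snd (\<omega> T))"
      unfolding Gr by (simp only: exp_add ennreal_mult' exp_ge_zero) (simp add: hist_at_def)
  qed
  also have "\<dots> = (\<integral>\<^sup>+\<omega>. \<integral>\<^sup>+a. ?F (hist_at T \<omega>) a \<partial>\<pi> T (hist_at T \<omega>) \<partial>process_law D ini \<theta> \<pi>)"
    by (rule nn_integral_process_action[OF F])
  also have "\<dots> \<le> (\<integral>\<^sup>+\<omega>. ennreal (?G \<omega>) \<partial>process_law D ini \<theta> \<pi>)"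
  proof (rule nn_integral_mono)
    fix \<omega> assume "\<omega> \<in> space (process_law D ini \<theta> \<pi>)"
    then have H: "hist_at T \<omega> \<in> space (hist_space D T)" by (rule hist_at_in_space)
    define H where "H = hist_at T \<omega>"
    note H = H[folded H_def]
    note sp = policy_prob_space[OF H]
    interpret A: prob_space "\<pi> T H" by (rule sp(1))
    let ?X = "{a \<in> space (actions D). Y (snd H) a}"
    have X: "?X \<in> sets (\<pi> T H)"
    proof -
      have "Measurable.pred (actions D) (\<lambda>a. Y (snd H) a)"
        by (rule Ym) (use H in \<open>auto simp: space_hist_space\<close>)
      then show ?thesis unfolding sp(2) by measurable
    qed
    have "(\<integral>\<^sup>+a. ?F H a \<partial>\<pi> T H) = (\<integral>\<^sup>+a. ennreal (?G (fst H)) * ennreal (exp (- (g * p T H))) * (1 + ennreal g * indicator ?X a) \<partial>\<pi> T H)"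
    proof (rule nn_integral_cong)
      fix a assume "a \<in> space (\<pi> T H)"
      then have a: "a \<in> space (actions D)" by (simp add: sp)
      have "ennreal (exp (c * of_bool (Y (snd H) a) - g * p T H)) = ennreal (exp (- (g * p T H))) * ennreal (exp (c * of_bool (Y (snd H) a)))"
        by (simp add: ennreal_mult'[symmetric] exp_add[symmetric])
      also have "ennreal (exp (c * of_bool (Y (snd H) a))) = 1 + ennreal g * indicator ?X a"
        using a exp_c by (cases "Y (snd H) a") simp_all
      finally show "?F H a = ennreal (?G (fst H)) * ennreal (exp (- (g * p T H))) * (1 + ennreal g * indicator ?X a)"
        by (simp only: mult.assoc)
    qed
    also have "\<dots> = ennreal (?G (fst H)) * ennreal (exp (- (g * p T H))) * (1 + ennreal g * emeasure (\<pi> T H) ?X)"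
      using X by (simp add: nn_integral_cmult nn_integral_add A.emeasure_space_1)
    also have "\<dots> \<le> ennreal (?G (fst H)) * ennreal (exp (- (g * p T H))) * (1 + ennreal g * ennreal (p T H))"
      unfolding H_def using Yp[OF H, unfolded H_def] by (intro mult_left_mono add_left_mono) simp_all
    also have "\<dots> \<le> ennreal (?G (fst H)) * ennreal (exp (- (g * p T H))) * ennreal (exp (g * p T H))"
    proof (intro mult_left_mono)
      have "1 + ennreal g * ennreal (p T H) = ennreal (1 + g * p T H)"
        using g0 p0[OF H] by (simp add: ennreal_mult'[symmetric])
      also have "\<dots> \<le> ennreal (exp (g * p T H))" by (intro ennreal_leI exp_ge_add_one_self)
      finally show "1 + ennreal g * ennreal (p T H) \<le> ennreal (exp (g * p T H))" .
    qed simp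
    also have "\<dots> = ennreal (?G (fst H))"
      by (simp add: mult.assoc ennreal_mult'[symmetric] exp_add[symmetric])
    finally show "(\<integral>\<^sup>+a. ?F (hist_at T \<omega>) a \<partial>\<pi> T (hist_at T \<omega>)) \<le> ennreal (?G \<omega>)"
      unfolding H_def Gr .
  qed
  also have "\<dots> \<le> 1" using Suc.IH by (simp add: g_def)
  finally show ?case by (simp add: g_def)
qed

end

section \<open>Consequences of bounded densities, and the tail of the count\<close>

context mdp
begin

text \<open>Integrate the bound on the density over \<open>X\<close>, which has mass one under the
  point mass. The set is left general: it is applied to the whole action space and, once the gap has
  made singletons of optimal actions measurable, to these singletons.\<close>

lemma return_bounded_density:
  assumes a: "a \<in> space (actions D)" and ac: "absolutely_continuous (actions D) (return (actions D) a)"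
    and le: "AE x in actions D. RN_deriv (actions D) (return (actions D) a) x \<le> ennreal C"
    and X: "X \<in> sets (actions D)" "a \<in> X"
  shows "1 \<le> ennreal C * emeasure (actions D) X"
proof -
  let ?R = "RN_deriv (actions D) (return (actions D) a)"
  have "density (actions D) ?R = return (actions D) a"
    by (rule actions.density_RN_deriv[OF ac]) simp
  then have "emeasure (density (actions D) ?R) X = 1" using X a by simp
  then have "1 = (\<integral>\<^sup>+x. ?R x * indicator X x \<partial>actions D)"
    using X by (simp add: emeasure_density)
  also have "\<dots> \<le> (\<integral>\<^sup>+x. ennreal C * indicator X x \<partial>actions D)"
    by (rule nn_integral_mono_AE) (use le in \<open>auto split: split_indicator\<close>)
  also have "\<dots> = ennreal C * emeasure (actions D) X" using X by (simp add: nn_integral_cmult_indicator)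
  finally show ?thesis .
qed

lemma emeasure_space_state_actions:
  "emeasure (state_actions D) (space (state_actions D)) =
    emeasure (states D) (space (states D)) * emeasure (actions D) (space (actions D))"
  unfolding space_state_actions unfolding state_actions_def by (rule actions.emeasure_pair_measure_Times) auto

lemma hdist_sq_le_mass:
  assumes \<theta>: "\<theta> \<in> space (params D)" "\<theta>' \<in> space (params D)" and w: "w \<in> borel_measurable (state_actions D)"
  shows "hdist_sq D w \<theta> \<theta>' \<le> 2 * (\<integral>\<^sup>+x. ennreal (w x) \<partial>state_actions D)"
proof -
  have "hdist_sq D w \<theta> \<theta>' \<le> (\<integral>\<^sup>+x. 2 * ennreal (w x) \<partial>state_actions D)"
    unfolding hdist_sq_def case_prod_unfold
  proof (rule nn_integral_mono)
    fix x assume "x \<in> space (state_actions D)"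
    then have "fst x \<in> space (states D)" "snd x \<in> space (actions D)"
      by (auto simp: space_state_actions mem_Times_iff)
    from mult_right_mono[OF hellinger_sq_le_2[OF \<theta> this], of "ennreal (w x)"]
    show "hellinger_sq (states D) (tdens D \<theta> (fst x) (snd x)) (tdens D \<theta>' (fst x) (snd x)) * ennreal (w (fst x, snd x)) \<le> 2 * ennreal (w x)"
      by simp
  qed
  also have "\<dots> = 2 * (\<integral>\<^sup>+x. ennreal (w x) \<partial>state_actions D)"
    by (rule nn_integral_cmult) (use w in measurable)
  finally show ?thesis .
qed

text \<open>This keeps the evidence finite, so Bayes' formula can fail only where the evidence is
  zero.\<close>

lemma likelihood_le_power:
  assumes H: "H \<in> space (hist_space D t)" and \<theta>: "\<theta> \<in> space (params D)"
    and C: "\<And>s a s'. s \<in> space (states D) \<Longrightarrow> a \<in> space (actions D) \<Longrightarrow> s' \<in> space (states D) \<Longrightarrow> tdens D \<theta> s a s' \<le> C"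
  shows "likelihood D t H \<theta> \<le> C ^ t"
proof -
  have a: "snd (fst H i) \<in> space (actions D)" if "i < t" for i
    using H that by (auto simp: space_hist_space space_PiM PiE_iff space_state_actions mem_Times_iff)
  have "likelihood D t H \<theta> \<le> (\<Prod>i<t. C)"
    unfolding likelihood_def
    by (intro prod_mono conjI tdens_nonneg C hist_state_in_space[OF H] \<theta> a) simp_all
  then show ?thesis by simp
qed

end

context mdp_control
begin

lemma prob_space_cond_law:
  assumes "h \<in> space (PiM {0..<Suc i} (\<lambda>_. state_actions D))"
  shows "prob_space (cond_law D ini \<theta> \<pi> i h j)"
proof -
  have h: "h i' \<in> space (state_actions D)" if "i' < Suc i" for i'
    using assms that by (auto simp: space_PiM PiE_iff)
  show ?thesis
    unfolding cond_law_def
    by (rule prob_space.prob_space_distr[OF prob_space_frozen_law[OF h]])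
      (simp_all add: measurable_cong_sets[OF sets_frozen_law[OF h]])
qed

lemma nn_integral_RN_cond_law:
  assumes h: "h \<in> space (PiM {0..<Suc i} (\<lambda>_. state_actions D))"
    and ac: "absolutely_continuous (state_actions D) (cond_law D ini \<theta> \<pi> i h j)"
  shows "(\<integral>\<^sup>+x. RN_deriv (state_actions D) (cond_law D ini \<theta> \<pi> i h j) x \<partial>state_actions D) = 1"
proof -
  let ?L = "cond_law D ini \<theta> \<pi> i h j"
  have s: "sets ?L = sets (state_actions D)" by (simp add: cond_law_def)
  have "density (state_actions D) (RN_deriv (state_actions D) ?L) = ?L"
    by (rule state_actions.density_RN_deriv[OF ac s])
  then have "emeasure (density (state_actions D) (RN_deriv (state_actions D) ?L)) (space (state_actions D)) = 1"
    using prob_space.emeasure_space_1[OF prob_space_cond_law[OF h, of j]] sets_eq_imp_space_eq[OF s] by simp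
  then show ?thesis by (simp add: emeasure_density cong: nn_integral_cong)
qed

text \<open>Markov's inequality is used twice, each time with probability \<eta> / 2: for the
  exponential moment and for \<open>Z\<close>. Off both exceptional events c N is below (exp c - 1)
  (r F + K + 2 S / \<eta>) + ln (2 / \<eta>), and the relation between c and r reduces the
  coefficient of F to c. Everything else is independent of T.\<close>

lemma counting_tail:
  fixes Y :: "'s \<Rightarrow> 'a \<Rightarrow> bool" and p :: "nat \<Rightarrow> ('s, 'a) hist \<Rightarrow> real"
  assumes Y: "Measurable.pred (state_actions D) (\<lambda>x. Y (fst x) (snd x))"
    and p: "\<And>t. p t \<in> borel_measurable (hist_space D t)"
    and p0: "\<And>t H. H \<in> space (hist_space D t) \<Longrightarrow> 0 \<le> p t H"
    and Yp: "\<And>t H. H \<in> space (hist_space D t) \<Longrightarrow>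
      emeasure (\<pi> t H) {a \<in> space (actions D). Y (snd H) a} \<le> ennreal (p t H)"
    and c: "0 < c" "(exp c - 1) * r \<le> c" and \<eta>: "0 < \<eta>"
    and Z: "Z \<in> borel_measurable (process_law D ini \<theta> \<pi>)" "(\<integral>\<^sup>+\<omega>. Z \<omega> \<partial>process_law D ini \<theta> \<pi>) \<le> ennreal S" "0 < S"
    and sum_p: "\<And>\<omega>. \<omega> \<in> space (process_law D ini \<theta> \<pi>) \<Longrightarrow>
      ennreal (\<Sum>t<T. p t (hist_at t \<omega>)) \<le> ennreal (r * F + K) + Z \<omega>"
    and F: "0 \<le> F" "0 \<le> r" "0 \<le> K"
  defines "N \<equiv> \<lambda>\<omega>. \<Sum>t<T. of_bool (Y (fst (\<omega> t)) (snd (\<omega> t))) :: real"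
  shows "N \<in> borel_measurable (process_law D ini \<theta> \<pi>)"
    and "measure (process_law D ini \<theta> \<pi>) {\<omega> \<in> space (process_law D ini \<theta> \<pi>).
      N \<omega> \<le> F + ((exp c - 1) * (K + 2 * S / \<eta>) + ln (2 / \<eta>)) / c} \<ge> 1 - \<eta>"
proof -
  let ?W = "process_law D ini \<theta> \<pi>"
  let ?B = "((exp c - 1) * (K + 2 * S / \<eta>) + ln (2 / \<eta>)) / c"
  interpret W: prob_space ?W by (rule prob_space_process_law)
  have Yt: "(\<lambda>\<omega>. of_bool (Y (fst (\<omega> t)) (snd (\<omega> t))) :: real) \<in> borel_measurable ?W" for t
  proof -
    have "(\<lambda>\<omega>. \<omega> t) \<in> PiM UNIV (\<lambda>_. state_actions D) \<rightarrow>\<^sub>M state_actions D" by simp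
    from measurable_compose[OF this Y] have "Measurable.pred ?W (\<lambda>\<omega>. Y (fst (\<omega> t)) (snd (\<omega> t)))"
      unfolding measurable_process_law .
    then show ?thesis by measurable
  qed
  show Nm: "N \<in> borel_measurable ?W" unfolding N_def by (intro borel_measurable_sum Yt)
  have pm: "(\<lambda>\<omega>. p t (hist_at t \<omega>)) \<in> borel_measurable ?W" for t
    unfolding measurable_process_law by (rule measurable_compose[OF measurable_hist_at p])
  define G where "G \<omega> = exp (c * N \<omega> - (exp c - 1) * (\<Sum>t<T. p t (hist_at t \<omega>)))" for \<omega>
  have Gm: "G \<in> borel_measurable ?W"
    unfolding G_def[abs_def] using Nm pm by measurable
  have G1: "(\<integral>\<^sup>+\<omega>. ennreal (G \<omega>) \<partial>?W) \<le> 1"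
    unfolding G_def N_def by (rule exponential_supermartingale[OF Y p p0 Yp]) (use c in auto)
  let ?good = "{\<omega> \<in> space ?W. N \<omega> \<le> F + ?B}"
  let ?b1 = "{\<omega> \<in> space ?W. 1 \<le> ennreal (\<eta> / 2) * ennreal (G \<omega>)}"
  let ?b2 = "{\<omega> \<in> space ?W. 1 \<le> ennreal (\<eta> / (2 * S)) * Z \<omega>}"
  have good_m: "?good \<in> sets ?W" using Nm by measurable
  have b_m: "?b1 \<in> sets ?W" "?b2 \<in> sets ?W" using Gm Z(1) by measurable
  have sub: "space ?W - ?good \<subseteq> ?b1 \<union> ?b2"
  proof (rule subsetI, rule ccontr)
    fix \<omega> assume "\<omega> \<in> space ?W - ?good" and "\<omega> \<notin> ?b1 \<union> ?b2"
    then have \<omega>: "\<omega> \<in> space ?W" and ng: "\<not> N \<omega> \<le> F + ?B"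
      and n1: "ennreal (\<eta> / 2) * ennreal (G \<omega>) < 1" and n2: "ennreal (\<eta> / (2 * S)) * Z \<omega> < 1"
      by (simp_all add: not_le)
    let ?P = "\<Sum>t<T. p t (hist_at t \<omega>)"
    have "\<eta> / 2 * G \<omega> < 1"
      using n1 \<eta> by (simp add: ennreal_mult'[symmetric])
    then have "G \<omega> < 2 / \<eta>" using \<eta> by (simp add: field_simps)
    then have "ln (G \<omega>) < ln (2 / \<eta>)" using \<eta> by (intro ln_strict_mono) (auto simp: G_def)
    then have 1: "c * N \<omega> < (exp c - 1) * ?P + ln (2 / \<eta>)"
      by (simp add: G_def)
    \<comment> \<open>\<open>Z\<close> may be infinite at some trajectories; outside the second
      exceptional event it is not.\<close>
    have "Z \<omega> \<noteq> \<top>" using n2 \<eta> Z(3) by (auto simp: ennreal_mult_top)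
    then obtain z where z: "Z \<omega> = ennreal z" "0 \<le> z" by (cases "Z \<omega>") auto
    have "\<eta> / (2 * S) * z < 1" using n2 z \<eta> Z(3) by (simp add: ennreal_mult'[symmetric])
    then have z2: "z < 2 * S / \<eta>" using \<eta> Z(3) by (simp add: field_simps)
    have "ennreal ?P \<le> ennreal (r * F + K + z)"
      using sum_p[OF \<omega>] z F by (simp add: ennreal_plus[symmetric] del: ennreal_plus)
    then have "?P \<le> r * F + K + z"
      using F z by (subst (asm) ennreal_le_iff) auto
    then have "?P \<le> r * F + (K + 2 * S / \<eta>)" using z2 by linarith
    then have "(exp c - 1) * ?P \<le> (exp c - 1) * (r * F + (K + 2 * S / \<eta>))"
      using c by (intro mult_left_mono) auto
    also have "\<dots> = (exp c - 1) * r * F + (exp c - 1) * (K + 2 * S / \<eta>)"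
      by (simp only: distrib_left mult.assoc)
    \<comment> \<open>The place where the coefficient of \<open>F\<close> in the final bound becomes
      exactly one.\<close>
    also have "\<dots> \<le> c * F + (exp c - 1) * (K + 2 * S / \<eta>)"
      by (intro add_right_mono mult_right_mono c F)
    finally have "c * N \<omega> < c * F + ((exp c - 1) * (K + 2 * S / \<eta>) + ln (2 / \<eta>))" using 1 by linarith
    also have "c * F + x = c * (F + x / c)" for x using c by (simp add: field_simps)
    finally show False using c ng by simp
  qed
  have e1: "emeasure ?W ?b1 \<le> ennreal (\<eta> / 2)"
  proof -
    have "emeasure ?W ?b1 \<le> ennreal (\<eta> / 2) * (\<integral>\<^sup>+\<omega>. ennreal (G \<omega>) * indicator (space ?W) \<omega> \<partial>?W)"
      by (rule nn_integral_Markov_inequality) (use Gm in auto)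
    also have "(\<integral>\<^sup>+\<omega>. ennreal (G \<omega>) * indicator (space ?W) \<omega> \<partial>?W) = (\<integral>\<^sup>+\<omega>. ennreal (G \<omega>) \<partial>?W)"
      by (intro nn_integral_cong) simp
    also have "ennreal (\<eta> / 2) * \<dots> \<le> ennreal (\<eta> / 2) * 1" by (intro mult_left_mono G1) simp
    finally show ?thesis by simp
  qed
  have e2: "emeasure ?W ?b2 \<le> ennreal (\<eta> / 2)"
  proof -
    have "emeasure ?W ?b2 \<le> ennreal (\<eta> / (2 * S)) * (\<integral>\<^sup>+\<omega>. Z \<omega> * indicator (space ?W) \<omega> \<partial>?W)"
      by (rule nn_integral_Markov_inequality) (use Z(1) in auto)
    also have "(\<integral>\<^sup>+\<omega>. Z \<omega> * indicator (space ?W) \<omega> \<partial>?W) = (\<integral>\<^sup>+\<omega>. Z \<omega> \<partial>?W)"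
      by (intro nn_integral_cong) simp
    also have "ennreal (\<eta> / (2 * S)) * \<dots> \<le> ennreal (\<eta> / (2 * S)) * ennreal S" by (intro mult_left_mono Z(2)) simp
    also have "\<dots> = ennreal (\<eta> / 2)" using Z(3) \<eta> by (simp add: ennreal_mult'[symmetric])
    finally show ?thesis .
  qed
  have "emeasure ?W (space ?W - ?good) \<le> emeasure ?W (?b1 \<union> ?b2)"
    by (rule emeasure_mono[OF sub]) (intro sets.Un b_m)
  also have "\<dots> \<le> emeasure ?W ?b1 + emeasure ?W ?b2" by (rule emeasure_subadditive[OF b_m])
  also have "\<dots> \<le> ennreal (\<eta> / 2) + ennreal (\<eta> / 2)" by (intro add_mono e1 e2)
  also have "\<dots> = ennreal \<eta>" using \<eta> by (simp add: ennreal_plus[symmetric] del: ennreal_plus)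
  finally have "measure ?W (space ?W - ?good) \<le> \<eta>"
    using \<eta> by (simp add: W.emeasure_eq_measure)
  then show "measure ?W ?good \<ge> 1 - \<eta>"
    using W.prob_compl[OF good_m] by linarith
qed

end

section \<open>Contraction and the number of wrong actions\<close>

text \<open>For positive n this is the n-th power of x / n \<le> exp (x / n).\<close>

lemma exp_le_power:
  fixes x :: real
  assumes "0 \<le> x"
  shows "x ^ n \<le> real n ^ n * exp x"
proof (cases "n = 0")
  case False
  have "(x / real n) ^ n \<le> exp (x / real n) ^ n"
    by (intro power_mono order_trans[OF _ exp_ge_add_one_self]) (use assms in auto)
  also have "exp (x / real n) ^ n = exp x" using False by (simp add: exp_of_nat_mult[symmetric])
  finally show ?thesis using False by (simp add: power_divide field_simps)
qed (use assms in simp)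

text \<open>As c is at least 1, the exponential term is also O(c^(-n/2)). Inserting the lower bound
  for c gives a power of t whose exponent is below -1 exactly when n (1 - 2 \<beta>) exceeds
  2.\<close>

lemma contraction_rate:
  fixes c :: real
  assumes c: "t powr (1 - 2 * \<beta>) \<le> c" and t: "1 \<le> t" and \<beta>: "\<beta> < 1 / 2"
  shows "2 * c powr (- real n / 2) + 8 * exp (- c) \<le> (2 + 8 * real n ^ n) * t powr (- (real n * (1 - 2 * \<beta>) / 2))"
proof -
  have c1: "1 \<le> c" using order_trans[OF ge_one_powr_ge_zero c] t \<beta> by simp
  have "exp (- c) \<le> real n ^ n * c powr (- real n / 2)"
  proof -
    have "c powr (real n / 2) \<le> c powr real n" using c1 by (intro powr_mono) auto
    also have "\<dots> = c ^ n" using c1 by (simp add: powr_realpow)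
    also have "\<dots> \<le> real n ^ n * exp c" using c1 by (intro exp_le_power) simp
    finally have "c powr (real n / 2) \<le> real n ^ n * exp c" .
    moreover have "0 < c powr (real n / 2)" using c1 by simp
    ultimately show ?thesis by (simp add: exp_minus powr_minus field_simps)
  qed
  then have "2 * c powr (- real n / 2) + 8 * exp (- c) \<le> (2 + 8 * real n ^ n) * c powr (- real n / 2)"
    by (simp add: algebra_simps)
  also have "c powr (- real n / 2) \<le> (t powr (1 - 2 * \<beta>)) powr (- real n / 2)"
    using c t by (intro powr_mono2') auto
  also have "\<dots> = t powr (- (real n * (1 - 2 * \<beta>) / 2))"
    by (simp add: powr_powr field_simps)
  finally show ?thesis by (simp add: mult_left_mono)
qed


theorem theorem3p1:
  fixes D :: "('s, 'a, 'p) mdp_family"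
    and ini :: "'s measure" and \<theta>\<^sub>0 :: 'p and \<gamma> :: real
    and Pols :: "('s, 'a) policy set" and astar :: "'p \<Rightarrow> 's \<Rightarrow> 'a"
    and \<delta> :: "nat \<Rightarrow> real" and prior :: "nat \<Rightarrow> 'p measure" and \<pi> :: "('s, 'a) policy"
    and k l n :: nat and \<alpha> \<epsilon> :: "nat \<Rightarrow> real" and \<mu> \<nu> :: "'s \<times> 'a \<Rightarrow> real"
    and K \<xi> C\<^sub>1 C\<^sub>2 C\<^sub>3 C\<^sub>4 \<rho> \<beta> b :: real and f :: "nat \<Rightarrow> real"
  assumes mdp: "wf_mdp_family D"
    and ini: "prob_space ini" "sets ini = sets (states D)"
    and \<theta>\<^sub>0: "\<theta>\<^sub>0 \<in> space (params D)"
    and \<gamma>: "0 < \<gamma>" "\<gamma> \<le> 1"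
    and Pols: "\<And>\<pi>'. \<pi>' \<in> Pols \<Longrightarrow> is_policy D \<pi>' \<and> stationary_policy D \<pi>'"
    and astar_measurable:
      "(\<lambda>(\<theta>, s). astar \<theta> s) \<in> params D \<Otimes>\<^sub>M states D \<rightarrow>\<^sub>M actions D"
    and opt_in_Pols: "\<And>\<theta>. \<theta> \<in> space (params D) \<Longrightarrow> select_policy D (astar \<theta>) \<in> Pols"
    and opt_V: "\<And>\<theta> \<pi>'. \<theta> \<in> space (params D) \<Longrightarrow> \<pi>' \<in> Pols \<Longrightarrow>
      V_value D \<gamma> ini \<theta> \<pi>' \<le> V_value D \<gamma> ini \<theta> (select_policy D (astar \<theta>))"
    and opt_argmax: "\<And>\<theta> s a. \<theta> \<in> space (params D) \<Longrightarrow> s \<in> space (states D) \<Longrightarrow>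
      a \<in> space (actions D) \<Longrightarrow>
      Q_value D \<gamma> ini \<theta> (select_policy D (astar \<theta>)) s a
        \<le> Q_value D \<gamma> ini \<theta> (select_policy D (astar \<theta>)) s (astar \<theta> s)"
    and rates: "\<And>t. 0 \<le> \<delta> t"
    and priors: "\<And>t. prob_space (prior t)" "\<And>t. sets (prior t) = sets (params D)"
    and pi: "\<pi> = ts_policy D astar \<delta> prior"
    \<comment> \<open>(A)\<close>
    and A_consts: "0 < k" "0 < l" "\<And>i. 0 < \<alpha> i" "antimono \<alpha>"
      "\<mu> \<in> borel_measurable (state_actions D)" "\<nu> \<in> borel_measurable (state_actions D)"
      "\<And>x. x \<in> space (state_actions D) \<Longrightarrow> 0 \<le> \<mu> x"
      "\<And>x. x \<in> space (state_actions D) \<Longrightarrow> 0 \<le> \<nu> x"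
    and A_densities: "\<And>\<theta> i h j. \<theta> \<in> space (params D) \<Longrightarrow>
      h \<in> space (PiM {0..<Suc i} (\<lambda>_. state_actions D)) \<Longrightarrow> j \<in> {1..k} \<union> {l} \<Longrightarrow>
      absolutely_continuous (state_actions D) (cond_law D ini \<theta> \<pi> i h j)"
    and A_lower: "\<And>\<theta> i h. \<theta> \<in> space (params D) \<Longrightarrow>
      h \<in> space (PiM {0..<Suc i} (\<lambda>_. state_actions D)) \<Longrightarrow>
      AE x in state_actions D. ennreal (\<alpha> i * \<mu> x) \<le>
        (\<Sum>j=1..k. RN_deriv (state_actions D) (cond_law D ini \<theta> \<pi> i h j) x) / of_nat k"
    and A_upper: "\<And>\<theta> i h. \<theta> \<in> space (params D) \<Longrightarrow>
      h \<in> space (PiM {0..<Suc i} (\<lambda>_. state_actions D)) \<Longrightarrow>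
      AE x in state_actions D.
        RN_deriv (state_actions D) (cond_law D ini \<theta> \<pi> i h l) x \<le> ennreal (\<nu> x)"
    \<comment> \<open>(B)\<close>
    and B_testing: "testing_constants D \<theta>\<^sub>0 \<pi> k l \<alpha> \<mu> \<nu> K \<xi>"
    and B_n: "0 < n"
    and B_eps: "\<And>t. 0 < \<epsilon> t" "\<epsilon> \<longlonglongrightarrow> 0"
      "(\<lambda>t. 1 / (real t * (eps_bar k l \<alpha> \<epsilon> t)\<^sup>2)) \<in> O(\<lambda>_. 1)"
    and B_entropy: "\<And>t. k + l \<le> t \<Longrightarrow>
      (SUP e\<in>{\<epsilon> t<..}. log_enat (covering_number (space (params D))
          (ennreal (1 / 2 * sqrt (alpha_last k l \<alpha> t) * \<xi> * e))
          {\<theta> \<in> space (params D). hdist D \<mu> \<theta> \<theta>\<^sub>0 < ennreal e} (hdist D \<nu>)))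
        \<le> ereal (real t * (eps_bar k l \<alpha> \<epsilon> t)\<^sup>2)"
    and B_prior: "\<forall>\<^sub>F j in sequentially. \<forall>t\<ge>k + l.
      0 < measure (prior t) (KL_nbhd D ini \<pi> t \<theta>\<^sub>0 (eps_bar k l \<alpha> \<epsilon> t) n) \<and>
      measure (prior t) {\<theta> \<in> space (params D).
          ennreal (real j * \<epsilon> t) < hdist D \<mu> \<theta> \<theta>\<^sub>0 \<and>
          hdist D \<mu> \<theta> \<theta>\<^sub>0 \<le> ennreal ((real j + 1) * \<epsilon> t)}
        / measure (prior t) (KL_nbhd D ini \<pi> t \<theta>\<^sub>0 (eps_bar k l \<alpha> \<epsilon> t) n)
        \<le> exp (K * real t * (eps_bar k l \<alpha> \<epsilon> t)\<^sup>2 * (real j)\<^sup>2 / 2)"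
    \<comment> \<open>(C)\<close>
    and C_finite: "emeasure (state_actions D) (space (state_actions D)) < \<infinity>"
    and C_consts: "0 < C\<^sub>1" "0 < C\<^sub>2" "0 < C\<^sub>3" "0 < C\<^sub>4" "0 < \<rho>" "\<rho> \<le> 1"
      "\<gamma> * C\<^sub>1 * C\<^sub>2 * measure (state_actions D) (space (state_actions D)) < 1"
    and C_policy: "\<And>\<pi>' t H. \<pi>' \<in> Pols \<Longrightarrow> H \<in> space (hist_space D t) \<Longrightarrow>
      absolutely_continuous (actions D) (\<pi>' t H) \<and>
      (AE a in actions D. RN_deriv (actions D) (\<pi>' t H) a \<le> ennreal C\<^sub>1)"
    and C_trans: "\<And>\<theta> s a s'. \<theta> \<in> space (params D) \<Longrightarrow> s \<in> space (states D) \<Longrightarrow>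
      a \<in> space (actions D) \<Longrightarrow> s' \<in> space (states D) \<Longrightarrow> tdens D \<theta> s a s' \<le> C\<^sub>2"
    and C_holder: "\<And>\<theta> s a s'. \<theta> \<in> space (params D) \<Longrightarrow> s \<in> space (states D) \<Longrightarrow>
      a \<in> space (actions D) \<Longrightarrow> s' \<in> space (states D) \<Longrightarrow>
      \<bar>tdens D \<theta> s a s' - tdens D \<theta>\<^sub>0 s a s'\<bar> \<le> C\<^sub>3 * enn2real (hdist D \<mu> \<theta> \<theta>\<^sub>0) powr \<rho>"
    and C_reward: "\<And>s a. s \<in> space (states D) \<Longrightarrow> a \<in> space (actions D) \<Longrightarrow>
      \<bar>reward D s a\<bar> \<le> C\<^sub>4"
    \<comment> \<open>(i), (ii), (iii)\<close>
    and i_beta: "0 < \<beta>" "\<beta> < 1 / 2" "real n * (1 - 2 * \<beta>) > 2"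
    and i_rate: "\<And>t. k + l \<le> t \<Longrightarrow> eps_bar k l \<alpha> \<epsilon> t \<ge> real t powr (- \<beta>)"
    and ii_gap: "0 < b"
      "\<And>s a. s \<in> space (states D) \<Longrightarrow> a \<in> space (actions D) \<Longrightarrow> a \<noteq> astar \<theta>\<^sub>0 s \<Longrightarrow>
        Q_value D \<gamma> ini \<theta>\<^sub>0 (select_policy D (astar \<theta>\<^sub>0)) s (astar \<theta>\<^sub>0 s)
          \<ge> Q_value D \<gamma> ini \<theta>\<^sub>0 (select_policy D (astar \<theta>\<^sub>0)) s a + b"
    and iii: "mono f" "\<And>t. (\<Sum>i\<le>t. \<delta> i) \<le> f t" "filterlim f at_top sequentially"
  shows
    "(\<exists>B :: real \<Rightarrow> real. \<forall>\<eta>. 0 < \<eta> \<and> \<eta> < 1 \<longrightarrow> (\<exists>T\<^sub>0. \<forall>T\<ge>T\<^sub>0. \<forall>d>0.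
        measure (process_law D ini \<theta>\<^sub>0 \<pi>)
          {\<omega> \<in> space (process_law D ini \<theta>\<^sub>0 \<pi>).
             (\<Sum>t\<le>T. of_bool (snd (\<omega> t) \<noteq> astar \<theta>\<^sub>0 (fst (\<omega> t)))) \<le> f T powr (1 + d) + B \<eta>}
          \<ge> 1 - \<eta>)) \<and>
     (\<forall>\<^sub>F M in at_top. AE \<omega> in process_law D ini \<theta>\<^sub>0 \<pi>.
        (\<lambda>T. measure (posterior D (prior T) T (hist_at T \<omega>))
           {\<theta> \<in> space (params D). hdist D \<mu> \<theta> \<theta>\<^sub>0 > ennreal (M * \<epsilon> T)}) \<longlonglongrightarrow> 0)"
proof -
  let ?s = "space (states D)" and ?a = "space (actions D)" and ?p = "space (params D)"
  let ?eS = "emeasure (states D) ?s" and ?eA = "emeasure (actions D) ?a"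
  let ?sel = "\<lambda>\<theta>. select_policy D (astar \<theta>)"
  let ?SA = "state_actions D"
  interpret mdp D by (rule mdp.intro[OF mdp])

  have "?s \<noteq> {}" using prob_space.not_empty[OF ini(1)] sets_eq_imp_space_eq[OF ini(2)] by simp
  then obtain s\<^sub>0 where s\<^sub>0: "s\<^sub>0 \<in> ?s" by blast
  have astar_in: "astar \<theta> s \<in> ?a" if "\<theta> \<in> ?p" "s \<in> ?s" for \<theta> s
    using measurable_space[OF astar_measurable, of "(\<theta>, s)"] that by (simp add: space_pair_measure)
  \<comment> \<open>Condition (C) is applied to the optimal policy at the history that consists of
    the single state s. Its law there is a point mass.\<close>
  have bounded_return: "1 \<le> ennreal C\<^sub>1 * emeasure (actions D) X" if s: "s \<in> ?s" and X: "X \<in> sets (actions D)" "astar \<theta>\<^sub>0 s \<in> X" for s X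
  proof (rule return_bounded_density[OF astar_in[OF \<theta>\<^sub>0 s] _ _ X])
    have H: "(\<lambda>_. undefined, s) \<in> space (hist_space D 0)" using s by (simp add: space_hist_space)
    show "absolutely_continuous (actions D) (return (actions D) (astar \<theta>\<^sub>0 s))"
      "AE x in actions D. RN_deriv (actions D) (return (actions D) (astar \<theta>\<^sub>0 s)) x \<le> ennreal C\<^sub>1"
      using C_policy[OF opt_in_Pols[OF \<theta>\<^sub>0] H] by (simp_all add: select_policy_def)
  qed
  have eS1: "1 \<le> ennreal C\<^sub>2 * ?eS"
  proof -
    have "1 = (\<integral>\<^sup>+s'. ennreal (tdens D \<theta>\<^sub>0 s\<^sub>0 (astar \<theta>\<^sub>0 s\<^sub>0) s') \<partial>states D)"
      using nn_integral_tdens[OF \<theta>\<^sub>0 s\<^sub>0 astar_in[OF \<theta>\<^sub>0 s\<^sub>0]] by simp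
    also have "\<dots> \<le> (\<integral>\<^sup>+s'. ennreal C\<^sub>2 \<partial>states D)"
      by (intro nn_integral_mono ennreal_leI C_trans \<theta>\<^sub>0 s\<^sub>0 astar_in)
    finally show ?thesis by simp
  qed
  have eA1: "1 \<le> ennreal C\<^sub>1 * ?eA"
    by (rule bounded_return[OF s\<^sub>0 sets.top astar_in[OF \<theta>\<^sub>0 s\<^sub>0]])
  have prod: "emeasure ?SA (space ?SA) = ?eS * ?eA" by (rule emeasure_space_state_actions)
  have eS0: "?eS \<noteq> 0" and eA0: "?eA \<noteq> 0" using eS1 eA1 by auto
  \<comment> \<open>The product of the two masses is finite and neither is zero, so both are
    finite.\<close>
  have eS_fin: "?eS \<noteq> \<infinity>" and eA_fin: "?eA \<noteq> \<infinity>"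
    using C_finite eS0 eA0 unfolding prod by (auto simp: ennreal_mult_top ennreal_top_mult)
  define m where "m = measure (states D) ?s"
  have m: "?eS = ennreal m" "0 \<le> m" using eS_fin by (simp_all add: m_def emeasure_eq_ennreal_measure)
  define m' where "m' = measure (actions D) ?a"
  have m': "?eA = ennreal m'" "0 \<le> m'" using eA_fin by (simp_all add: m'_def emeasure_eq_ennreal_measure)
  \<comment> \<open>A probability density bounded by a constant needs a reference mass of at least
    its reciprocal. Applied to the transitions and to the optimal policy, this makes
    \<open>C\<^sub>1 * C\<^sub>2\<close> times the total mass at least one.\<close>
  have \<gamma>1: "\<gamma> < 1"
  proof -
    have "1 \<le> C\<^sub>2 * m" using eS1 C_consts(2) m by (simp add: ennreal_mult'[symmetric])
    moreover have "1 \<le> C\<^sub>1 * m'" using eA1 C_consts(1) m' by (simp add: ennreal_mult'[symmetric])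
    ultimately have "1 * 1 \<le> (C\<^sub>2 * m) * (C\<^sub>1 * m')" by (intro mult_mono) auto
    moreover have "measure ?SA (space ?SA) = m * m'"
      using prod m m' by (simp add: measure_def ennreal_mult'[symmetric])
    ultimately have "1 \<le> C\<^sub>1 * C\<^sub>2 * measure ?SA (space ?SA)" by (simp add: mult_ac)
    then have "\<gamma> * 1 \<le> \<gamma> * (C\<^sub>1 * C\<^sub>2 * measure ?SA (space ?SA))" using \<gamma>(1) by (intro mult_left_mono) auto
    then show ?thesis using C_consts(7) by (simp add: mult.assoc)
  qed

  interpret ts: thompson D astar \<delta> prior
    unfolding thompson_def thompson_axioms_def
    by (intro conjI mdp_axioms astar_measurable allI rates priors eA0 eA_fin)
  have policy: "is_policy D \<pi>" unfolding pi by (rule ts.is_policy_ts)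
  have fmc: "finite_mdp_control D ini \<pi> \<theta>\<^sub>0"
    unfolding finite_mdp_control_def finite_mdp_control_axioms_def mdp_control_def mdp_control_axioms_def
    by (intro conjI mdp_axioms ini policy \<theta>\<^sub>0 eS_fin)
  interpret c: finite_mdp_control D ini \<pi> \<theta>\<^sub>0 by (rule fmc)
  have pm: "posterior_model D ini \<pi> \<theta>\<^sub>0 (prior t)" for t
    unfolding posterior_model_def by (intro conjI fmc ts.mdp_prior)
  interpret o: mdp_optimal D ini \<gamma> astar C\<^sub>4
    unfolding mdp_optimal_def mdp_optimal_axioms_def
    using mdp_axioms ini \<gamma>(1) \<gamma>1 astar_measurable Pols[OF opt_in_Pols] opt_argmax C_consts(4) C_reward
    by (intro conjI allI impI) simp_all

  let ?Y = "\<lambda>s a. a \<noteq> astar \<theta>\<^sub>0 s"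
  have gap: "o.Qr \<theta>\<^sub>0 (s, a) + b \<le> o.Qr \<theta>\<^sub>0 (s, astar \<theta>\<^sub>0 s)" if "s \<in> ?s" "a \<in> ?a" "a \<noteq> astar \<theta>\<^sub>0 s" for s a
    using ii_gap(2)[OF that] by (simp add: o.Qr_def)
  \<comment> \<open>The gap rewrites "a is not optimal" as an inequality between measurable
    functions. This yields measurability of the wrong actions, and of the singletons of optimal
    ones, on an arbitrary action space.\<close>
  have Y_iff: "?Y (fst x) (snd x) \<longleftrightarrow> o.Qr \<theta>\<^sub>0 x + b \<le> o.Qr \<theta>\<^sub>0 (fst x, astar \<theta>\<^sub>0 (fst x))" if "x \<in> space ?SA" for x
  proof (cases x)
    case (Pair s a)
    then show ?thesis using gap[of s a] that ii_gap(1) by (cases "a = astar \<theta>\<^sub>0 s") (auto simp: space_state_actions)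
  qed
  have Ym: "Measurable.pred ?SA (\<lambda>x. ?Y (fst x) (snd x))"
  proof -
    note [measurable] = o.measurable_Qr[OF \<theta>\<^sub>0] \<theta>\<^sub>0
    have "Measurable.pred ?SA (\<lambda>x. o.Qr \<theta>\<^sub>0 x + b \<le> o.Qr \<theta>\<^sub>0 (fst x, astar \<theta>\<^sub>0 (fst x)))" by measurable
    then show ?thesis by (rule measurable_cong[THEN iffD2, rotated]) (rule Y_iff)
  qed
  have Ym_sec: "{a \<in> ?a. ?Y s a} \<in> sets (actions D)" if "s \<in> ?s" for s
  proof -
    have "(\<lambda>a. (s, a)) \<in> actions D \<rightarrow>\<^sub>M ?SA" using that by measurable
    from measurable_compose[OF this Ym] show ?thesis by (simp add: pred_def)
  qed
  have single: "{astar \<theta>\<^sub>0 s} \<in> sets (actions D)" if "s \<in> ?s" for s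
  proof -
    have "{astar \<theta>\<^sub>0 s} = ?a - {a \<in> ?a. ?Y s a}" using astar_in[OF \<theta>\<^sub>0 that] by auto
    then show ?thesis using Ym_sec[OF that] by simp
  qed
  obtain e where e: "0 < e" "e \<le> 1" and e_avoid: "\<And>a. a \<in> ?a \<Longrightarrow> {a} \<in> sets (actions D) \<Longrightarrow> 1 / C\<^sub>1 \<le> measure (actions D) {a} \<Longrightarrow>
      emeasure (equal_prob (actions D)) (?a - {a}) \<le> ennreal (1 - e)"
    using equal_prob_avoid[OF eA0 eA_fin C_consts(1)] by blast
  \<comment> \<open>The singleton of the optimal action has mass at least
    \<open>1 / C\<^sub>1\<close> at every state, so a single e serves all states.\<close>
  have explore: "emeasure (equal_prob (actions D)) {a \<in> ?a. ?Y s a} \<le> ennreal (1 - e)" if s: "s \<in> ?s" for s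
  proof -
    have "emeasure (actions D) {astar \<theta>\<^sub>0 s} \<noteq> \<top>"
      using eA_fin emeasure_space[of "actions D" "{astar \<theta>\<^sub>0 s}"] by (auto simp: top_unique)
    then have "1 / C\<^sub>1 \<le> measure (actions D) {astar \<theta>\<^sub>0 s}"
      using bounded_return[OF s single[OF s]] C_consts(1)
      by (simp add: emeasure_eq_ennreal_measure ennreal_mult'[symmetric] field_simps)
    moreover have "{a \<in> ?a. ?Y s a} = ?a - {astar \<theta>\<^sub>0 s}" by auto
    ultimately show ?thesis using e_avoid[OF astar_in[OF \<theta>\<^sub>0 s] single[OF s]] by simp
  qed

  have \<mu>m: "\<mu> \<in> borel_measurable ?SA" and \<nu>m: "\<nu> \<in> borel_measurable ?SA" by (rule A_consts)+
  \<comment> \<open>Integrate the lower bound of (A) at time 0 for an arbitrary first pair: the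
    conditional densities have mass one, so \<mu> is integrable, and squared Hellinger distances are
    at most 2.\<close>
  have dist_fin: "hdist D \<mu> \<theta> \<theta>\<^sub>0 < \<top>" if \<theta>: "\<theta> \<in> ?p" for \<theta>
  proof -
    let ?h = "restrict (\<lambda>_. (s\<^sub>0, astar \<theta>\<^sub>0 s\<^sub>0)) {0..<Suc 0}"
    let ?RN = "\<lambda>j. RN_deriv ?SA (cond_law D ini \<theta>\<^sub>0 \<pi> 0 ?h j)"
    have h: "?h \<in> space (PiM {0..<Suc 0} (\<lambda>_. ?SA))"
      using s\<^sub>0 astar_in[OF \<theta>\<^sub>0 s\<^sub>0] by (auto simp: space_PiM space_state_actions)
    have "(\<integral>\<^sup>+x. ennreal (\<alpha> 0 * \<mu> x) \<partial>?SA) \<le> (\<integral>\<^sup>+x. (\<Sum>j=1..k. ?RN j x) / of_nat k \<partial>?SA)"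
      by (rule nn_integral_mono_AE[OF A_lower[OF \<theta>\<^sub>0 h]])
    also have "\<dots> = (\<Sum>j=1..k. \<integral>\<^sup>+x. ?RN j x \<partial>?SA) / of_nat k"
      by (subst nn_integral_divide) (auto simp: nn_integral_sum)
    also have "\<dots> = (\<Sum>j=1..k. 1) / of_nat k"
      by (intro arg_cong2[where f="(/)"] sum.cong refl c.nn_integral_RN_cond_law[OF h A_densities[OF \<theta>\<^sub>0 h]]) simp
    also have "\<dots> = 1" using A_consts(1) by (simp add: ennreal_divide_self of_nat_less_top)
    also have "1 < (\<top>::ennreal)" by simp
    finally have "(\<integral>\<^sup>+x. ennreal (\<alpha> 0) * ennreal (\<mu> x) \<partial>?SA) < \<top>"
      using A_consts(3)[of 0] by (simp add: ennreal_mult' less_imp_le)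
    then have "ennreal (\<alpha> 0) * (\<integral>\<^sup>+x. ennreal (\<mu> x) \<partial>?SA) < \<top>"
      using \<mu>m by (simp add: nn_integral_cmult)
    then have "(\<integral>\<^sup>+x. ennreal (\<mu> x) \<partial>?SA) < \<top>"
      using A_consts(3)[of 0] by (auto simp: ennreal_mult_less_top)
    then have "2 * (\<integral>\<^sup>+x. ennreal (\<mu> x) \<partial>?SA) < \<top>" by (simp add: ennreal_mult_less_top)
    then have "hdist_sq D \<mu> \<theta> \<theta>\<^sub>0 < \<top>" by (rule le_less_trans[OF hdist_sq_le_mass[OF \<theta> \<theta>\<^sub>0 \<mu>m]])
    then show ?thesis by (auto simp: hdist_eq)
  qed
  have ev_fin: "evidence D (prior t) t H < \<top>" if H: "H \<in> space (hist_space D t)" for t H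
  proof -
    interpret p: mdp_prior D "prior t" by (rule ts.mdp_prior)
    have "evidence D (prior t) t H \<le> (\<integral>\<^sup>+\<theta>. ennreal (C\<^sub>2 ^ t) \<partial>prior t)"
      unfolding evidence_def
      by (intro nn_integral_mono ennreal_leI likelihood_le_power H) (simp_all add: p.space_prior C_trans)
    also have "\<dots> < \<top>" using p.prior.emeasure_space_1 by (simp add: ennreal_mult_less_top)
    finally show ?thesis .
  qed

  obtain J\<^sub>0 where J\<^sub>0: "\<And>j t. J\<^sub>0 \<le> j \<Longrightarrow> k + l \<le> t \<Longrightarrow>
      0 < measure (prior t) (KL_nbhd D ini \<pi> t \<theta>\<^sub>0 (eps_bar k l \<alpha> \<epsilon> t) n) \<and>
      measure (prior t) {\<theta> \<in> ?p. ennreal (real j * \<epsilon> t) < hdist D \<mu> \<theta> \<theta>\<^sub>0 \<and>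
          hdist D \<mu> \<theta> \<theta>\<^sub>0 \<le> ennreal ((real j + 1) * \<epsilon> t)}
        / measure (prior t) (KL_nbhd D ini \<pi> t \<theta>\<^sub>0 (eps_bar k l \<alpha> \<epsilon> t) n)
        \<le> exp (K * real t * (eps_bar k l \<alpha> \<epsilon> t)\<^sup>2 * (real j)\<^sup>2 / 2)"
    using B_prior unfolding eventually_sequentially by blast
  have K: "0 < K" using B_testing by (simp add: testing_constants_def)
  \<comment> \<open>The three requirements are the range of the prior ratio condition, the threshold
    of the tests for shells, and the exponent estimate of
    \<open>posterior_contraction\<close>.\<close>
  define J where "J = max J\<^sub>0 (max 8 (nat \<lceil>6 / K\<rceil>))"
  have J: "J\<^sub>0 \<le> J" "8 \<le> J" "6 \<le> K * real J"
  proof -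
    have "6 / K \<le> real (nat \<lceil>6 / K\<rceil>)" by linarith
    also have "\<dots> \<le> real J" unfolding J_def by (intro of_nat_mono max.coboundedI2 order_refl)
    finally show "6 \<le> K * real J" using K by (simp add: field_simps)
  qed (simp_all add: J_def)
  define A where "A t = {\<theta> \<in> ?p. ennreal (real J * \<epsilon> t) < hdist D \<mu> \<theta> \<theta>\<^sub>0}" for t
  define post where "post t H = emeasure (posterior D (prior t) t H) (A t)" for t H
  have Am: "A t \<in> sets (params D)" for t
  proof -
    note [measurable] = measurable_hdist[OF \<mu>m \<theta>\<^sub>0]
    show ?thesis unfolding A_def by measurable
  qed
  have post_prob: "prob_space (posterior D (prior t) t H)" if "H \<in> space (hist_space D t)" for t H
    by (rule mdp_prior.prob_space_posterior[OF ts.mdp_prior that])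
  have post_real: "post t H = ennreal (measure (posterior D (prior t) t H) (A t))" and post1: "post t H \<le> 1"
    if "H \<in> space (hist_space D t)" for t H
    using prob_space.measure_le_1[OF post_prob[OF that]]
    by (auto simp: post_def finite_measure.emeasure_eq_measure[OF prob_space.finite_measure[OF post_prob[OF that]]])
  have post_m: "post t \<in> borel_measurable (hist_space D t)" for t
    unfolding post_def[abs_def]
    by (rule measurable_compose[OF measurable_prob_algebraD[OF mdp_prior.measurable_posterior[OF ts.mdp_prior]]
        measurable_emeasure_subprob_algebra[OF Am]])

  define R where "R = 2 + 8 * real n ^ n"
  \<comment> \<open>Before time k + l there is no complete block and the posterior mass is only
    bounded by 1.\<close>
  define u where "u t = (if t < k + l then 1 else 0) + R * real t powr (- (real n * (1 - 2 * \<beta>) / 2))" for t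
  have R: "0 \<le> R" by (simp add: R_def)
  have u0: "0 \<le> u t" for t using R by (simp add: u_def)
  have post_mean: "(\<integral>\<^sup>+H. post t H \<partial>hist_law D ini \<theta>\<^sub>0 \<pi> t) \<le> ennreal (u t)" for t
  proof (cases "k + l \<le> t")
    case True
    let ?e = "eps_bar k l \<alpha> \<epsilon> t"
    have t1: "1 \<le> real t" using True A_consts(1) by simp
    have pc: "real t powr (1 - 2 * \<beta>) \<le> real t * ?e\<^sup>2"
    proof -
      have "real t powr (1 - 2 * \<beta>) = real t * (real t powr (- \<beta>))\<^sup>2"
        using t1 by (simp add: powr_diff powr_minus powr_power field_simps flip: powr_numeral powr_powr)
      also have "\<dots> \<le> real t * ?e\<^sup>2" by (intro mult_left_mono power_mono i_rate[OF True]) simp_all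
      finally show ?thesis .
    qed
    have c1: "1 \<le> real t * ?e\<^sup>2"
      using order_trans[OF ge_one_powr_ge_zero pc] t1 i_beta by simp
    have "(\<integral>\<^sup>+H. post t H \<partial>hist_law D ini \<theta>\<^sub>0 \<pi> t) \<le>
      ennreal (2 * (real t * ?e\<^sup>2) powr (- real n / 2) + 8 * exp (- (real t * ?e\<^sup>2)))"
      unfolding post_def A_def
      by (rule posterior_model.posterior_contraction[where J=J and \<epsilon>=\<epsilon>, OF pm B_testing True \<mu>m \<nu>m A_consts(3) B_eps(1) dist_fin ev_fin
          B_entropy[OF True] conjunct1[OF J\<^sub>0[OF J(1) True]] conjunct2[OF J\<^sub>0[OF order_trans[OF J(1)] True]] J(2,3) c1])
    also have "\<dots> \<le> ennreal (u t)"
      using contraction_rate[OF pc t1 i_beta(2), of n] True by (intro ennreal_leI) (simp add: u_def R_def)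
    finally show ?thesis .
  next
    case False
    have "(\<integral>\<^sup>+H. post t H \<partial>hist_law D ini \<theta>\<^sub>0 \<pi> t) \<le> (\<integral>\<^sup>+H. 1 \<partial>hist_law D ini \<theta>\<^sub>0 \<pi> t)"
      by (intro nn_integral_mono post1) (simp add: c.space_hist_law)
    also have "\<dots> = 1" using prob_space.emeasure_space_1[OF c.prob_space_hist_law] by simp
    also have "\<dots> \<le> ennreal (u t)" using False R by (simp add: u_def)
    finally show ?thesis .
  qed
  have u_sum: "summable u"
  proof -
    have "summable (\<lambda>t. if t < k + l then 1 else (0::real))"
      by (rule summable_finite[of "{..<k + l}"]) auto
    \<comment> \<open>Summability holds because n (1 - 2 \<beta>) / 2 exceeds 1, by condition
      (i).\<close>
    moreover have "summable (\<lambda>t. real t powr (- (real n * (1 - 2 * \<beta>) / 2)))"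
      using i_beta(3) by (subst summable_real_powr_iff) simp
    ultimately show ?thesis unfolding u_def[abs_def] by (intro summable_add summable_mult)
  qed

  let ?W = "process_law D ini \<theta>\<^sub>0 \<pi>"
  define S where "S = suminf u + 1"
  have S: "0 < S" using suminf_nonneg[OF u_sum u0] by (simp add: S_def)
  \<comment> \<open>The total posterior mass of the exceptional sets along one trajectory.\<close>
  define Z where "Z \<omega> = (\<Sum>t. post t (hist_at t \<omega>))" for \<omega>
  have post_at_m: "(\<lambda>\<omega>. post t (hist_at t \<omega>)) \<in> borel_measurable ?W" for t
    unfolding c.measurable_process_law by (rule measurable_compose[OF measurable_hist_at post_m])
  have Zm: "Z \<in> borel_measurable ?W"
    unfolding Z_def[abs_def] by (intro borel_measurable_suminf_order post_at_m)
  have Zint: "(\<integral>\<^sup>+\<omega>. Z \<omega> \<partial>?W) \<le> ennreal S"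
  proof -
    have "(\<integral>\<^sup>+\<omega>. Z \<omega> \<partial>?W) = (\<Sum>t. \<integral>\<^sup>+\<omega>. post t (hist_at t \<omega>) \<partial>?W)"
      unfolding Z_def by (rule nn_integral_suminf[OF post_at_m])
    also have "\<dots> \<le> (\<Sum>t. ennreal (u t))"
      by (intro suminf_le) (use post_mean in \<open>auto simp: c.nn_integral_hist_law[OF post_m, symmetric]\<close>)
    also have "\<dots> = ennreal (suminf u)" by (rule suminf_ennreal2[OF u0 u_sum])
    also have "\<dots> \<le> ennreal S" by (intro ennreal_leI) (simp add: S_def)
    finally show ?thesis .
  qed

  \<comment> \<open>An integrable \<open>Z\<close> is finite almost surely, and the terms of a
    convergent series tend to zero. Larger M only shrinks the sets, so every M from J on
    works.\<close>
  have claim2: "\<forall>\<^sub>F M in at_top. AE \<omega> in ?W. (\<lambda>T. measure (posterior D (prior T) T (hist_at T \<omega>))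
           {\<theta> \<in> ?p. hdist D \<mu> \<theta> \<theta>\<^sub>0 > ennreal (M * \<epsilon> T)}) \<longlonglongrightarrow> 0"
    using eventually_ge_at_top[of "real J"]
  proof eventually_elim
    case (elim M)
    have "AE \<omega> in ?W. Z \<omega> \<noteq> \<infinity>"
      by (rule nn_integral_noteq_infinite[OF Zm]) (use Zint in \<open>auto simp: top_unique\<close>)
    then show ?case
    proof (rule AE_mp, intro AE_I2 impI)
      fix \<omega> assume \<omega>: "\<omega> \<in> space ?W" and fin: "Z \<omega> \<noteq> \<infinity>"
      note H = c.hist_at_in_space[OF \<omega>]
      let ?q = "\<lambda>t. measure (posterior D (prior t) t (hist_at t \<omega>)) (A t)"
      have "(\<Sum>t. ennreal (?q t)) \<noteq> \<top>" using fin by (simp add: Z_def post_real[OF H])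
      then have "summable ?q" by (intro summable_suminf_not_top) auto
      then have lim: "?q \<longlonglongrightarrow> 0" by (rule summable_LIMSEQ_zero)
      show "(\<lambda>T. measure (posterior D (prior T) T (hist_at T \<omega>))
           {\<theta> \<in> ?p. hdist D \<mu> \<theta> \<theta>\<^sub>0 > ennreal (M * \<epsilon> T)}) \<longlonglongrightarrow> 0"
      proof (rule tendsto_sandwich[OF _ _ tendsto_const lim]; intro always_eventually allI)
        fix T
        show "measure (posterior D (prior T) T (hist_at T \<omega>)) {\<theta> \<in> ?p. hdist D \<mu> \<theta> \<theta>\<^sub>0 > ennreal (M * \<epsilon> T)} \<le> ?q T"
        proof (rule finite_measure.finite_measure_mono[OF prob_space.finite_measure[OF post_prob[OF H]]])
          have "ennreal (real J * \<epsilon> T) \<le> ennreal (M * \<epsilon> T)"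
            using elim B_eps(1)[of T] by (intro ennreal_leI mult_right_mono) auto
          then show "{\<theta> \<in> ?p. hdist D \<mu> \<theta> \<theta>\<^sub>0 > ennreal (M * \<epsilon> T)} \<subseteq> A T" by (auto simp: A_def)
          show "A T \<in> sets (posterior D (prior T) T (hist_at T \<omega>))"
            using Am by (simp add: mdp_prior.sets_posterior[OF ts.mdp_prior])
        qed
      qed simp
    qed
  qed

  \<comment> \<open>The bound on the change of transition densities outside \<open>A t\<close> that
    the Hoelder condition of (C) provides.\<close>
  define h where "h t = C\<^sub>3 * (real J * \<epsilon> t) powr \<rho>" for t
  have h0: "0 \<le> h t" for t using C_consts(3) by (simp add: h_def)
  have h_lim: "(\<lambda>t. 2 * (\<gamma> * h t * (2 * C\<^sub>4 / (1 - \<gamma>)) * m / (1 - \<gamma>))) \<longlonglongrightarrow> 0"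
  proof -
    have "(\<lambda>t. (real J * \<epsilon> t) powr \<rho>) \<longlonglongrightarrow> 0"
    proof (rule tendsto_zero_powrI[where b=\<rho>])
      show "(\<lambda>t. real J * \<epsilon> t) \<longlonglongrightarrow> 0" using tendsto_mult_right_zero[OF B_eps(2)] by simp
      show "\<forall>\<^sub>F t in sequentially. 0 \<le> real J * \<epsilon> t" using B_eps(1) by (simp add: less_imp_le)
    qed (use C_consts(5) in auto)
    then have "(\<lambda>t. 2 * (\<gamma> * (C\<^sub>3 * (real J * \<epsilon> t) powr \<rho>) * (2 * C\<^sub>4 / (1 - \<gamma>)) * m / (1 - \<gamma>)))
        \<longlonglongrightarrow> 2 * (\<gamma> * (C\<^sub>3 * 0) * (2 * C\<^sub>4 / (1 - \<gamma>)) * m / (1 - \<gamma>))"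
      by (intro tendsto_intros) (use \<gamma>1 in auto)
    then show ?thesis by (simp add: h_def)
  qed
  obtain t\<^sub>1 where t\<^sub>1: "\<And>t. t\<^sub>1 \<le> t \<Longrightarrow> 2 * (\<gamma> * h t * (2 * C\<^sub>4 / (1 - \<gamma>)) * m / (1 - \<gamma>)) < b"
    using order_tendstoD(2)[OF h_lim ii_gap(1)] unfolding eventually_sequentially by blast
  have stable: "astar \<theta> s = astar \<theta>\<^sub>0 s" if t: "t\<^sub>1 \<le> t" and \<theta>: "\<theta> \<in> ?p" "\<theta> \<notin> A t" and s: "s \<in> ?s" for t \<theta> s
  proof (rule o.astar_stable[OF \<theta>(1) \<theta>\<^sub>0 gap[OF s] s m h0 _ t\<^sub>1[OF t]])
    fix s a s' assume sas: "s \<in> ?s" "a \<in> ?a" "s' \<in> ?s"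
    have "hdist D \<mu> \<theta> \<theta>\<^sub>0 \<le> ennreal (real J * \<epsilon> t)" using \<theta> by (simp add: A_def not_less)
    then have "enn2real (hdist D \<mu> \<theta> \<theta>\<^sub>0) \<le> real J * \<epsilon> t"
      using B_eps(1)[of t] by (intro enn2real_leI) auto
    then have "C\<^sub>3 * enn2real (hdist D \<mu> \<theta> \<theta>\<^sub>0) powr \<rho> \<le> h t"
      unfolding h_def using C_consts(3,5) by (intro mult_left_mono powr_mono2) auto
    then show "\<bar>tdens D \<theta> s a s' - tdens D \<theta>\<^sub>0 s a s'\<bar> \<le> h t"
      using C_holder[OF \<theta>(1) sas] by linarith
  qed

  \<comment> \<open>The three summands bound a wrong action due to the posterior, one due to
    exploration, and, trivially by 1, one at the finitely many times before the optimal actions are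
    stable.\<close>
  define p where "p t H = measure (posterior D (prior t) t H) (A t) + \<delta> t * (1 - e) + (if t < t\<^sub>1 then 1 else 0)" for t H
  have p_m: "p t \<in> borel_measurable (hist_space D t)" for t
  proof -
    have [measurable]: "(\<lambda>H. measure (posterior D (prior t) t H) (A t)) \<in> borel_measurable (hist_space D t)"
      by (rule measurable_compose[OF measurable_prob_algebraD[OF mdp_prior.measurable_posterior[OF ts.mdp_prior]]
          measurable_measure_subprob_algebra[OF Am]])
    show ?thesis unfolding p_def[abs_def] by measurable
  qed
  have p0: "0 \<le> p t H" for t H using rates[of t] e by (simp add: p_def)
  have Yp: "emeasure (\<pi> t H) {a \<in> ?a. ?Y (snd H) a} \<le> ennreal (p t H)" if H: "H \<in> space (hist_space D t)" for t H
  proof (cases "t < t\<^sub>1")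
    case True
    have "emeasure (\<pi> t H) {a \<in> ?a. ?Y (snd H) a} \<le> 1"
      by (rule prob_space.measure_le_1[OF c.policy_prob_space(1)[OF H]])
    also have "\<dots> \<le> ennreal (p t H)" using True rates[of t] e by (simp add: p_def)
    finally show ?thesis .
  next
    case False
    have s: "snd H \<in> ?s" using H by (simp add: space_hist_space)
    have "emeasure (\<pi> t H) {a \<in> ?a. ?Y (snd H) a} \<le>
        post t H + ennreal (\<delta> t) * emeasure (equal_prob (actions D)) {a \<in> ?a. ?Y (snd H) a}"
      unfolding pi post_def
      by (rule ts.emeasure_ts_policy_le[OF H Ym_sec[OF s] Am]) (use stable[of t _ "snd H"] s False in auto)
    also have "\<dots> \<le> post t H + ennreal (\<delta> t) * ennreal (1 - e)"
      by (intro add_left_mono mult_left_mono explore[OF s]) simp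
    also have "\<dots> = ennreal (p t H)"
      using False e rates[of t] by (simp add: p_def post_real[OF H] ennreal_mult'[symmetric])
    finally show ?thesis .
  qed
  have f0: "0 \<le> f t" for t using iii(2)[of t] sum_nonneg[of "{..t}" \<delta>] rates by (meson order_trans)
  \<comment> \<open>Replacing the partial sums of the posterior masses by \<open>Z\<close> makes the
    bound uniform in T.\<close>
  have sum_p: "ennreal (\<Sum>t<Suc T. p t (hist_at t \<omega>)) \<le> ennreal ((1 - e) * f T + real t\<^sub>1) + Z \<omega>"
    if \<omega>: "\<omega> \<in> space ?W" for T \<omega>
  proof -
    note H = c.hist_at_in_space[OF \<omega>]
    let ?q = "\<lambda>t. measure (posterior D (prior t) t (hist_at t \<omega>)) (A t)"
    have "(\<Sum>t<Suc T. if t < t\<^sub>1 then 1 else (0::real)) = (\<Sum>t\<in>{..<Suc T} \<inter> {..<t\<^sub>1}. 1)"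
      by (subst sum.inter_restrict) auto
    also have "\<dots> \<le> (\<Sum>t<t\<^sub>1. 1)" by (intro sum_mono2) auto
    finally have s1: "(\<Sum>t<Suc T. if t < t\<^sub>1 then 1 else (0::real)) \<le> real t\<^sub>1" by simp
    have "(\<Sum>t<Suc T. \<delta> t * (1 - e)) = (\<Sum>t\<le>T. \<delta> t) * (1 - e)"
      by (simp add: sum_distrib_right lessThan_Suc_atMost)
    also have "\<dots> \<le> f T * (1 - e)" by (intro mult_right_mono iii(2)) (use e in simp)
    finally have s2: "(\<Sum>t<Suc T. \<delta> t * (1 - e)) \<le> (1 - e) * f T" by (simp add: mult.commute)
    have "(\<Sum>t<Suc T. p t (hist_at t \<omega>)) \<le> (\<Sum>t<Suc T. ?q t) + ((1 - e) * f T + real t\<^sub>1)"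
      using s1 s2 by (simp only: p_def sum.distrib)
    then have "ennreal (\<Sum>t<Suc T. p t (hist_at t \<omega>)) \<le> ennreal ((\<Sum>t<Suc T. ?q t) + ((1 - e) * f T + real t\<^sub>1))"
      by (rule ennreal_leI)
    also have "\<dots> = (\<Sum>t<Suc T. ennreal (?q t)) + ennreal ((1 - e) * f T + real t\<^sub>1)"
    proof -
      have "0 \<le> (\<Sum>t<Suc T. ?q t)" by (intro sum_nonneg measure_nonneg)
      moreover have "0 \<le> (1 - e) * f T + real t\<^sub>1" using e f0[of T] by simp
      moreover have "(\<Sum>t<Suc T. ennreal (?q t)) = ennreal (\<Sum>t<Suc T. ?q t)"
        by (rule sum_ennreal) simp
      ultimately show ?thesis by (simp only: ennreal_plus)
    qed
    also have "(\<Sum>t<Suc T. ennreal (?q t)) \<le> (\<Sum>t. ennreal (?q t))"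
      by (rule sum_le_suminf) auto
    also have "(\<Sum>t. ennreal (?q t)) = Z \<omega>" by (simp add: Z_def post_real[OF H])
    finally show ?thesis by (simp add: add.commute add_right_mono)
  qed
  \<comment> \<open>On the unit interval exp e is at most 1 + e + e^2, and (e + e^2) (1 - e) = e -
    e^3. This admits the exponential parameter c = e with the rate r = 1 - e.\<close>
  have exp_e: "(exp e - 1) * (1 - e) \<le> e"
  proof -
    have "(exp e - 1) * (1 - e) \<le> (e + e\<^sup>2) * (1 - e)"
      using exp_bound[of e] e by (intro mult_right_mono) auto
    also have "\<dots> = e - e ^ 3" by (simp add: power2_eq_square power3_eq_cube algebra_simps)
    finally show ?thesis using e by (simp add: order_trans)
  qed
  \<comment> \<open>\<open>t\<^sub>1\<close>, \<open>S\<close> and e are fixed by the model, so the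
    value depends on \<eta> alone.\<close>
  define B where "B \<eta> = ((exp e - 1) * (real t\<^sub>1 + 2 * S / \<eta>) + ln (2 / \<eta>)) / e" for \<eta>
  \<comment> \<open>From here on f(T) is at least 1, hence at most each of its powers with exponent
    1 + d. This is the only condition on T, so the threshold is the same for all d and
    \<eta>.\<close>
  obtain T\<^sub>0 where T\<^sub>0: "\<And>T. T\<^sub>0 \<le> T \<Longrightarrow> 1 \<le> f T"
    using iii(3) unfolding filterlim_at_top eventually_sequentially by blast
  have claim1: "measure ?W {\<omega> \<in> space ?W.
      (\<Sum>t\<le>T. of_bool (snd (\<omega> t) \<noteq> astar \<theta>\<^sub>0 (fst (\<omega> t)))) \<le> f T powr (1 + d) + B \<eta>} \<ge> 1 - \<eta>"
    if \<eta>: "0 < \<eta>" and T: "T\<^sub>0 \<le> T" and d: "0 < d" for \<eta> T d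
  proof -
    interpret W: prob_space ?W by (rule c.prob_space_process_law)
    have e1: "0 \<le> 1 - e" using e by simp
    note ct = c.counting_tail[where Y="?Y" and p=p and c=e and r="1 - e" and Z=Z and S=S and T="Suc T" and F="f T" and K="real t\<^sub>1",
        OF Ym p_m p0 Yp e(1) exp_e \<eta> Zm Zint S sum_p f0 e1 of_nat_0_le_iff]
    have Nm: "(\<lambda>\<omega>. \<Sum>t<Suc T. of_bool (?Y (fst (\<omega> t)) (snd (\<omega> t))) :: real) \<in> borel_measurable ?W"
      by (rule ct(1))
    have "1 - \<eta> \<le> measure ?W {\<omega> \<in> space ?W. (\<Sum>t<Suc T. of_bool (?Y (fst (\<omega> t)) (snd (\<omega> t))) :: real) \<le> f T + B \<eta>}"
      unfolding B_def by (rule ct(2))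
    also have "\<dots> \<le> measure ?W {\<omega> \<in> space ?W. (\<Sum>t<Suc T. of_bool (?Y (fst (\<omega> t)) (snd (\<omega> t))) :: real) \<le> f T powr (1 + d) + B \<eta>}"
    proof (rule W.finite_measure_mono)
      have "f T powr 1 \<le> f T powr (1 + d)" using T\<^sub>0[OF T] d by (intro powr_mono) auto
      then have "f T \<le> f T powr (1 + d)" using T\<^sub>0[OF T] by simp
      then show "{\<omega> \<in> space ?W. (\<Sum>t<Suc T. of_bool (?Y (fst (\<omega> t)) (snd (\<omega> t))) :: real) \<le> f T + B \<eta>} \<subseteq>
        {\<omega> \<in> space ?W. (\<Sum>t<Suc T. of_bool (?Y (fst (\<omega> t)) (snd (\<omega> t))) :: real) \<le> f T powr (1 + d) + B \<eta>}"
        by auto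
      show "{\<omega> \<in> space ?W. (\<Sum>t<Suc T. of_bool (?Y (fst (\<omega> t)) (snd (\<omega> t))) :: real) \<le> f T powr (1 + d) + B \<eta>} \<in> sets ?W"
        using Nm by measurable
    qed
    finally show ?thesis by (simp only: lessThan_Suc_atMost)
  qed
  show ?thesis using claim1 claim2 by blast
qed

end
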